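(* Let $N\ge 2$ be an integer, let $\beta>N$ and let $p\ge 1$. There exists a finite constant $C(N,\beta,p)$, depending only on $N,\beta,p$, such that for every integer $n\ge 1$ and every $z\in\mathbb{R}$, $$\left|\mathbb{P}_{n,\beta}\left(W_n/B\le z\right)-\Phi(z)\right|\le \frac{C(N,\beta,p)}{(1+|z|)^p\,n^{1/2}},$$ where $W_n$ is the centred and rescaled squared length of the total spin in the mean-field classical $N$-vector model with $n$ spins at inverse temperature $\beta$, namely $$W_n=\sqrt{n}\left(\frac{\beta^2}{n^2b^2}|S_n|^2-1\right),$$ and $B>0$ is the square root of $$B^2=\frac{4\beta^2}{(1-\beta f'(b))b^2}\left[1-\frac{(N-1)f(b)}{b}-(f(b))^2\right].$$
   Context: Model: $\mathbb{S}^{N-1}$ is the unit sphere in $\mathbb{R}^N$, $\mu$ is the uniform probability measure on $\mathbb{S}^{N-1}$, $\Omega_n=(\mathbb{S}^{N-1})^n$, and $\mathbb{P}_n=\mu\times\dots\times\mu$ is the product measure on $\Omega_n$. For $\sigma=(\sigma_1,\dots,\sigma_n)\in\Omega_n$ the Hamiltonian is $$H_n(\sigma)=-\frac{1}{2n}\sum_{i=1}^n\sum_{j=1}^n\langle\sigma_i,\sigma_j\rangle,$$ with $\langle\cdot,\cdot\rangle$ the inner product in $\mathbb{R}^N$. The Gibbs measure $\mathbb{P}_{n,\beta}$ on $\Omega_n$ is given by $$d\mathbb{P}_{n,\beta}(\sigma)=\frac{1}{Z_{n,\beta}}\exp(-\beta H_n(\sigma))\,d\mathbb{P}_n(\sigma),\qquad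 Z_{n,\beta}=\int_{\Omega_n}\exp(-\beta H_n(\sigma))\,d\mathbb{P}_n(\sigma).$$ The configuration $\sigma$ is distributed according to $\mathbb{P}_{n,\beta}$, $S_n=\sum_{j=1}^n\sigma_j$ is the total spin, and $|\cdot|$ is the Euclidean norm on $\mathbb{R}^N$. Special functions: $I_\nu(x)=\sum_{s=0}^\infty\frac{1}{s!\,\Gamma(s+\nu+1)}\left(\frac{x}{2}\right)^{\nu+2s}$ is the modified Bessel function of the first kind, and $$f(x)=\frac{I_{N/2}(x)}{I_{(N/2)-1}(x)},\quad x>0.$$ For $\beta>N$, $b$ denotes the unique strictly positive solution of the equation $x-\beta f(x)=0$ (known to exist and be unique). $\Phi$ is the standard normal distribution function. *)

theory Defs
  imports "HOL-Probability.Probability"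
begin

section \<open>The uniform measure on the unit sphere\<close>

text \<open>
  The uniform distribution on the sphere is the law of \<open>X / |X|\<close> with \<open>X\<close> uniform on the
  unit ball (\<open>sgn\<close> is normalisation; the point 0, which it fixes, is a null set). It is defined
  on the Borel sets of the sphere. Rotation invariance, which characterises it among the
  probability measures on the sphere, is proved below.
\<close>

definition uniform_sphere :: "(real ^ 'n) measure" where
  "uniform_sphere =
     restrict_space (distr (uniform_measure lborel (ball 0 1)) borel sgn) (sphere 0 1)"

lemma space_uniform_sphere [simp]: "space uniform_sphere = sphere 0 1"
  by (simp add: uniform_sphere_def space_restrict_space)

lemma sets_uniform_sphere: "sets uniform_sphere = sets (restrict_space borel (sphere 0 1))"
  by (simp add: uniform_sphere_def sets_restrict_space)

lemma borel_measurable_sgn_vec [measurable]: "(sgn :: real ^ 'n \<Rightarrow> real ^ 'n) \<in> borel_measurable borel"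
  unfolding sgn_div_norm by measurable

lemma emeasure_uniform_sphere:
  fixes A :: "(real ^ 'n) set"
  assumes "A \<in> sets borel" "A \<subseteq> sphere 0 1"
  shows "emeasure uniform_sphere A =
    emeasure lborel (sgn -` A \<inter> ball 0 1) / emeasure lborel (ball (0 :: real ^ 'n) 1)"
proof -
  have [measurable]: "A \<in> sets borel" by fact
  have "emeasure uniform_sphere A
      = emeasure (distr (uniform_measure lborel (ball 0 1)) borel sgn) A"
    unfolding uniform_sphere_def using assms by (subst emeasure_restrict_space) auto
  also have "\<dots> = emeasure (uniform_measure lborel (ball 0 1)) (sgn -` A)"
    by (subst emeasure_distr) auto
  also have "sgn -` A \<in> sets lborel"
    using measurable_sets[OF borel_measurable_sgn_vec assms(1)] by simp
  then have "emeasure (uniform_measure lborel (ball 0 1)) (sgn -` A)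
      = emeasure lborel (ball 0 1 \<inter> sgn -` A) / emeasure lborel (ball (0 :: real ^ 'n) 1)"
    by (subst emeasure_uniform_measure) auto
  finally show ?thesis by (simp add: Int_commute)
qed

lemma prob_space_uniform_sphere: "prob_space (uniform_sphere :: (real ^ 'n) measure)"
proof
  let ?B = "ball 0 1 :: (real ^ 'n) set"
  have fin: "emeasure lborel ?B \<noteq> \<infinity>"
    using emeasure_lborel_ball_finite[of "0 :: real ^ 'n" 1] by simp
  have pos: "emeasure lborel ?B \<noteq> 0"
    using content_ball_pos[of 1 "0 :: real ^ 'n"] by (auto simp: measure_def)
  have eq: "sgn -` sphere 0 1 \<inter> ?B = ?B - {0}"
    by (auto simp: norm_sgn)
  have "emeasure lborel (?B - {0}) = emeasure lborel ?B"
    by (rule emeasure_Diff_null_set) auto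
  then show "emeasure uniform_sphere (space (uniform_sphere :: (real ^ 'n) measure)) = 1"
    using fin pos by (simp add: emeasure_uniform_sphere eq top_unique less_top)
qed

lemma nn_integral_lborel_translate:
  fixes f :: "'a::euclidean_space \<Rightarrow> ennreal"
  assumes "f \<in> borel_measurable borel"
  shows "(\<integral>\<^sup>+x. f (c + x) \<partial>lborel) = (\<integral>\<^sup>+x. f x \<partial>lborel)"
proof -
  have "(\<integral>\<^sup>+x. f x \<partial>lborel) = (\<integral>\<^sup>+x. f x \<partial>distr lborel borel ((+) c))"
    by (simp add: lborel_distr_plus)
  also have "\<dots> = (\<integral>\<^sup>+x. f (c + x) \<partial>lborel)"
    using assms by (subst nn_integral_distr) auto
  finally show ?thesis ..
qed

lemma emeasure_lborel_orthogonal_vimage: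
  fixes T :: "'a::euclidean_space \<Rightarrow> 'a"
  assumes T: "orthogonal_transformation T" and A: "A \<in> sets borel"
  shows "emeasure lborel (T -` A) = emeasure lborel A"
proof -
  define B where "B = ball (0 :: 'a) 1"
  have lin: "linear T" and T_norm: "norm (T x) = norm x" for x
    using T by (auto simp: orthogonal_transformation)
  obtain U where U: "T (U x) = x" for x
    using orthogonal_transformation_surj[OF T] by (metis surjD)
  have [measurable]: "T \<in> borel_measurable borel"
    using lin by (simp add: borel_measurable_continuous_onI linear_continuous_on linear_conv_bounded_linear)
  have [measurable]: "A \<in> sets borel" "B \<in> sets borel"
    using A by (auto simp: B_def)
  have fin: "emeasure lborel B \<noteq> \<infinity>" "emeasure lborel B \<noteq> 0"
    using emeasure_lborel_ball_finite[of "0 :: 'a" 1] content_ball_pos[of 1 "0 :: 'a"]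
    by (auto simp: measure_def B_def)
  have inner1: "(\<integral>\<^sup>+y. indicator B (x - T y) \<partial>lborel) = emeasure lborel B" for x
  proof -
    have "(\<integral>\<^sup>+y. indicator B (x - T y) \<partial>lborel)
        = (\<integral>\<^sup>+y. indicator B (x - T (U x + y)) \<partial>lborel)"
      by (rule nn_integral_lborel_translate[symmetric]) measurable
    also have "\<dots> = (\<integral>\<^sup>+y. indicator B y \<partial>lborel)"
      by (intro nn_integral_cong) (simp add: linear_add[OF lin] U B_def T_norm indicator_def)
    finally show ?thesis by simp
  qed
  have inner2: "(\<integral>\<^sup>+y. indicator A (x + T y) \<partial>lborel) = emeasure lborel (T -` A)" for x
  proof -
    have "(\<integral>\<^sup>+y. indicator A (x + T y) \<partial>lborel)
        = (\<integral>\<^sup>+y. indicator A (x + T (- U x + y)) \<partial>lborel)"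
      by (rule nn_integral_lborel_translate[symmetric]) measurable
    also have "\<dots> = (\<integral>\<^sup>+y. indicator (T -` A) y \<partial>lborel)"
      by (intro nn_integral_cong) (simp add: linear_diff[OF lin] U indicator_def)
    also have "\<dots> = emeasure lborel (T -` A)"
      by (rule nn_integral_indicator) (use measurable_sets[of T borel borel A] in auto)
    finally show ?thesis .
  qed
  have "emeasure lborel A * emeasure lborel B
      = (\<integral>\<^sup>+x. indicator A x * emeasure lborel B \<partial>lborel)"
    by (simp add: nn_integral_multc)
  also have "\<dots> = (\<integral>\<^sup>+x. \<integral>\<^sup>+y. indicator A x * indicator B (x - T y) \<partial>lborel \<partial>lborel)"
    by (simp add: nn_integral_cmult inner1)
  also have "\<dots> = (\<integral>\<^sup>+y. \<integral>\<^sup>+x. indicator A x * indicator B (x - T y) \<partial>lborel \<partial>lborel)"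
    by (rule lborel_pair.Fubini') measurable
  also have "\<dots> = (\<integral>\<^sup>+y. \<integral>\<^sup>+x. indicator A (T y + x) * indicator B (T y + x - T y) \<partial>lborel \<partial>lborel)"
    by (intro nn_integral_cong nn_integral_lborel_translate[symmetric]) measurable
  also have "\<dots> = (\<integral>\<^sup>+x. \<integral>\<^sup>+y. indicator A (T y + x) * indicator B (T y + x - T y) \<partial>lborel \<partial>lborel)"
    by (rule lborel_pair.Fubini') measurable
  also have "\<dots> = (\<integral>\<^sup>+x. emeasure lborel (T -` A) * indicator B x \<partial>lborel)"
    by (simp add: nn_integral_multc inner2 add.commute[of "T _"])
  also have "\<dots> = emeasure lborel (T -` A) * emeasure lborel B"
    by (simp add: nn_integral_cmult)
  finally show ?thesis
    using fin by (simp add: mult.commute[of _ "emeasure lborel B"] ennreal_mult_cancel_left)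
qed

lemma uniform_sphere_rotation_invariant:
  fixes T :: "real ^ 'n \<Rightarrow> real ^ 'n"
  assumes T: "orthogonal_transformation T"
  shows "distr uniform_sphere uniform_sphere T = uniform_sphere"
proof -
  have T_norm: "norm (T x) = norm x" for x
    using T by (rule orthogonal_transformation_norm)
  have lin: "linear T" using T by (rule orthogonal_transformation_linear)
  have T_borel: "T \<in> borel_measurable borel"
    using lin by (simp add: borel_measurable_continuous_onI linear_continuous_on linear_conv_bounded_linear)
  have T_meas: "T \<in> measurable uniform_sphere uniform_sphere"
    unfolding measurable_cong_sets[OF sets_uniform_sphere sets_uniform_sphere]
    by (rule measurable_restrict_space3[OF T_borel]) (auto simp: T_norm)
  have T_sgn: "T (sgn x) = sgn (T x)" for x
    using linear_cmul[OF lin] by (simp add: sgn_div_norm T_norm)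
  show ?thesis
  proof (rule measure_eqI)
    fix A assume "A \<in> sets (distr uniform_sphere uniform_sphere T)"
    then have A': "A \<in> sets (uniform_sphere :: (real ^ 'n) measure)" by simp
    then have A: "A \<in> sets borel" "A \<subseteq> sphere 0 1"
      by (auto simp: sets_uniform_sphere sets_restrict_space)
    let ?C = "sgn -` A \<inter> ball 0 1"
    have C: "?C \<in> sets borel"
      using measurable_sets[OF borel_measurable_sgn_vec A(1)] by auto
    have TA: "T -` A \<in> sets borel" "T -` A \<subseteq> sphere 0 1"
      using measurable_sets[OF T_borel A(1)] A(2) T_norm by auto
    have "emeasure (distr uniform_sphere uniform_sphere T) A = emeasure uniform_sphere (T -` A)"
      using T_meas A' TA(2) by (simp add: emeasure_distr Int_absorb2)
    also have "\<dots> = emeasure lborel (sgn -` (T -` A) \<inter> ball 0 1)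
        / emeasure lborel (ball (0 :: real ^ 'n) 1)"
      by (rule emeasure_uniform_sphere[OF TA])
    also have "sgn -` (T -` A) \<inter> ball 0 1 = T -` ?C"
      by (auto simp: T_sgn T_norm)
    also have "emeasure lborel (T -` ?C) = emeasure lborel ?C"
      by (rule emeasure_lborel_orthogonal_vimage[OF T C])
    also have "emeasure lborel ?C / emeasure lborel (ball (0 :: real ^ 'n) 1)
        = emeasure uniform_sphere A"
      by (rule emeasure_uniform_sphere[OF A, symmetric])
    finally show "emeasure (distr uniform_sphere uniform_sphere T) A = emeasure uniform_sphere A" .
  qed simp
qed


section \<open>The mean-field classical N-vector model\<close>

text \<open>
  The dimension \<open>N\<close> is \<open>CARD('n)\<close>. A configuration of \<open>n\<close> spins is a function on \<open>{1..n}\<close> with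
  values in the sphere (extensional, that is \<open>undefined\<close> outside \<open>{1..n}\<close>).
\<close>

definition config_measure :: "nat \<Rightarrow> (nat \<Rightarrow> real ^ 'n) measure" where
  "config_measure n = PiM {1..n} (\<lambda>_. uniform_sphere)"

definition hamiltonian :: "nat \<Rightarrow> (nat \<Rightarrow> real ^ 'n) \<Rightarrow> real" where
  "hamiltonian n \<sigma> = - (1 / (2 * real n)) * (\<Sum>i = 1..n. \<Sum>j = 1..n. \<sigma> i \<bullet> \<sigma> j)"

definition partition_function :: "'n::finite itself \<Rightarrow> nat \<Rightarrow> real \<Rightarrow> real" where
  "partition_function _ n \<beta> =
     (\<integral>\<sigma>. exp (- \<beta> * hamiltonian n \<sigma>) \<partial>(config_measure n :: (nat \<Rightarrow> real ^ 'n) measure))"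

definition gibbs_measure :: "nat \<Rightarrow> real \<Rightarrow> (nat \<Rightarrow> real ^ 'n) measure" where
  "gibbs_measure n \<beta> = density (config_measure n)
     (\<lambda>\<sigma>. ennreal (exp (- \<beta> * hamiltonian n \<sigma>) / partition_function TYPE('n) n \<beta>))"

definition total_spin :: "nat \<Rightarrow> (nat \<Rightarrow> real ^ 'n) \<Rightarrow> real ^ 'n" where
  "total_spin n \<sigma> = (\<Sum>j = 1..n. \<sigma> j)"


section \<open>Bessel functions and the limiting constants\<close>

text \<open>Meant for \<open>x > 0\<close> only: the \<open>powr\<close> convention gives the value 0 at \<open>x = 0\<close>, even for \<open>\<nu> = 0\<close>.\<close>

definition bessel_I :: "real \<Rightarrow> real \<Rightarrow> real" where
  "bessel_I \<nu> x =
     (\<Sum>s. 1 / (fact s * Gamma (real s + \<nu> + 1)) * (x / 2) powr (\<nu> + 2 * real s))"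

definition bessel_ratio :: "nat \<Rightarrow> real \<Rightarrow> real" where
  "bessel_ratio N x = bessel_I (real N / 2) x / bessel_I (real N / 2 - 1) x"

definition b_root :: "nat \<Rightarrow> real \<Rightarrow> real" where
  "b_root N \<beta> = (THE x. x > 0 \<and> x - \<beta> * bessel_ratio N x = 0)"

definition B_squared :: "nat \<Rightarrow> real \<Rightarrow> real" where
  "B_squared N \<beta> = (let b = b_root N \<beta>; f = bessel_ratio N in
     4 * \<beta>\<^sup>2 / ((1 - \<beta> * deriv f b) * b\<^sup>2) * (1 - (real N - 1) * f b / b - (f b)\<^sup>2))"

definition W_stat :: "nat \<Rightarrow> real \<Rightarrow> (nat \<Rightarrow> real ^ 'n) \<Rightarrow> real" where
  "W_stat n \<beta> \<sigma> =
     sqrt (real n) *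
       (\<beta>\<^sup>2 / ((real n)\<^sup>2 * (b_root CARD('n) \<beta>)\<^sup>2) * (norm (total_spin n \<sigma>))\<^sup>2 - 1)"

end

theory Submission
  imports Defs
begin

text \<open>
  The proof is Stein's method with an exact integration by parts in place of an exchangeable pair.
  Write \<open>N\<close> for the dimension, \<open>R\<close> for the squared norm of the mean spin \<open>S / n\<close>, \<open>f\<close> for the Bessel ratio,
  \<open>s0 = b / \<beta>\<close> and \<open>V = R - s0\<^sup>2\<close>; the statistic is \<open>sqrt n * V / s0\<^sup>2\<close>.

  Given the other spins, the spin \<open>i\<close> has density proportional to \<open>exp (\<beta> * (Y\<^sub>i \<bullet> s))\<close> with
  \<open>Y\<^sub>i = (S - \<sigma>\<^sub>i) / n\<close>, and \<open>R\<close> is an affine function of \<open>Y\<^sub>i \<bullet> \<sigma>\<^sub>i\<close>. The cosine of the angle between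
  \<open>Y\<^sub>i\<close> and the spin has a one-dimensional law with an explicit bounded Stein kernel, so that
  conditionally \<open>h R * (Y\<^sub>i \<bullet> \<sigma>\<^sub>i - mean)\<close> and \<open>2 / n * h' R * kernel\<^sub>i\<close> have equal means. Averaging over
  \<open>i\<close> gives, for every \<open>h\<close> with at most one kink, the identity of \<open>gibbs_stein_identity\<close>,
  in which the mean of \<open>h R * drift\<close> equals \<open>2 / n\<close> times the mean of \<open>h' R * mean_kern\<close>. Since the
  component of a spin along its field has a density, a kink of \<open>h\<close> costs nothing, and no smoothing or concentration
  inequality for small intervals is needed.

  Three facts about the two sides turn this identity into the theorem.

  \<^item> The drift is \<open>\<kappa> * V\<close> up to terms of order \<open>V\<^sup>2 + 1 / n\<close> (\<open>drift_linear\<close>). It has the sign of \<open>V\<close> up to a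
    small error even near \<open>R = 0\<close>, where its main part vanishes and a term \<open>- 1 / n\<close> takes over (\<open>drift_restoring\<close>).
    Both rest on the strict decrease of \<open>f r / r\<close>, which follows from a Riccati equation for \<open>f\<close>.
  \<^item> Odd powers of \<open>V\<close> in the identity give, by induction, moments of \<open>V\<close> of order \<open>2 * k\<close> bounded by a
    multiple of \<open>1 / n ^ k\<close> (\<open>moment_bound\<close>).
  \<^item> The mean kernel is within a distance of order \<open>1 / sqrt n\<close> in mean square of the constant \<open>v0\<close>
    (\<open>mean_kern_concentration\<close>): the fluctuations of different spins are conditionally centred and almost
    uncorrelated, because removing one spin changes the field felt by another one by \<open>1 / n\<close> only.

  Inserting the solution of the Stein equation of the indicator of \<open>{..z}\<close> at the normalised deviation
  expresses the distance of the two distribution functions at \<open>z\<close> by these two errors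
  (\<open>distribution_error_eq\<close>). The solution and its derivative are at most a multiple of
  \<open>((1 + \<bar>w\<bar>) / (1 + \<bar>z\<bar>)) ^ k\<close> at \<open>w\<close>, for every \<open>k\<close>; this is where the decay in \<open>z\<close> comes from, and the
  powers of \<open>w\<close> are absorbed by the moments.
\<close>

section \<open>Angular integrals and the mean magnetisation\<close>

text \<open>
  The inner product of a uniform point of the sphere with a fixed unit vector is distributed as
  \<open>cos t\<close> with \<open>t\<close> of density proportional to \<open>sin t ^ (N - 2)\<close> on \<open>[0, pi]\<close>. Working with the
  angle \<open>t\<close> keeps all the integrands smooth, also for \<open>N = 2\<close>.
\<close>

locale angular =
  fixes N :: nat
  assumes N_ge_2: "2 \<le> N"
begin

definition ang :: "nat \<Rightarrow> real \<Rightarrow> real" where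
  "ang j r = integral {0..pi} (\<lambda>t. cos t ^ j * exp (r * cos t) * sin t ^ (N - 2))"

text \<open>
  The mean of \<open>cos t\<close> under the density tilted by \<open>exp (r * cos t)\<close>; for \<open>r > 0\<close> it is the Bessel
  ratio, but unlike the ratio it is smooth on the whole line.
\<close>

definition mag :: "real \<Rightarrow> real" where
  "mag r = ang 1 r / ang 0 r"

lemma ang_integrable: "(\<lambda>t. cos t ^ j * exp (r * cos t) * sin t ^ (N - 2)) integrable_on {a..b::real}"
  by (intro integrable_continuous_interval continuous_intros)

lemma ang_has_integral:
  "((\<lambda>t. cos t ^ j * exp (r * cos t) * sin t ^ (N - 2)) has_integral ang j r) {0..pi}"
  unfolding ang_def by (rule integrable_integral[OF ang_integrable])

lemma ang_deriv: "(ang j has_real_derivative ang (Suc j) r) (at r)"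
proof -
  have "((\<lambda>r. integral (cbox 0 pi) (\<lambda>t. cos t ^ j * exp (r * cos t) * sin t ^ (N - 2)))
      has_field_derivative integral (cbox 0 pi) (\<lambda>t. cos t ^ Suc j * exp (r * cos t) * sin t ^ (N - 2)))
      (at r within UNIV)"
  proof (rule leibniz_rule_field_derivative[where fx = "\<lambda>r t. cos t ^ Suc j * exp (r * cos t) * sin t ^ (N - 2)"])
    show "((\<lambda>r. cos t ^ j * exp (r * cos t) * sin t ^ (N - 2)) has_real_derivative
        cos t ^ Suc j * exp (r * cos t) * sin t ^ (N - 2)) (at r within UNIV)" for r t :: real
      by (auto intro!: derivative_eq_intros simp: algebra_simps)
    show "continuous_on (UNIV \<times> cbox 0 pi)
        (\<lambda>(r, t). cos t ^ Suc j * exp (r * cos t) * sin t ^ (N - 2) :: real)"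
      unfolding split_beta by (intro continuous_intros)
  qed (auto simp: ang_integrable)
  then show ?thesis by (simp add: ang_def[abs_def])
qed

lemma ang_mono_integrand:
  fixes u v :: "real \<Rightarrow> real"
  assumes "\<And>t. t \<in> {0..pi} \<Longrightarrow> u t \<le> v t"
    and "continuous_on {0..pi} u" "continuous_on {0..pi} v"
  shows "integral {0..pi} u \<le> integral {0..pi} v"
  by (intro integral_le integrable_continuous_interval assms)

lemma sin_power_integral_pos: "integral {0..pi} (\<lambda>t. sin t ^ k) > (0::real)"
proof -
  have "integral {0..pi} (\<lambda>t. sin t ^ k) \<noteq> (0::real)"
  proof
    assume 0: "integral {0..pi} (\<lambda>t. sin t ^ k) = (0::real)"
    have "(\<lambda>t. sin t ^ k) (pi / 2) = (0::real)"
    proof (rule has_integral_0_cbox_imp_0[of 0 pi "\<lambda>t. sin t ^ k"])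
      show "((\<lambda>t. sin t ^ k) has_integral (0::real)) (cbox 0 pi)"
        unfolding box_real
        by (subst 0[symmetric], intro integrable_integral integrable_continuous_interval continuous_intros)
      show "continuous_on (cbox 0 pi) (\<lambda>t. sin t ^ k :: real)" by (intro continuous_intros)
      show "box 0 pi \<noteq> ({}::real set)" by (simp add: not_le)
    qed (auto intro!: zero_le_power sin_ge_zero)
    then show False by simp
  qed
  moreover have "integral {0..pi} (\<lambda>t. sin t ^ k) \<ge> (0::real)"
    by (intro integral_nonneg integrable_continuous_interval continuous_intros)
      (auto intro!: zero_le_power sin_ge_zero)
  ultimately show ?thesis by simp
qed

lemma abs_mult_cos_le: "\<bar>r * cos t\<bar> \<le> \<bar>r :: real\<bar>"
  unfolding abs_mult by (rule mult_left_le) auto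

lemma exp_cos_ge: "exp (- \<bar>r\<bar>) \<le> exp (r * cos t :: real)"
  using abs_mult_cos_le[of r t] by simp

lemma ang_0_pos: "ang 0 r > 0"
proof -
  have "0 < exp (- \<bar>r\<bar>) * integral {0..pi} (\<lambda>t. sin t ^ (N - 2))"
    by (simp add: sin_power_integral_pos)
  also have "\<dots> = integral {0..pi} (\<lambda>t. exp (- \<bar>r\<bar>) * sin t ^ (N - 2))" by simp
  also have "\<dots> \<le> ang 0 r"
    unfolding ang_def
    by (intro ang_mono_integrand continuous_intros)
      (auto intro!: mult_right_mono zero_le_power sin_ge_zero exp_cos_ge simp del: exp_le_cancel_iff)
  finally show ?thesis .
qed

text \<open>
  The integral of the derivative of \<open>cos t ^ k * sin t ^ (N - 1) * exp (r * cos t)\<close> over \<open>[0, pi]\<close>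
  vanishes, as \<open>sin\<close> does at both ends.
\<close>

lemma ang_parts_aux:
  "((\<lambda>t. (N - 1) * (cos t ^ Suc k * exp (r * cos t) * sin t ^ (N - 2))
      - (real k * (cos t ^ (k - 1)) + r * cos t ^ k) * exp (r * cos t) * sin t ^ N) has_integral 0) {0..pi}"
proof -
  have N1: "sin t ^ N = sin t * sin t * sin t ^ (N - 2)" "sin t ^ (N - Suc 0) = sin t * sin t ^ (N - 2)"
    "N - 1 - 1 = N - 2" for t :: real
    using N_ge_2 by (auto simp: power_eq_if numeral_2_eq_2 Suc_diff_Suc)
  have [simp]: "N - Suc (Suc 0) = N - 2" by simp
  have "((\<lambda>t. (N - 1) * (cos t ^ Suc k * exp (r * cos t) * sin t ^ (N - 2))
      - (real k * (cos t ^ (k - 1)) + r * cos t ^ k) * exp (r * cos t) * sin t ^ N)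
     has_integral (cos pi ^ k * sin pi ^ (N - 1) * exp (r * cos pi)
       - cos 0 ^ k * sin 0 ^ (N - 1) * exp (r * cos 0))) {0..pi}"
  proof (rule fundamental_theorem_of_calculus)
    fix t :: real
    show "((\<lambda>t. cos t ^ k * sin t ^ (N - 1) * exp (r * cos t)) has_vector_derivative
      (N - 1) * (cos t ^ Suc k * exp (r * cos t) * sin t ^ (N - 2))
      - (real k * (cos t ^ (k - 1)) + r * cos t ^ k) * exp (r * cos t) * sin t ^ N) (at t within {0..pi})"
      unfolding has_real_derivative_iff_has_vector_derivative[symmetric]
      by (rule derivative_eq_intros refl)+ (simp add: N1 algebra_simps)
  qed simp
  moreover have "N - 1 \<noteq> 0" using N_ge_2 by simp
  ultimately show ?thesis by (simp add: power_0_left)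
qed

lemma sin_power_N: "sin t ^ N = (1 - cos t ^ 2) * sin t ^ (N - 2)" for t :: real
proof -
  have "sin t ^ N = (sin t)\<^sup>2 * sin t ^ (N - 2)"
    by (metis N_ge_2 le_add_diff_inverse power_add)
  then show ?thesis by (simp only: sin_squared_eq)
qed

lemma ang_parts: "(real N - 1) * ang 1 r = r * (ang 0 r - ang 2 r)"
proof -
  have 1: "((\<lambda>t. (real N - 1) * (cos t ^ 1 * exp (r * cos t) * sin t ^ (N - 2))
      - r * (cos t ^ 0 * exp (r * cos t) * sin t ^ (N - 2) - cos t ^ 2 * exp (r * cos t) * sin t ^ (N - 2)))
     has_integral (real N - 1) * ang 1 r - r * (ang 0 r - ang 2 r)) {0..pi}"
    by (intro has_integral_diff has_integral_mult_right ang_has_integral)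
  have 2: "((\<lambda>t. (real N - 1) * (cos t ^ 1 * exp (r * cos t) * sin t ^ (N - 2))
      - r * (cos t ^ 0 * exp (r * cos t) * sin t ^ (N - 2) - cos t ^ 2 * exp (r * cos t) * sin t ^ (N - 2)))
     has_integral 0) {0..pi}"
    by (rule has_integral_eq[OF _ ang_parts_aux[of 0 r]], unfold sin_power_N)
      (use N_ge_2 in \<open>simp add: algebra_simps of_nat_diff\<close>)
  from has_integral_unique[OF 1 2] show ?thesis by simp
qed

text \<open>The second form of the first angular integral exhibits its sign and its size.\<close>

lemma ang_1_eq: "ang 1 r = r / (real N - 1) * integral {0..pi} (\<lambda>t. exp (r * cos t) * sin t ^ N)"
proof -
  have "ang 0 r - ang 2 r = integral {0..pi} (\<lambda>t. exp (r * cos t) * sin t ^ N)"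
    unfolding ang_def
  proof (subst integral_diff[symmetric], (intro integrable_continuous_interval continuous_intros)+,
      rule integral_cong)
    fix t :: real
    show "cos t ^ 0 * exp (r * cos t) * sin t ^ (N - 2) - cos t ^ 2 * exp (r * cos t) * sin t ^ (N - 2)
        = exp (r * cos t) * sin t ^ N" unfolding sin_power_N by (simp add: algebra_simps)
  qed
  then show ?thesis using ang_parts[of r] N_ge_2 by (simp add: field_simps)
qed

lemma ang_1_lower:
  obtains c where "c > 0" "\<And>r. 0 \<le> r \<Longrightarrow> r \<le> \<rho> \<Longrightarrow> c * r \<le> ang 1 r"
proof
  let ?c = "exp (- \<bar>\<rho>\<bar>) * integral {0..pi} (\<lambda>t. sin t ^ N) / (real N - 1)"
  show "?c > 0" using N_ge_2 by (simp add: sin_power_integral_pos)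
  fix r :: real assume r: "0 \<le> r" "r \<le> \<rho>"
  have "exp (- \<bar>\<rho>\<bar>) * integral {0..pi} (\<lambda>t. sin t ^ N) = integral {0..pi} (\<lambda>t. exp (- \<bar>\<rho>\<bar>) * sin t ^ N)"
    by simp
  also have "\<dots> \<le> integral {0..pi} (\<lambda>t. exp (r * cos t) * sin t ^ N)"
  proof (intro ang_mono_integrand continuous_intros mult_right_mono)
    show "exp (- \<bar>\<rho>\<bar>) \<le> exp (r * cos t)" for t
      by (rule order_trans[OF _ exp_cos_ge]) (use r in auto)
  qed (auto intro!: zero_le_power sin_ge_zero)
  finally have "r * (exp (- \<bar>\<rho>\<bar>) * integral {0..pi} (\<lambda>t. sin t ^ N))
      \<le> r * integral {0..pi} (\<lambda>t. exp (r * cos t) * sin t ^ N)"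
    using r by (intro mult_left_mono)
  then show "?c * r \<le> ang 1 r"
    unfolding ang_1_eq using N_ge_2 by (simp add: divide_simps mult_ac)
qed

lemma abs_mag_le_1: "\<bar>mag r\<bar> \<le> 1"
proof -
  have w: "0 \<le> exp (r * cos t) * sin t ^ (N - 2)" if "t \<in> {0..pi}" for t
    using that by (intro mult_nonneg_nonneg zero_le_power sin_ge_zero) auto
  have "ang 1 r \<le> ang 0 r"
    unfolding ang_def
  proof (intro ang_mono_integrand continuous_intros)
    fix t assume "t \<in> {0..pi}"
    from mult_right_mono[OF cos_le_one w[OF this]]
    show "cos t ^ 1 * exp (r * cos t) * sin t ^ (N - 2) \<le> cos t ^ 0 * exp (r * cos t) * sin t ^ (N - 2)"
      by (simp add: mult_ac)
  qed
  moreover have "- ang 0 r \<le> ang 1 r"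
    unfolding ang_def integral_neg[symmetric]
  proof (intro ang_mono_integrand continuous_intros)
    fix t assume "t \<in> {0..pi}"
    from mult_right_mono[OF cos_ge_minus_one w[OF this]]
    show "- (cos t ^ 0 * exp (r * cos t) * sin t ^ (N - 2)) \<le> cos t ^ 1 * exp (r * cos t) * sin t ^ (N - 2)"
      by (simp add: mult_ac)
  qed
  ultimately have "\<bar>ang 1 r\<bar> \<le> ang 0 r" by linarith
  then show ?thesis using ang_0_pos[of r] by (simp add: mag_def abs_divide)
qed

text \<open>The derivative of the mean is the variance of \<open>cos t\<close> under the tilted density.\<close>

lemma mag_deriv: "(mag has_real_derivative ang 2 r / ang 0 r - (mag r)\<^sup>2) (at r)"
proof -
  have "((\<lambda>r. ang 1 r / ang 0 r) has_real_derivative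
     (ang (Suc 1) r * ang 0 r - ang 1 r * ang (Suc 0) r) / (ang 0 r * ang 0 r)) (at r)"
    by (rule DERIV_divide[OF ang_deriv ang_deriv]) (use ang_0_pos[of r] in simp)
  moreover have "(ang (Suc 1) r * ang 0 r - ang 1 r * ang (Suc 0) r) / (ang 0 r * ang 0 r) =
      ang 2 r / ang 0 r - (mag r)\<^sup>2"
    using ang_0_pos[of r] by (simp add: mag_def field_simps power2_eq_square numeral_2_eq_2)
  ultimately show ?thesis by (simp add: mag_def[abs_def])
qed

definition mag' :: "real \<Rightarrow> real" where
  "mag' r = ang 2 r / ang 0 r - (mag r)\<^sup>2"

lemma mag_has_derivative: "(mag has_real_derivative mag' r) (at r within S)"
  using mag_deriv[of r] unfolding mag'_def by (rule DERIV_subset) simp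

lemma continuous_mag: "continuous_on S mag"
  by (rule DERIV_continuous_on[OF mag_has_derivative])

text \<open>
  Integration by parts expresses the second moment through the first, which closes the formula for
  the derivative.
\<close>

lemma riccati: "r * mag' r = r - r * (mag r)\<^sup>2 - (real N - 1) * mag r"
proof -
  have "ang 2 r = ang 0 r * (mag' r + (mag r)\<^sup>2)" "ang 1 r = ang 0 r * mag r"
    using ang_0_pos[of r] by (simp_all add: mag'_def mag_def)
  then have "ang 0 r * ((real N - 1) * mag r) = ang 0 r * (r * (1 - (mag' r + (mag r)\<^sup>2)))"
    using ang_parts[of r] by (simp add: algebra_simps)
  then have "(real N - 1) * mag r = r * (1 - (mag' r + (mag r)\<^sup>2))"
    using ang_0_pos[of r] by simp
  then show ?thesis by (simp add: algebra_simps)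
qed

lemma mag'_eq_integral:
  "mag' r = integral {0..pi} (\<lambda>t. (cos t - mag r)\<^sup>2 * exp (r * cos t) * sin t ^ (N - 2)) / ang 0 r"
proof -
  have "((\<lambda>t. (cos t ^ 2 * exp (r * cos t) * sin t ^ (N - 2)
        - 2 * mag r * (cos t ^ 1 * exp (r * cos t) * sin t ^ (N - 2)))
        + (mag r)\<^sup>2 * (cos t ^ 0 * exp (r * cos t) * sin t ^ (N - 2)))
      has_integral (ang 2 r - 2 * mag r * ang 1 r) + (mag r)\<^sup>2 * ang 0 r) {0..pi}"
    by (intro has_integral_add has_integral_diff has_integral_mult_right ang_has_integral)
  then have "((\<lambda>t. (cos t - mag r)\<^sup>2 * exp (r * cos t) * sin t ^ (N - 2))
      has_integral (ang 2 r - 2 * mag r * ang 1 r) + (mag r)\<^sup>2 * ang 0 r) {0..pi}"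
    by (rule has_integral_eq[rotated]) (simp add: power2_eq_square algebra_simps)
  then have "integral {0..pi} (\<lambda>t. (cos t - mag r)\<^sup>2 * exp (r * cos t) * sin t ^ (N - 2))
      = (ang 2 r - 2 * mag r * ang 1 r) + (mag r)\<^sup>2 * ang 0 r"
    by (rule integral_unique)
  also have "\<dots> = ang 0 r * mag' r"
    using ang_0_pos[of r] by (simp add: mag'_def mag_def field_simps power2_eq_square)
  finally show ?thesis using ang_0_pos[of r] by simp
qed

lemma mag'_nonneg: "0 \<le> mag' r"
  unfolding mag'_eq_integral
  by (intro divide_nonneg_pos ang_0_pos integral_nonneg integrable_continuous_interval continuous_intros)
    (auto intro!: mult_nonneg_nonneg zero_le_power[OF sin_ge_zero])

lemma mag'_pos: "0 < mag' r"
proof -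
  let ?g = "\<lambda>t. (cos t - mag r)\<^sup>2 * exp (r * cos t) * sin t ^ (N - 2)"
  have "mag' r \<noteq> 0"
  proof
    assume "mag' r = 0"
    then have 0: "integral {0..pi} ?g = 0" using mag'_eq_integral[of r] ang_0_pos[of r] by simp
    have z: "?g t = 0" if "t \<in> cbox 0 pi" for t
    proof (rule has_integral_0_cbox_imp_0[OF _ _ _ _ that])
      show "(?g has_integral 0) (cbox 0 pi)"
        unfolding box_real
        by (subst 0[symmetric], intro integrable_integral integrable_continuous_interval continuous_intros)
      show "continuous_on (cbox 0 pi) ?g" by (intro continuous_intros)
      show "box 0 pi \<noteq> ({}::real set)" by (simp add: not_le)
    qed (auto intro!: mult_nonneg_nonneg zero_le_power[OF sin_ge_zero])
    have "sin (pi / 3) \<noteq> 0" by (simp add: sin_60)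
    then have "cos (pi / 2) = mag r" "cos (pi / 3) = mag r"
      using z[of "pi / 2"] z[of "pi / 3"] pi_gt_zero by auto
    then show False by (simp add: cos_60)
  qed
  then show ?thesis using mag'_nonneg[of r] by simp
qed

lemma mag'_le_1: "mag' r \<le> 1"
proof -
  have "ang 2 r \<le> ang 0 r"
    unfolding ang_def
    by (intro ang_mono_integrand continuous_intros mult_right_mono)
      (auto intro!: zero_le_power sin_ge_zero simp: abs_square_le_1)
  then have "ang 2 r / ang 0 r \<le> 1" using ang_0_pos[of r] by simp
  then show ?thesis unfolding mag'_def by (smt (verit) zero_le_power2)
qed

lemma mag_lipschitz: "\<bar>mag r - mag s\<bar> \<le> \<bar>r - s\<bar>"
proof -
  have "norm (mag r - mag s) \<le> 1 * norm (r - s)"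
  proof (rule field_differentiable_bound[of UNIV mag mag'])
    show "(mag has_field_derivative mag' x) (at x within UNIV)" for x
      by (rule mag_has_derivative)
    show "norm (mag' x) \<le> 1" for x
      using mag'_nonneg[of x] mag'_le_1[of x] by simp
  qed auto
  then show ?thesis by simp
qed

lemma mag_less_1: "mag r < 1"
proof -
  have "mag r < mag (r + 1)"
  proof (rule DERIV_pos_imp_increasing[of r "r + 1" mag])
    show "\<exists>y. (mag has_real_derivative y) (at x) \<and> 0 < y" for x
      by (rule exI[of _ "mag' x"], rule conjI[OF mag_has_derivative mag'_pos])
  qed simp
  then show ?thesis using abs_mag_le_1[of "r + 1"] by simp
qed

subsection \<open>Strict decrease of the slope\<close>

text \<open>
  The slope \<open>mag r / r\<close> decreases, with a rate proportional to \<open>r\<close>. By the Riccati equation its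
  derivative is \<open>slope_num r\<close> divided by a positive quantity, and the derivative of \<open>slope_num\<close>
  collapses to a single negative term.
\<close>

definition slope_num :: "real \<Rightarrow> real" where
  "slope_num r = r ^ N * (ang 0 r)\<^sup>2 - real N * r ^ (N - 1) * ang 0 r * ang 1 r - r ^ N * (ang 1 r)\<^sup>2"

lemma slope_num_deriv:
  "(slope_num has_real_derivative - 2 * r ^ (N - 1) * (ang 1 r)\<^sup>2) (at r)"
proof -
  obtain m where m: "N = Suc (Suc m)"
    using N_ge_2 by (metis add_2_eq_Suc le_Suc_ex)
  have mN: "real N = real m + 2" "x ^ N = x * (x * x ^ m)" "x ^ (N - 1) = x * x ^ m" for x :: real
    by (simp_all add: m)
  have d0: "(ang 0 has_real_derivative ang 1 r) (at r)"
    using ang_deriv[of 0 r] unfolding One_nat_def[symmetric] .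
  have d1: "(ang 1 has_real_derivative ang 2 r) (at r)"
    using ang_deriv[of 1 r] unfolding Suc_1 .
  \<comment> \<open>eliminating \<open>ang 2\<close> cancels everything but one term\<close>
  have 2: "r * ang 2 r = r * ang 0 r - (real m + 1) * ang 1 r"
    using ang_parts[of r] by (simp add: algebra_simps mN(1))
  let ?D = "((real m + 2) * r ^ Suc m * (ang 0 r)\<^sup>2 + r ^ Suc (Suc m) * (2 * ang 0 r * ang 1 r))
     - ((real m + 2) * ((real m + 1) * r ^ m) * ang 0 r * ang 1 r
        + (real m + 2) * r ^ Suc m * ang 1 r * ang 1 r + (real m + 2) * r ^ Suc m * ang 0 r * ang 2 r)
     - ((real m + 2) * r ^ Suc m * (ang 1 r)\<^sup>2 + r ^ Suc (Suc m) * (2 * ang 1 r * ang 2 r))"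
  have D: "((\<lambda>r. r ^ Suc (Suc m) * (ang 0 r)\<^sup>2 - (real m + 2) * r ^ Suc m * ang 0 r * ang 1 r
      - r ^ Suc (Suc m) * (ang 1 r)\<^sup>2) has_real_derivative ?D) (at r)"
    by (rule derivative_eq_intros d0 d1 refl)+ (simp add: algebra_simps power2_eq_square)
  have sl: "slope_num = (\<lambda>r. r ^ Suc (Suc m) * (ang 0 r)\<^sup>2
      - (real m + 2) * r ^ Suc m * ang 0 r * ang 1 r - r ^ Suc (Suc m) * (ang 1 r)\<^sup>2)"
    by (rule ext) (simp only: slope_num_def mN power_Suc)
  have "?D = r ^ m * ((real m + 2) * r * (ang 0 r)\<^sup>2 + 2 * r * r * ang 0 r * ang 1 r
      - (real m + 2) * (real m + 1) * ang 0 r * ang 1 r - 2 * (real m + 2) * r * (ang 1 r)\<^sup>2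
      - (real m + 2) * ang 0 r * (r * ang 2 r) - 2 * r * ang 1 r * (r * ang 2 r))"
    by (simp add: algebra_simps power2_eq_square)
  also have "\<dots> = - 2 * r ^ (N - 1) * (ang 1 r)\<^sup>2"
    unfolding 2 mN by (simp add: algebra_simps power2_eq_square)
  finally show ?thesis using D unfolding sl by (simp only:)
qed

lemma slope_num_le:
  assumes "\<rho> > 0"
  obtains c where "c > 0" "\<And>r. 0 \<le> r \<Longrightarrow> r \<le> \<rho> \<Longrightarrow> slope_num r \<le> - c * r ^ (N + 2)"
proof -
  obtain c where c: "c > 0" "\<And>r. 0 \<le> r \<Longrightarrow> r \<le> \<rho> \<Longrightarrow> c * r \<le> ang 1 r"
    using ang_1_lower by blast
  let ?c = "2 * c\<^sup>2 / (real N + 2)"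
  have "slope_num r + ?c * r ^ (N + 2) \<le> slope_num 0 + ?c * 0 ^ (N + 2)" if r: "0 \<le> r" "r \<le> \<rho>" for r
  proof (rule DERIV_nonpos_imp_nonincreasing[OF r(1)])
    fix x assume x: "0 \<le> x" "x \<le> r"
    have "((\<lambda>x. slope_num x + ?c * x ^ (N + 2)) has_real_derivative
        - 2 * x ^ (N - 1) * (ang 1 x)\<^sup>2 + ?c * (real (N + 2) * x ^ (N + 1))) (at x)"
      by (rule derivative_eq_intros slope_num_deriv[THEN DERIV_cong] refl | simp)+
    moreover have "- 2 * x ^ (N - 1) * (ang 1 x)\<^sup>2 + ?c * (real (N + 2) * x ^ (N + 1)) \<le> 0"
    proof -
      have "(c * x)\<^sup>2 \<le> (ang 1 x)\<^sup>2" by (intro power_mono) (use c x r in auto)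
      then have "2 * x ^ (N - 1) * (c * x)\<^sup>2 \<le> 2 * x ^ (N - 1) * (ang 1 x)\<^sup>2"
        using x by (intro mult_left_mono) auto
      moreover have "?c * (real (N + 2) * x ^ (N + 1)) = 2 * c\<^sup>2 * x ^ (N + 1)"
        by (simp add: field_simps)
      moreover have "N + 1 = (N - 1) + 2" using N_ge_2 by simp
      then have "2 * c\<^sup>2 * x ^ (N + 1) = 2 * x ^ (N - 1) * (c * x)\<^sup>2"
        by (simp only: power_add) (simp add: power_mult_distrib)
      ultimately show ?thesis by linarith
    qed
    ultimately show "\<exists>y. ((\<lambda>x. slope_num x + ?c * x ^ (N + 2)) has_real_derivative y) (at x) \<and> y \<le> 0"
      by blast
  qed
  moreover have "slope_num 0 = 0" using N_ge_2 by (simp add: slope_num_def power_0_left)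
  ultimately have "slope_num r \<le> - ?c * r ^ (N + 2)" if "0 \<le> r" "r \<le> \<rho>" for r
    using that by (simp add: field_simps) (smt (verit) that)
  moreover have "?c > 0" using c by simp
  ultimately show ?thesis using that by blast
qed

text \<open>The quotient \<open>mag r / r\<close>, in a form that makes sense and is smooth at 0.\<close>

definition slope :: "real \<Rightarrow> real" where
  "slope r = (1 - ang 2 r / ang 0 r) / (real N - 1)"

lemma mag_eq_slope: "mag r = r * slope r"
proof -
  have "(real N - 1) * mag r = r * (1 - ang 2 r / ang 0 r)"
    using ang_parts[of r] ang_0_pos[of r] by (simp add: mag_def field_simps)
  then show ?thesis using N_ge_2 by (simp add: slope_def field_simps)
qed

text \<open>
  All derivatives of \<open>ang 2\<close> and \<open>ang 0\<close> being continuous, the slope is continuously differentiable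
  also at 0, where its expression as a quotient by \<open>r\<close> is of no use.
\<close>

lemma slope_C1:
  obtains s' where "\<And>r. (slope has_real_derivative s' r) (at r)" "continuous_on UNIV s'"
proof
  let ?s' = "\<lambda>r. - ((ang 3 r * ang 0 r - ang 2 r * ang 1 r) / (ang 0 r * ang 0 r)) / (real N - 1)"
  have d: "(ang j has_real_derivative ang (Suc j) r) (at r within S)" for j r S
    using ang_deriv by (rule DERIV_subset) simp
  have c: "continuous_on UNIV (ang j)" for j
    by (rule DERIV_continuous_on[OF d])
  have nz: "ang 0 r \<noteq> 0" for r using ang_0_pos[of r] by simp
  have "((\<lambda>r. (1 - ang 2 r / ang 0 r) / (real N - 1)) has_real_derivative ?s' r) (at r)" for r
  proof -
    have "((\<lambda>r. ang 2 r / ang 0 r) has_real_derivative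
        (ang (Suc 2) r * ang 0 r - ang 2 r * ang (Suc 0) r) / (ang 0 r * ang 0 r)) (at r)"
      by (rule DERIV_divide[OF d d nz])
    from DERIV_cdivide[OF DERIV_diff[OF DERIV_const this], of 1 "real N - 1"]
    show ?thesis by (simp add: eval_nat_numeral)
  qed
  then show "(slope has_real_derivative ?s' r) (at r)" for r
    by (simp add: slope_def[abs_def])
  show "continuous_on UNIV ?s'"
    using N_ge_2 nz by (intro continuous_intros c) auto
qed

lemma continuous_slope: "continuous_on S slope"
proof -
  obtain s' where "\<And>r. (slope has_real_derivative s' r) (at r)" using slope_C1 by metis
  then show ?thesis by (meson DERIV_isCont continuous_at_imp_continuous_on)
qed

lemma slope_lipschitz:
  obtains C where "C \<ge> 0" "\<And>r s. r \<in> {0..\<rho>} \<Longrightarrow> s \<in> {0..\<rho>} \<Longrightarrow> \<bar>slope r - slope s\<bar> \<le> C * \<bar>r - s\<bar>"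
proof -
  obtain s' where s': "\<And>r. (slope has_real_derivative s' r) (at r)" "continuous_on UNIV s'"
    using slope_C1 by metis
  have "compact (s' ` {0..\<rho>})"
    by (intro compact_continuous_image continuous_on_subset[OF s'(2)]) auto
  then obtain C where C: "\<And>r. r \<in> {0..\<rho>} \<Longrightarrow> \<bar>s' r\<bar> \<le> C"
    using compact_imp_bounded[of "s' ` {0..\<rho>}"] unfolding bounded_iff
    by (metis imageI real_norm_def)
  have "\<bar>slope r - slope s\<bar> \<le> \<bar>C\<bar> * \<bar>r - s\<bar>" if rs: "r \<in> {0..\<rho>}" "s \<in> {0..\<rho>}" for r s
  proof -
    have "norm (slope r - slope s) \<le> \<bar>C\<bar> * norm (r - s)"
    proof (rule field_differentiable_bound[of "{0..\<rho>}" slope s'])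
      show "(slope has_field_derivative s' z) (at z within {0..\<rho>})" for z
        using s'(1) by (rule DERIV_subset) simp
      show "norm (s' z) \<le> \<bar>C\<bar>" if "z \<in> {0..\<rho>}" for z using C[OF that] by simp
    qed (use rs in auto)
    then show ?thesis by simp
  qed
  then show ?thesis using that[of "\<bar>C\<bar>"] by simp
qed

lemma slope_deriv:
  assumes "r > 0"
  shows "(slope has_real_derivative slope_num r / (r ^ (N + 1) * (ang 0 r)\<^sup>2)) (at r)"
proof -
  obtain m where m: "N = Suc m" using N_ge_2 by (cases N) auto
  have "((\<lambda>r. mag r / r) has_real_derivative (mag' r * r - mag r * 1) / (r * r)) (at r)"
    by (rule DERIV_divide[OF mag_has_derivative DERIV_ident]) (use assms in simp)
  moreover have "(mag' r * r - mag r * 1) / (r * r) = slope_num r / (r ^ (N + 1) * (ang 0 r)\<^sup>2)"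
  proof -
    have A: "ang 1 r = ang 0 r * mag r" using ang_0_pos[of r] by (simp add: mag_def)
    have mN: "r ^ N = r * r ^ m" "r ^ (N - 1) = r ^ m" "r ^ (N + 1) = r * r * r ^ m"
      by (simp_all add: m)
    have "slope_num r = (r ^ m * (ang 0 r)\<^sup>2) * (r - real N * mag r - r * (mag r)\<^sup>2)"
      unfolding slope_num_def A mN by (simp add: algebra_simps power2_eq_square)
    also have "r - real N * mag r - r * (mag r)\<^sup>2 = mag' r * r - mag r * 1"
      using riccati[of r] by (simp add: algebra_simps)
    finally show ?thesis using assms ang_0_pos[of r] by (simp add: mN)
  qed
  ultimately have "((\<lambda>r. mag r / r) has_real_derivative slope_num r / (r ^ (N + 1) * (ang 0 r)\<^sup>2)) (at r)"
    by simp
  then show ?thesis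
  proof (rule has_field_derivative_transform_within_open[of _ _ _ "{0<..}"])
    show "mag x / x = slope x" if "x \<in> {0<..}" for x
      using that by (simp add: mag_eq_slope)
  qed (use assms in auto)
qed

lemma ang_upper:
  assumes "\<bar>r\<bar> \<le> \<rho>"
  shows "\<bar>ang j r\<bar> \<le> pi * exp \<rho>"
proof -
  have "norm (ang j r) \<le> exp \<rho> * measure lborel (cbox 0 pi)"
  proof (rule has_integral_bound)
    show "((\<lambda>t. cos t ^ j * exp (r * cos t) * sin t ^ (N - 2)) has_integral ang j r) (cbox 0 pi)"
      using ang_has_integral by simp
    fix t :: real
    have "\<bar>cos t ^ j\<bar> * (exp (r * cos t) * \<bar>sin t ^ (N - 2)\<bar>) \<le> 1 * (exp \<rho> * 1)"
    proof (intro mult_mono)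
      show "exp (r * cos t) \<le> exp \<rho>" using abs_mult_cos_le[of r t] assms by simp
    qed (auto simp: power_abs intro!: power_le_one)
    then show "norm (cos t ^ j * exp (r * cos t) * sin t ^ (N - 2)) \<le> exp \<rho>"
      by (simp add: abs_mult mult_ac)
  qed simp
  then show ?thesis by (simp add: mult.commute)
qed

text \<open>
  The lower bound for the rate survives at \<open>r = 0\<close> when it is measured in \<open>r\<^sup>2\<close>: the numerator of the
  derivative is of order \<open>- r ^ (N + 2)\<close> and the denominator of order \<open>r ^ (N + 1)\<close>.
\<close>

lemma slope_decrease:
  assumes "\<rho> > 0"
  obtains c where "c > 0"
    "\<And>r s. 0 \<le> r \<Longrightarrow> r \<le> s \<Longrightarrow> s \<le> \<rho> \<Longrightarrow> c * (s\<^sup>2 - r\<^sup>2) \<le> slope r - slope s"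
proof -
  obtain c where c: "c > 0" "\<And>r. 0 \<le> r \<Longrightarrow> r \<le> \<rho> \<Longrightarrow> slope_num r \<le> - c * r ^ (N + 2)"
    using slope_num_le[OF assms] by blast
  let ?K = "pi * exp \<rho>"
  let ?c = "c / (2 * ?K\<^sup>2)"
  have "slope s + ?c * s\<^sup>2 \<le> slope r + ?c * r\<^sup>2" if rs: "0 \<le> r" "r \<le> s" "s \<le> \<rho>" for r s
  proof (rule DERIV_nonpos_imp_decreasing_open[OF rs(2)])
    show "continuous_on {r..s} (\<lambda>x. slope x + ?c * x\<^sup>2)"
      by (intro continuous_intros continuous_slope)
    fix x assume x: "r < x" "x < s"
    then have x0: "x > 0" "x \<le> \<rho>" using rs by auto
    have "((\<lambda>x. slope x + ?c * x\<^sup>2) has_real_derivative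
        slope_num x / (x ^ (N + 1) * (ang 0 x)\<^sup>2) + ?c * (2 * x)) (at x)"
      by (rule derivative_eq_intros slope_deriv[OF x0(1)] refl)+ simp
    moreover have "slope_num x / (x ^ (N + 1) * (ang 0 x)\<^sup>2) + ?c * (2 * x) \<le> 0"
    proof -
      have "slope_num x / (x ^ (N + 1) * (ang 0 x)\<^sup>2) \<le> (- c * x ^ (N + 2)) / (x ^ (N + 1) * (ang 0 x)\<^sup>2)"
        using c(2)[of x] x0 by (intro divide_right_mono) auto
      also have "\<dots> = - (c * x) / (ang 0 x)\<^sup>2"
        using x0 by simp
      also have "\<dots> \<le> - (c * x) / ?K\<^sup>2"
      proof -
        have "(ang 0 x)\<^sup>2 \<le> ?K\<^sup>2"
          using ang_upper[of x \<rho> 0] ang_0_pos[of x] x0 by (intro power_mono) auto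
        then have "(c * x) / ?K\<^sup>2 \<le> (c * x) / (ang 0 x)\<^sup>2"
          using c x0 ang_0_pos[of x] by (intro divide_left_mono) auto
        then show ?thesis by simp
      qed
      finally show ?thesis by simp
    qed
    ultimately show "\<exists>y. ((\<lambda>x. slope x + ?c * x\<^sup>2) has_real_derivative y) (at x) \<and> y \<le> 0" by blast
  qed
  then have "?c * (s\<^sup>2 - r\<^sup>2) \<le> slope r - slope s" if "0 \<le> r" "r \<le> s" "s \<le> \<rho>" for r s
    using that by (simp add: right_diff_distrib) (smt (verit) that)
  moreover have "?c > 0" using c by simp
  ultimately show ?thesis using that by blast
qed

lemma slope_strict_decrease:
  assumes "0 \<le> r" "r < s"
  shows "slope s < slope r"
proof -
  obtain c where "c > 0" "c * (s\<^sup>2 - r\<^sup>2) \<le> slope r - slope s"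
    using slope_decrease[of s] assms by (metis less_eq_real_def order_le_less_trans)
  moreover have "r\<^sup>2 < s\<^sup>2" using assms by (simp add: power_strict_mono)
  ultimately show ?thesis by (smt (verit) mult_pos_pos)
qed

lemma mag'_less_slope:
  assumes "r > 0"
  shows "mag' r < slope r"
proof -
  obtain c where "c > 0" "slope_num r \<le> - c * r ^ (N + 2)"
    using slope_num_le[OF assms] assms by (metis less_eq_real_def order_refl)
  then have "slope_num r < 0" using assms by (smt (verit) mult_pos_pos zero_less_power mult_minus_left)
  then have "slope_num r / (r ^ (N + 1) * (ang 0 r)\<^sup>2) < 0"
    using assms ang_0_pos[of r] by (intro divide_neg_pos) auto
  then have "r * (slope_num r / (r ^ (N + 1) * (ang 0 r)\<^sup>2)) < 0"
    using assms by (intro mult_pos_neg)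
  moreover have "mag' r = slope r + r * (slope_num r / (r ^ (N + 1) * (ang 0 r)\<^sup>2))"
  proof (rule DERIV_unique[OF mag_has_derivative])
    have "((\<lambda>r. r * slope r) has_real_derivative
        1 * slope r + slope_num r / (r ^ (N + 1) * (ang 0 r)\<^sup>2) * r) (at r)"
      by (rule DERIV_mult[OF DERIV_ident slope_deriv[OF assms]])
    then show "(mag has_real_derivative slope r + r * (slope_num r / (r ^ (N + 1) * (ang 0 r)\<^sup>2))) (at r)"
      by (simp add: mag_eq_slope[abs_def] mult.commute)
  qed
  ultimately show ?thesis by linarith
qed

text \<open>The moments of \<open>cos t\<close> determine both its law and the power series of \<open>ang 0\<close>.\<close>

lemma ang_moment_rec: "(real N - 1) * ang (Suc k) 0 = real k * (ang (k - 1) 0 - ang (Suc k) 0)"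
proof -
  have 1: "((\<lambda>t. (real N - 1) * (cos t ^ Suc k * exp (0 * cos t) * sin t ^ (N - 2))
      - real k * (cos t ^ (k - 1) * exp (0 * cos t) * sin t ^ (N - 2) - cos t ^ Suc k * exp (0 * cos t) * sin t ^ (N - 2)))
     has_integral (real N - 1) * ang (Suc k) 0 - real k * (ang (k - 1) 0 - ang (Suc k) 0)) {0..pi}"
    by (intro has_integral_diff has_integral_mult_right ang_has_integral)
  have 2: "((\<lambda>t. (real N - 1) * (cos t ^ Suc k * exp (0 * cos t) * sin t ^ (N - 2))
      - real k * (cos t ^ (k - 1) * exp (0 * cos t) * sin t ^ (N - 2) - cos t ^ Suc k * exp (0 * cos t) * sin t ^ (N - 2)))
     has_integral 0) {0..pi}"
  proof (rule has_integral_eq[OF _ ang_parts_aux[of k 0]], unfold sin_power_N)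
    fix t :: real
    show "real (N - 1) * (cos t ^ Suc k * exp (0 * cos t) * sin t ^ (N - 2)) -
         (real k * cos t ^ (k - 1) + 0 * cos t ^ k) * exp (0 * cos t) *
         ((1 - (cos t)\<^sup>2) * sin t ^ (N - 2)) =
         (real N - 1) * (cos t ^ Suc k * exp (0 * cos t) * sin t ^ (N - 2)) -
         real k * (cos t ^ (k - 1) * exp (0 * cos t) * sin t ^ (N - 2) -
           cos t ^ Suc k * exp (0 * cos t) * sin t ^ (N - 2))"
      using N_ge_2 by (cases k) (simp_all add: algebra_simps of_nat_diff power2_eq_square)
  qed
  from has_integral_unique[OF 1 2] show ?thesis by simp
qed

lemma ang_odd: "odd k \<Longrightarrow> ang k 0 = 0"
proof (induction k rule: less_induct)
  case (less k)
  then obtain j where j: "k = Suc j" "even j" by (cases k) auto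
  have "(real N - 1 + real j) * ang k 0 = real j * ang (j - 1) 0"
    using ang_moment_rec[of j] j by (simp add: algebra_simps)
  also have "\<dots> = 0"
    using less.IH[of "j - 1"] j by (cases "j = 0") auto
  finally show ?case using N_ge_2 by (auto simp: j)
qed

lemma ang_even:
  "ang (2 * s) 0 = ang 0 0 * Gamma (real N / 2) * fact (2 * s) / (4 ^ s * fact s * Gamma (real s + real N / 2))"
proof (induction s)
  case 0
  have "Gamma (real N / 2) > 0" using N_ge_2 by (intro Gamma_real_pos) simp
  then show ?case by simp
next
  case (Suc s)
  have G: "Gamma (real s + real N / 2) > 0" using N_ge_2 by (intro Gamma_real_pos) simp
  have G1: "Gamma (real (Suc s) + real N / 2) = (real s + real N / 2) * Gamma (real s + real N / 2)"
  proof -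
    have "real s + real N / 2 \<notin> \<int>\<^sub>\<le>\<^sub>0"
      using N_ge_2 by (auto elim!: nonpos_Ints_cases)
    from Gamma_plus1[OF this] show ?thesis by (simp add: add_ac)
  qed
  have "(real N + 2 * real s) * ang (2 * Suc s) 0 = (2 * real s + 1) * ang (2 * s) 0"
    using ang_moment_rec[of "Suc (2 * s)"] by (simp add: algebra_simps)
  then have "ang (2 * Suc s) 0 = (2 * real s + 1) / (real N + 2 * real s) * ang (2 * s) 0"
    using N_ge_2 by (simp add: field_simps)
  also have "\<dots> = (2 * real s + 1) / (real N + 2 * real s) *
      (ang 0 0 * Gamma (real N / 2) * fact (2 * s) / (4 ^ s * fact s * Gamma (real s + real N / 2)))"
    unfolding Suc.IH ..
  also have "\<dots> = ((2 * real s + 2) * ((2 * real s + 1) * (ang 0 0 * Gamma (real N / 2) * fact (2 * s))))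
      / ((2 * real s + 2) * ((real N + 2 * real s) * (4 ^ s * fact s * Gamma (real s + real N / 2))))"
    by (subst mult_divide_mult_cancel_left) auto
  also have "(2 * real s + 2) * ((2 * real s + 1) * (ang 0 0 * Gamma (real N / 2) * fact (2 * s)))
      = ang 0 0 * Gamma (real N / 2) * fact (2 * Suc s)"
    by (simp add: algebra_simps)
  also have "(2 * real s + 2) * ((real N + 2 * real s) * (4 ^ s * fact s * Gamma (real s + real N / 2)))
      = 4 ^ Suc s * fact (Suc s) * Gamma (real (Suc s) + real N / 2)"
    unfolding G1 by (simp add: algebra_simps)
  finally show ?case .
qed

lemma ang_series: "(\<lambda>k. r ^ k / fact k * ang (k + j) 0) sums ang j r"
proof -
  let ?K = "pi * exp \<bar>r\<bar>"
  have bound: "\<bar>ang j r - (\<Sum>k<n. r ^ k / fact k * ang (k + j) 0)\<bar> \<le> ?K * (\<bar>r\<bar> ^ n / fact n)" for n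
  proof -
    have "(ang (0 + j) = ang j) \<and> (\<forall>m x. (ang (m + j) has_real_derivative ang (Suc m + j) x) (at x))"
      using ang_deriv by simp
    then obtain t where t: "\<bar>t\<bar> \<le> \<bar>r\<bar>"
      "ang j r = (\<Sum>m<n. ang (m + j) 0 / fact m * r ^ m) + ang (n + j) t / fact n * r ^ n"
      using Maclaurin_all_le_objl[of "\<lambda>m. ang (m + j)" "ang j" r n] by auto
    have "\<bar>ang j r - (\<Sum>k<n. r ^ k / fact k * ang (k + j) 0)\<bar> = \<bar>ang (n + j) t\<bar> * (\<bar>r\<bar> ^ n / fact n)"
      unfolding t(2) by (simp add: abs_mult power_abs mult_ac)
    also have "\<dots> \<le> ?K * (\<bar>r\<bar> ^ n / fact n)"
      by (intro mult_right_mono ang_upper t) simp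
    finally show ?thesis .
  qed
  have "(\<lambda>n. \<Sum>k<n. r ^ k / fact k * ang (k + j) 0) \<longlonglongrightarrow> ang j r"
  proof (rule Lim_transform_bound[of _ "\<lambda>n. ?K * (\<bar>r\<bar> ^ n / fact n)", THEN LIM_zero_cancel])
    show "\<forall>\<^sub>F n in sequentially. norm ((\<Sum>k<n. r ^ k / fact k * ang (k + j) 0) - ang j r)
        \<le> norm (?K * (\<bar>r\<bar> ^ n / fact n))"
      using bound by (intro always_eventually) (simp add: abs_minus_commute)
    show "(\<lambda>n. ?K * (\<bar>r\<bar> ^ n / fact n)) \<longlonglongrightarrow> 0"
      by (rule tendsto_mult_right_zero) (use power_tendsto_0_iff summable_LIMSEQ_zero[OF summable_exp[of "\<bar>r\<bar>"]] in \<open>simp add: field_simps\<close>)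
  qed
  then show ?thesis by (simp add: sums_def)
qed

subsection \<open>The ratio of Bessel functions\<close>

lemma Gamma_half_N_pos: "0 < Gamma (real N / 2)"
  using N_ge_2 by (intro Gamma_real_pos) simp

lemma ang_0_bessel:
  assumes "r > 0"
  shows "bessel_I (real N / 2 - 1) r = (r / 2) powr (real N / 2 - 1) * (ang 0 r / (ang 0 0 * Gamma (real N / 2)))"
proof -
  let ?c = "ang 0 0 * Gamma (real N / 2)"
  have c: "?c \<noteq> 0" using ang_0_pos[of 0] Gamma_half_N_pos by simp
  have "(\<lambda>s. r ^ (2 * s) / fact (2 * s) * ang (2 * s) 0) sums ang 0 r"
  proof (subst sums_mono_reindex[of "\<lambda>s. 2 * s" "\<lambda>k. r ^ k / fact k * ang k 0" "ang 0 r"])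
    show "r ^ k / fact k * ang k 0 = 0" if "k \<notin> range (\<lambda>s. 2 * s)" for k
    proof -
      have "odd k" using that by (metis evenE rangeI)
      then show ?thesis by (simp add: ang_odd)
    qed
  qed (use ang_series[of r 0] in \<open>auto simp: strict_mono_def\<close>)
  then have "(\<lambda>s. r ^ (2 * s) / fact (2 * s) * ang (2 * s) 0 / ?c) sums (ang 0 r / ?c)"
    by (rule sums_divide)
  also have "(\<lambda>s. r ^ (2 * s) / fact (2 * s) * ang (2 * s) 0 / ?c)
      = (\<lambda>s. (r / 2) ^ (2 * s) / (fact s * Gamma (real s + real N / 2)))"
    unfolding ang_even using c by (simp add: power_divide power_mult mult.assoc)
  finally have "(\<lambda>s. (r / 2) powr (real N / 2 - 1) * ((r / 2) ^ (2 * s) / (fact s * Gamma (real s + real N / 2))))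
      sums ((r / 2) powr (real N / 2 - 1) * (ang 0 r / ?c))"
    by (rule sums_mult)
  also have "(\<lambda>s. (r / 2) powr (real N / 2 - 1) * ((r / 2) ^ (2 * s) / (fact s * Gamma (real s + real N / 2))))
      = (\<lambda>s. 1 / (fact s * Gamma (real s + (real N / 2 - 1) + 1)) * (r / 2) powr (real N / 2 - 1 + 2 * real s))"
  proof
    fix s
    have e: "(r / 2) powr (real N / 2 - 1 + 2 * real s) = (r / 2) powr (real N / 2 - 1) * (r / 2) ^ (2 * s)"
      using assms powr_realpow[of "r / 2" "2 * s"] by (simp add: powr_add)
    show "(r / 2) powr (real N / 2 - 1) * ((r / 2) ^ (2 * s) / (fact s * Gamma (real s + real N / 2)))
      = 1 / (fact s * Gamma (real s + (real N / 2 - 1) + 1)) * (r / 2) powr (real N / 2 - 1 + 2 * real s)"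
      unfolding e by simp
  qed
  finally show ?thesis unfolding bessel_I_def by (rule sums_unique[symmetric])
qed

lemma ang_1_bessel:
  assumes "r > 0"
  shows "bessel_I (real N / 2) r = (r / 2) powr (real N / 2 - 1) * (ang 1 r / (ang 0 0 * Gamma (real N / 2)))"
proof -
  let ?c = "ang 0 0 * Gamma (real N / 2)"
  have c: "?c \<noteq> 0" using ang_0_pos[of 0] Gamma_half_N_pos by simp
  have "(\<lambda>s. r ^ Suc (2 * s) / fact (Suc (2 * s)) * ang (Suc (2 * s) + 1) 0) sums ang 1 r"
  proof (subst sums_mono_reindex[of "\<lambda>s. Suc (2 * s)" "\<lambda>k. r ^ k / fact k * ang (k + 1) 0" "ang 1 r"])
    show "r ^ k / fact k * ang (k + 1) 0 = 0" if "k \<notin> range (\<lambda>s. Suc (2 * s))" for k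
    proof -
      have "even k" using that by (metis oddE rangeI Suc_eq_plus1)
      then show ?thesis by (simp add: ang_odd)
    qed
  qed (use ang_series[of r 1] in \<open>auto simp: strict_mono_def\<close>)
  then have "(\<lambda>s. r ^ Suc (2 * s) / fact (Suc (2 * s)) * ang (Suc (2 * s) + 1) 0 / ?c) sums (ang 1 r / ?c)"
    by (rule sums_divide)
  also have "(\<lambda>s. r ^ Suc (2 * s) / fact (Suc (2 * s)) * ang (Suc (2 * s) + 1) 0 / ?c)
      = (\<lambda>s. (r / 2) ^ Suc (2 * s) / (fact s * Gamma (real s + real N / 2 + 1)))"
  proof
    fix s
    have e: "Suc (2 * s) + 1 = 2 * Suc s" "real (Suc s) + real N / 2 = real s + real N / 2 + 1" by auto
    have f: "fact (2 * Suc s) = (2 * real (Suc s)) * fact (Suc (2 * s))" by simp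
    show "r ^ Suc (2 * s) / fact (Suc (2 * s)) * ang (Suc (2 * s) + 1) 0 / ?c
        = (r / 2) ^ Suc (2 * s) / (fact s * Gamma (real s + real N / 2 + 1))"
      unfolding e(1) ang_even f e(2) using c
      by (simp add: power_divide power_mult divide_simps del: fact_Suc) (simp add: algebra_simps)
  qed
  finally have "(\<lambda>s. (r / 2) powr (real N / 2 - 1) * ((r / 2) ^ Suc (2 * s) / (fact s * Gamma (real s + real N / 2 + 1))))
      sums ((r / 2) powr (real N / 2 - 1) * (ang 1 r / ?c))"
    by (rule sums_mult)
  also have "(\<lambda>s. (r / 2) powr (real N / 2 - 1) * ((r / 2) ^ Suc (2 * s) / (fact s * Gamma (real s + real N / 2 + 1))))
      = (\<lambda>s. 1 / (fact s * Gamma (real s + real N / 2 + 1)) * (r / 2) powr (real N / 2 + 2 * real s))"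
  proof
    fix s
    have "(r / 2) powr (real N / 2 + 2 * real s) = (r / 2) powr ((real N / 2 - 1) + real (Suc (2 * s)))"
      by (rule arg_cong) simp
    also have "\<dots> = (r / 2) powr (real N / 2 - 1) * (r / 2) ^ Suc (2 * s)"
      using assms by (subst powr_add, subst powr_realpow) auto
    finally have e: "(r / 2) powr (real N / 2 + 2 * real s) = (r / 2) powr (real N / 2 - 1) * (r / 2) ^ Suc (2 * s)" .
    show "(r / 2) powr (real N / 2 - 1) * ((r / 2) ^ Suc (2 * s) / (fact s * Gamma (real s + real N / 2 + 1)))
      = 1 / (fact s * Gamma (real s + real N / 2 + 1)) * (r / 2) powr (real N / 2 + 2 * real s)"
      unfolding e by simp
  qed
  finally show ?thesis unfolding bessel_I_def by (rule sums_unique[symmetric])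
qed

lemma bessel_ratio_eq_mag: "r > 0 \<Longrightarrow> bessel_ratio N r = mag r"
  using ang_0_pos[of 0] Gamma_half_N_pos
  by (simp add: bessel_ratio_def ang_0_bessel ang_1_bessel mag_def)

lemma deriv_bessel_ratio:
  assumes "r > 0"
  shows "deriv (bessel_ratio N) r = mag' r"
proof (rule DERIV_imp_deriv)
  show "(bessel_ratio N has_real_derivative mag' r) (at r)"
    by (rule has_field_derivative_transform_within_open[OF mag_has_derivative, of "{0<..}"])
      (use assms bessel_ratio_eq_mag in auto)
qed

end

text \<open>Below the critical temperature: \<open>\<beta>\<close> exceeds \<open>N\<close>, the inverse of the slope at 0.\<close>

locale low_temperature = angular +
  fixes \<beta> :: real
  assumes \<beta>_gt_N: "real N < \<beta>"
begin

lemma \<beta>_pos: "0 < \<beta>" using \<beta>_gt_N by (smt (verit) of_nat_0_le_iff)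

lemma slope_0: "slope 0 = 1 / real N"
proof -
  have "real N * ang 2 0 = ang 0 0"
    using ang_moment_rec[of 1] by (simp add: algebra_simps numeral_2_eq_2)
  then have e: "ang 2 0 / ang 0 0 = 1 / real N"
    using ang_0_pos[of 0] N_ge_2 by (simp add: field_simps)
  show ?thesis unfolding slope_def e using N_ge_2 by (simp add: field_simps)
qed

definition b :: real where "b = b_root N \<beta>"

text \<open>
  The positive roots are the points where the slope, which decreases from \<open>1 / N > 1 / \<beta>\<close>, equals \<open>1 / \<beta>\<close>.
  At \<open>\<beta>\<close> it is below that value because the mean of \<open>cos t\<close> is below 1.
\<close>

lemma ex1_root: "\<exists>!x. x > 0 \<and> x - \<beta> * bessel_ratio N x = 0"
proof (rule ex_ex1I)
  have "slope \<beta> \<le> 1 / \<beta>"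
    using mag_less_1[of \<beta>] \<beta>_pos by (simp add: mag_eq_slope field_simps)
  moreover have "1 / \<beta> < slope 0"
    using \<beta>_gt_N N_ge_2 unfolding slope_0 by (intro divide_strict_left_mono) auto
  ultimately obtain x where x: "0 \<le> x" "x \<le> \<beta>" "slope x = 1 / \<beta>"
    using IVT2'[of slope \<beta> "1 / \<beta>" 0] continuous_slope \<beta>_pos by auto
  have "x \<noteq> 0" using x \<open>1 / \<beta> < slope 0\<close> by auto
  then have "x > 0" using x by simp
  moreover have "x - \<beta> * bessel_ratio N x = 0"
    unfolding bessel_ratio_eq_mag[OF \<open>x > 0\<close>] mag_eq_slope x(3) using \<beta>_pos by simp
  ultimately show "\<exists>x. x > 0 \<and> x - \<beta> * bessel_ratio N x = 0" by blast
next
  fix x y assume xy: "0 < x \<and> x - \<beta> * bessel_ratio N x = 0" "0 < y \<and> y - \<beta> * bessel_ratio N y = 0"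
  have "slope z = 1 / \<beta>" if "0 < z \<and> z - \<beta> * bessel_ratio N z = 0" for z
    using that \<beta>_pos by (auto simp: bessel_ratio_eq_mag mag_eq_slope field_simps)
  then have "slope x = slope y" using xy by metis
  then show "x = y"
    using slope_strict_decrease[of x y] slope_strict_decrease[of y x] xy by (cases x y rule: linorder_cases) auto
qed

lemma b_pos: "0 < b" and \<beta>_mag_b: "\<beta> * mag b = b"
proof -
  have "b > 0 \<and> b - \<beta> * bessel_ratio N b = 0"
    unfolding b_def b_root_def by (rule theI'[OF ex1_root])
  then show "0 < b" "\<beta> * mag b = b" by (auto simp: bessel_ratio_eq_mag)
qed

lemma b_less_\<beta>: "b < \<beta>"
  using \<beta>_mag_b mag_less_1[of b] \<beta>_pos by (smt (verit) mult_less_cancel_left_pos mult_cancel_left1)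

lemma \<beta>_slope_b: "\<beta> * slope b = 1"
  using \<beta>_mag_b b_pos by (simp add: mag_eq_slope)

lemma \<beta>_mag'_b: "\<beta> * mag' b < 1"
  using mult_strict_left_mono[OF mag'_less_slope[OF b_pos] \<beta>_pos] \<beta>_slope_b by simp

lemma B_squared_eq: "B_squared N \<beta> = 4 * \<beta>\<^sup>2 * mag' b / ((1 - \<beta> * mag' b) * b\<^sup>2)"
proof -
  have "1 - (real N - 1) * mag b / b - (mag b)\<^sup>2 = mag' b"
    using riccati[of b] b_pos by (simp add: field_simps)
  then show ?thesis
    using b_pos by (simp add: B_squared_def Let_def deriv_bessel_ratio bessel_ratio_eq_mag flip: b_def)
qed

lemma B_squared_pos: "0 < B_squared N \<beta>"
  unfolding B_squared_eq using \<beta>_pos b_pos mag'_pos[of b] \<beta>_mag'_b by (intro divide_pos_pos mult_pos_pos) auto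

end

section \<open>The Stein kernel of the tilted angular law\<close>

lemma x_cos_le_sin:
  assumes "0 \<le> x" "x \<le> pi"
  shows "x * cos x \<le> sin x"
proof -
  have "sin 0 - 0 * cos 0 \<le> sin x - x * cos x"
  proof (rule DERIV_nonneg_imp_nondecreasing[OF assms(1)])
    fix y assume y: "0 \<le> y" "y \<le> x"
    have "((\<lambda>y. sin y - y * cos y) has_real_derivative y * sin y) (at y)"
      by (rule derivative_eq_intros refl)+ simp
    moreover have "0 \<le> y * sin y" using y assms by (intro mult_nonneg_nonneg sin_ge_zero) auto
    ultimately show "\<exists>d. ((\<lambda>y. sin y - y * cos y) has_real_derivative d) (at y) \<and> 0 \<le> d" by blast
  qed
  then show ?thesis by simp
qed

lemma le_two_sin:
  assumes "0 \<le> x" "x \<le> pi / 2"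
  shows "x \<le> 2 * sin x"
proof -
  have c: "sqrt 2 / 2 \<le> cos (x / 2)"
    using cos_monotone_0_pi_le[of "x / 2" "pi / 4"] assms pi_gt_zero by (simp add: cos_45)
  have "x / 2 * (sqrt 2 / 2) \<le> x / 2 * cos (x / 2)"
    using assms by (intro mult_left_mono c) auto
  also have "\<dots> \<le> sin (x / 2)" using assms by (intro x_cos_le_sin) auto
  finally have s: "x / 2 * (sqrt 2 / 2) \<le> sin (x / 2)" .
  have "x / 2 * (sqrt 2 / 2) * (sqrt 2 / 2) \<le> sin (x / 2) * cos (x / 2)"
    using assms by (intro mult_mono s c order_trans[OF _ s]) auto
  also have "2 * (sin (x / 2) * cos (x / 2)) = sin x"
    using sin_double[of "x / 2"] by simp
  finally show ?thesis by (simp add: field_simps)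
qed

context angular
begin

definition centred :: "real \<Rightarrow> real \<Rightarrow> real" where
  "centred r t = (cos t - mag r) * exp (r * cos t) * sin t ^ (N - 2)"

definition prim :: "real \<Rightarrow> real \<Rightarrow> real" where
  "prim r \<theta> = integral {0..\<theta>} (centred r)"

text \<open>
  For \<open>x = cos t\<close> with \<open>t\<close> of density proportional to \<open>exp (r * cos t) * sin t ^ (N - 2)\<close>, the
  covariance of \<open>x\<close> and \<open>h x\<close> is the mean of \<open>kern r t * h' x\<close>. The primitive of the centred
  density vanishes at both ends of \<open>[0, pi]\<close>, so that integrating from the nearer end shows the
  kernel to be of the size of \<open>(sin t)\<^sup>2\<close>.
\<close>

definition kern :: "real \<Rightarrow> real \<Rightarrow> real" where
  "kern r \<theta> = sin \<theta> * exp (- (r * cos \<theta>)) * prim r \<theta> / sin \<theta> ^ (N - 2)"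

lemma continuous_centred: "continuous_on S (centred r)"
  unfolding centred_def by (intro continuous_intros)

lemma centred_integrable: "centred r integrable_on {a..c}"
  by (intro integrable_continuous_interval continuous_centred)

lemma prim_0 [simp]: "prim r 0 = 0"
  by (simp add: prim_def)

lemma prim_pi [simp]: "prim r pi = 0"
proof -
  have "((\<lambda>t. cos t ^ 1 * exp (r * cos t) * sin t ^ (N - 2) - mag r * (cos t ^ 0 * exp (r * cos t) * sin t ^ (N - 2)))
      has_integral ang 1 r - mag r * ang 0 r) {0..pi}"
    by (intro has_integral_diff has_integral_mult_right ang_has_integral)
  then have "(centred r has_integral ang 1 r - mag r * ang 0 r) {0..pi}"
    by (rule has_integral_eq[rotated]) (simp add: centred_def algebra_simps)
  then have "prim r pi = ang 1 r - mag r * ang 0 r"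
    unfolding prim_def by (rule integral_unique)
  then show ?thesis using ang_0_pos[of r] by (simp add: mag_def)
qed

text \<open>
  On the interval from \<open>\<theta>\<close> to the nearer end of \<open>[0, pi]\<close> the sine is largest at \<open>\<theta>\<close>, and the length is at
  most of the order of \<open>sin \<theta>\<close>. As the total integral is 0, the primitive is up to sign the integral over it.
\<close>

lemma prim_short_interval:
  assumes "0 \<le> \<theta>" "\<theta> \<le> pi"
  obtains a c s where "a \<le> c" "{a..c} \<subseteq> {0..pi}" "\<And>t. t \<in> {a..c} \<Longrightarrow> sin t \<le> sin \<theta>"
    "c - a \<le> 2 * sin \<theta>" "\<bar>s\<bar> = 1" "\<And>r. prim r \<theta> = s * integral {a..c} (centred r)"
proof (cases "\<theta> \<le> pi / 2")
  case True
  show ?thesis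
  proof (rule that[of 0 \<theta> 1])
    show "sin t \<le> sin \<theta>" if "t \<in> {0..\<theta>}" for t
      using that True pi_gt_zero by (intro sin_monotone_2pi_le) auto
    show "\<theta> - 0 \<le> 2 * sin \<theta>" using le_two_sin[of \<theta>] True assms by simp
  qed (use assms in \<open>auto simp: prim_def\<close>)
next
  case False
  show ?thesis
  proof (rule that[of \<theta> pi "-1"])
    show "sin t \<le> sin \<theta>" if "t \<in> {\<theta>..pi}" for t
    proof -
      have "sin (pi - t) \<le> sin (pi - \<theta>)"
        using that False pi_gt_zero by (intro sin_monotone_2pi_le) auto
      then show ?thesis by simp
    qed
    show "pi - \<theta> \<le> 2 * sin \<theta>" using le_two_sin[of "pi - \<theta>"] False assms by simp
    fix r
    have "integral {0..\<theta>} (centred r) + integral {\<theta>..pi} (centred r) = integral {0..pi} (centred r)"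
      by (intro Henstock_Kurzweil_Integration.integral_combine assms centred_integrable)
    then show "prim r \<theta> = - 1 * integral {\<theta>..pi} (centred r)"
      using prim_pi[of r] by (simp add: prim_def)
  qed (use assms in auto)
qed

lemma interval_integral_abs_le:
  fixes f :: "real \<Rightarrow> real"
  assumes "a \<le> c" "continuous_on {a..c} f" "\<And>t. t \<in> {a..c} \<Longrightarrow> \<bar>f t\<bar> \<le> B"
  shows "\<bar>integral {a..c} f\<bar> \<le> B * (c - a)"
proof -
  have "norm (integral {a..c} f) \<le> B * (c - a)"
    by (rule integral_bound) (use assms in auto)
  then show ?thesis by simp
qed

lemma prim_bound:
  assumes "0 \<le> \<theta>" "\<theta> \<le> pi"
  shows "\<bar>prim r \<theta>\<bar> \<le> 4 * exp \<bar>r\<bar> * sin \<theta> * sin \<theta> ^ (N - 2)"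
proof -
  obtain a c s where acs: "a \<le> c" "{a..c} \<subseteq> {0..pi}" "\<And>t. t \<in> {a..c} \<Longrightarrow> sin t \<le> sin \<theta>"
    "c - a \<le> 2 * sin \<theta>" "\<bar>s\<bar> = 1" "\<And>r. prim r \<theta> = s * integral {a..c} (centred r)"
    using prim_short_interval[OF assms] by metis
  have "\<bar>centred r t\<bar> \<le> 2 * exp \<bar>r\<bar> * sin \<theta> ^ (N - 2)" if t: "t \<in> {a..c}" for t
  proof -
    have s0: "0 \<le> sin t" using acs(2) t by (intro sin_ge_zero) auto
    have "\<bar>cos t - mag r\<bar> * exp (r * cos t) * sin t ^ (N - 2) \<le> 2 * exp \<bar>r\<bar> * sin \<theta> ^ (N - 2)"
    proof (intro mult_mono power_mono acs(3) t s0)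
      show "\<bar>cos t - mag r\<bar> \<le> 2" using abs_cos_le_one[of t] abs_mag_le_1[of r] by linarith
      show "exp (r * cos t) \<le> exp \<bar>r\<bar>" using abs_mult_cos_le[of r t] by simp
    qed (use s0 in auto)
    then show ?thesis using s0 by (simp add: centred_def abs_mult)
  qed
  then have "\<bar>integral {a..c} (centred r)\<bar> \<le> 2 * exp \<bar>r\<bar> * sin \<theta> ^ (N - 2) * (c - a)"
    by (intro interval_integral_abs_le acs continuous_centred)
  also have "\<dots> \<le> 2 * exp \<bar>r\<bar> * sin \<theta> ^ (N - 2) * (2 * sin \<theta>)"
    using assms by (intro mult_left_mono acs mult_nonneg_nonneg zero_le_power sin_ge_zero) auto
  finally show ?thesis using acs(5) by (simp add: acs(6) abs_mult mult_ac)
qed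

lemma kern_bound:
  assumes "0 \<le> \<theta>" "\<theta> \<le> pi" "\<bar>r\<bar> \<le> \<rho>"
  shows "\<bar>kern r \<theta>\<bar> \<le> 4 * exp (2 * \<rho>) * (sin \<theta>)\<^sup>2"
proof (cases "sin \<theta> = 0")
  case True
  then show ?thesis by (simp add: kern_def)
next
  case False
  then have s: "0 < sin \<theta>" using sin_ge_zero[of \<theta>] assms by simp
  have "\<bar>kern r \<theta>\<bar> = sin \<theta> * exp (- (r * cos \<theta>)) * \<bar>prim r \<theta>\<bar> / sin \<theta> ^ (N - 2)"
    using s by (simp add: kern_def abs_mult)
  also have "\<dots> \<le> sin \<theta> * exp \<rho> * (4 * exp \<rho> * sin \<theta> * sin \<theta> ^ (N - 2)) / sin \<theta> ^ (N - 2)"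
  proof (intro divide_right_mono mult_mono mult_left_mono)
    show "exp (- (r * cos \<theta>)) \<le> exp \<rho>" using abs_mult_cos_le[of r \<theta>] assms by simp
    have "4 * exp \<bar>r\<bar> * sin \<theta> * sin \<theta> ^ (N - 2) \<le> 4 * exp \<rho> * sin \<theta> * sin \<theta> ^ (N - 2)"
      using s assms by (intro mult_right_mono) auto
    with prim_bound[OF assms(1,2), of r]
    show "\<bar>prim r \<theta>\<bar> \<le> 4 * exp \<rho> * sin \<theta> * sin \<theta> ^ (N - 2)" by linarith
  qed (use s in auto)
  also have "\<dots> = 4 * exp (2 * \<rho>) * (sin \<theta>)\<^sup>2"
  proof -
    have "exp (2 * \<rho>) = exp \<rho> * exp \<rho>" by (simp flip: exp_add)
    then show ?thesis using s by (simp add: power2_eq_square)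
  qed
  finally show ?thesis .
qed

text \<open>
  The Lipschitz bounds in \<open>r\<close> and in \<open>cos \<theta>\<close> serve to compare the kernels of a spin before and after
  another spin has been removed. For the tilt, the factor \<open>exp (- (r * cos \<theta>))\<close> is moved into the
  integral, whose integrand is Lipschitz in \<open>r\<close> uniformly.
\<close>

lemma kern_lipschitz_tilt:
  assumes \<theta>: "0 \<le> \<theta>" "\<theta> \<le> pi" and r: "\<bar>r\<bar> \<le> \<rho>" "\<bar>r'\<bar> \<le> \<rho>"
  shows "\<bar>kern r \<theta> - kern r' \<theta>\<bar> \<le> 10 * exp (2 * \<rho>) * \<bar>r - r'\<bar>"
proof (cases "sin \<theta> = 0")
  case True
  then show ?thesis by (simp add: kern_def)
next
  case False
  then have s: "0 < sin \<theta>" using sin_ge_zero[of \<theta>] \<theta> by simp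
  obtain a c \<epsilon> where acs: "a \<le> c" "{a..c} \<subseteq> {0..pi}" "\<And>t. t \<in> {a..c} \<Longrightarrow> sin t \<le> sin \<theta>"
    "c - a \<le> 2 * sin \<theta>" "\<bar>\<epsilon>\<bar> = 1" "\<And>r. prim r \<theta> = \<epsilon> * integral {a..c} (centred r)"
    using prim_short_interval[OF \<theta>] by metis
  let ?u = "\<lambda>t r. (cos t - mag r) * exp (r * (cos t - cos \<theta>))"
  have u: "\<bar>?u t r - ?u t r'\<bar> \<le> 5 * exp (2 * \<rho>) * \<bar>r - r'\<bar>" for t
  proof -
    have "norm (?u t r - ?u t r') \<le> 5 * exp (2 * \<rho>) * norm (r - r')"
    proof (rule field_differentiable_bound[of "{- \<rho>..\<rho>}" "?u t"])
      fix x assume x: "x \<in> {- \<rho>..\<rho>}"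
      let ?e = "exp (x * (cos t - cos \<theta>))" and ?d = "cos t - cos \<theta>"
      show "(?u t has_field_derivative (- mag' x + (cos t - mag x) * ?d) * ?e) (at x within {- \<rho>..\<rho>})"
        by (rule derivative_eq_intros mag_has_derivative refl)+ (simp add: algebra_simps)
      have d: "\<bar>?d\<bar> \<le> 2" using abs_cos_le_one[of t] abs_cos_le_one[of \<theta>] by linarith
      have "\<bar>(cos t - mag x) * ?d\<bar> \<le> 2 * 2"
        unfolding abs_mult using abs_cos_le_one[of t] abs_mag_le_1[of x] by (intro mult_mono d) linarith+
      then have "\<bar>- mag' x + (cos t - mag x) * ?d\<bar> \<le> 5"
        using mag'_nonneg[of x] mag'_le_1[of x] by linarith
      moreover have "\<bar>x * ?d\<bar> \<le> \<rho> * 2"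
        unfolding abs_mult using x by (intro mult_mono d) auto
      then have "?e \<le> exp (2 * \<rho>)" by (simp add: mult.commute)
      ultimately show "norm ((- mag' x + (cos t - mag x) * ?d) * ?e) \<le> 5 * exp (2 * \<rho>)"
        unfolding real_norm_def abs_mult by (intro mult_mono) auto
    qed (use r in auto)
    then show ?thesis by simp
  qed
  have eq: "kern r \<theta> = \<epsilon> * sin \<theta> / sin \<theta> ^ (N - 2) * integral {a..c} (\<lambda>t. ?u t r * sin t ^ (N - 2))" for r
  proof -
    have "integral {a..c} (\<lambda>t. ?u t r * sin t ^ (N - 2))
        = integral {a..c} (\<lambda>t. exp (- (r * cos \<theta>)) * centred r t)"
      by (intro integral_cong)
        (simp add: centred_def right_diff_distrib exp_diff exp_minus divide_inverse mult_ac)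
    then show ?thesis by (simp add: kern_def acs(6) mult_ac)
  qed
  have "kern r \<theta> - kern r' \<theta> = \<epsilon> * sin \<theta> / sin \<theta> ^ (N - 2) *
      integral {a..c} (\<lambda>t. ?u t r * sin t ^ (N - 2) - ?u t r' * sin t ^ (N - 2))"
    unfolding eq
    by (subst Henstock_Kurzweil_Integration.integral_diff, (intro integrable_continuous_interval continuous_intros)+)
      (simp add: right_diff_distrib)
  then have "\<bar>kern r \<theta> - kern r' \<theta>\<bar> = sin \<theta> / sin \<theta> ^ (N - 2) *
      \<bar>integral {a..c} (\<lambda>t. ?u t r * sin t ^ (N - 2) - ?u t r' * sin t ^ (N - 2))\<bar>"
    using s acs(5) by (simp add: abs_mult)
  also have "\<dots> \<le> sin \<theta> / sin \<theta> ^ (N - 2) * (5 * exp (2 * \<rho>) * \<bar>r - r'\<bar> * sin \<theta> ^ (N - 2) * (c - a))"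
  proof (intro mult_left_mono interval_integral_abs_le acs continuous_intros)
    fix t assume t: "t \<in> {a..c}"
    have s0: "0 \<le> sin t" using acs(2) t by (intro sin_ge_zero) auto
    have "\<bar>?u t r - ?u t r'\<bar> * sin t ^ (N - 2) \<le> 5 * exp (2 * \<rho>) * \<bar>r - r'\<bar> * sin \<theta> ^ (N - 2)"
      using s0 by (intro mult_mono u power_mono acs(3) t) auto
    then show "\<bar>?u t r * sin t ^ (N - 2) - ?u t r' * sin t ^ (N - 2)\<bar> \<le> 5 * exp (2 * \<rho>) * \<bar>r - r'\<bar> * sin \<theta> ^ (N - 2)"
      using s0 by (simp add: abs_mult flip: left_diff_distrib)
  qed (use s in auto)
  also have "\<dots> \<le> sin \<theta> / sin \<theta> ^ (N - 2) * (5 * exp (2 * \<rho>) * \<bar>r - r'\<bar> * sin \<theta> ^ (N - 2) * (2 * sin \<theta>))"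
    using s acs(4) by (intro mult_left_mono) auto
  also have "\<dots> = 10 * exp (2 * \<rho>) * \<bar>r - r'\<bar> * (sin \<theta>)\<^sup>2"
    using s by (simp add: power2_eq_square)
  also have "\<dots> \<le> 10 * exp (2 * \<rho>) * \<bar>r - r'\<bar> * 1"
    by (intro mult_left_mono) (auto simp: abs_square_le_1)
  finally show ?thesis by simp
qed

lemma kern_deriv:
  assumes "0 < \<theta>" "\<theta> < pi"
  shows "(kern r has_real_derivative
     sin \<theta> * (cos \<theta> - mag r) + r * sin \<theta> * kern r \<theta> - (real N - 3) * cos \<theta> * (kern r \<theta> / sin \<theta>)) (at \<theta>)"
proof -
  have s: "0 < sin \<theta>" using assms by (rule sin_gt_zero)
  obtain m where m: "N = Suc (Suc m)"
    using N_ge_2 by (metis add_2_eq_Suc le_Suc_ex)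
  have mN: "N - 2 = m" "real N - 3 = real m - 1" by (simp_all add: m)
  have "((\<lambda>x. integral {0..x} (centred r)) has_real_derivative centred r \<theta>) (at \<theta> within {0..pi})"
    by (rule integral_has_real_derivative[OF continuous_centred]) (use assms in auto)
  then have p: "(prim r has_real_derivative centred r \<theta>) (at \<theta>)"
    using assms by (simp add: prim_def[abs_def] at_within_Icc_at)
  let ?e = "exp (- (r * cos \<theta>))"
  have "((\<lambda>\<theta>. sin \<theta> * exp (- (r * cos \<theta>)) * prim r \<theta>) has_real_derivative
     cos \<theta> * ?e * prim r \<theta> + sin \<theta> * (?e * (r * sin \<theta>)) * prim r \<theta> + sin \<theta> * ?e * centred r \<theta>) (at \<theta>)"
    by (rule derivative_eq_intros p refl)+ (simp add: algebra_simps)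
  moreover have "((\<lambda>\<theta>. sin \<theta> ^ (N - 2)) has_real_derivative real m * sin \<theta> ^ (m - 1) * cos \<theta>) (at \<theta>)"
    unfolding mN by (rule derivative_eq_intros refl)+ simp
  ultimately have "(kern r has_real_derivative
     ((cos \<theta> * ?e * prim r \<theta> + sin \<theta> * (?e * (r * sin \<theta>)) * prim r \<theta> + sin \<theta> * ?e * centred r \<theta>) * sin \<theta> ^ (N - 2)
       - sin \<theta> * ?e * prim r \<theta> * (real m * sin \<theta> ^ (m - 1) * cos \<theta>)) / (sin \<theta> ^ (N - 2) * sin \<theta> ^ (N - 2))) (at \<theta>)"
    unfolding kern_def[abs_def] by (rule DERIV_divide) (use s in simp)
  moreover have "((cos \<theta> * ?e * prim r \<theta> + sin \<theta> * (?e * (r * sin \<theta>)) * prim r \<theta> + sin \<theta> * ?e * centred r \<theta>) * sin \<theta> ^ (N - 2)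
       - sin \<theta> * ?e * prim r \<theta> * (real m * sin \<theta> ^ (m - 1) * cos \<theta>)) / (sin \<theta> ^ (N - 2) * sin \<theta> ^ (N - 2))
    = sin \<theta> * (cos \<theta> - mag r) + r * sin \<theta> * kern r \<theta> - (real N - 3) * cos \<theta> * (kern r \<theta> / sin \<theta>)"
  proof -
    have k: "?e * prim r \<theta> = kern r \<theta> / sin \<theta> * sin \<theta> ^ m"
      using s by (simp add: kern_def mN)
    have ce: "?e * centred r \<theta> = (cos \<theta> - mag r) * sin \<theta> ^ m"
      by (simp add: centred_def mN exp_minus)
    have sm: "real m * sin \<theta> ^ (m - 1) * sin \<theta> = real m * sin \<theta> ^ m"
      by (cases m) auto
    let ?Z = "cos \<theta> * (kern r \<theta> / sin \<theta>) + r * sin \<theta> * (sin \<theta> * (kern r \<theta> / sin \<theta>))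
        + sin \<theta> * (cos \<theta> - mag r) - real m * cos \<theta> * (kern r \<theta> / sin \<theta>)"
    have "(cos \<theta> * ?e * prim r \<theta> + sin \<theta> * (?e * (r * sin \<theta>)) * prim r \<theta> + sin \<theta> * ?e * centred r \<theta>) * sin \<theta> ^ m
       - sin \<theta> * ?e * prim r \<theta> * (real m * sin \<theta> ^ (m - 1) * cos \<theta>)
      = (cos \<theta> * (?e * prim r \<theta>) + r * sin \<theta> * sin \<theta> * (?e * prim r \<theta>) + sin \<theta> * (?e * centred r \<theta>)) * sin \<theta> ^ m
       - (?e * prim r \<theta>) * cos \<theta> * (real m * sin \<theta> ^ (m - 1) * sin \<theta>)"
      by (simp add: algebra_simps)
    also have "\<dots> = (sin \<theta> ^ m * sin \<theta> ^ m) * ?Z"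
      unfolding k ce sm by (simp add: algebra_simps)
    finally have num: "(cos \<theta> * ?e * prim r \<theta> + sin \<theta> * (?e * (r * sin \<theta>)) * prim r \<theta> + sin \<theta> * ?e * centred r \<theta>) * sin \<theta> ^ m
       - sin \<theta> * ?e * prim r \<theta> * (real m * sin \<theta> ^ (m - 1) * cos \<theta>) = (sin \<theta> ^ m * sin \<theta> ^ m) * ?Z" .
    have Z: "?Z = sin \<theta> * (cos \<theta> - mag r) + r * sin \<theta> * kern r \<theta> - (real m - 1) * cos \<theta> * (kern r \<theta> / sin \<theta>)"
    proof -
      define q where "q = kern r \<theta> / sin \<theta>"
      have "kern r \<theta> = sin \<theta> * q" using s by (simp add: q_def)
      then show ?thesis unfolding q_def[symmetric] by (simp add: algebra_simps)
    qed
    show ?thesis unfolding mN num Z[symmetric] using s by simp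
  qed
  ultimately show ?thesis by simp
qed

text \<open>
  The derivative in \<open>\<theta>\<close> is bounded by a multiple of \<open>sin \<theta>\<close>, the derivative of \<open>- cos \<theta>\<close>: adding or
  subtracting a multiple of \<open>cos\<close> makes the kernel monotone. The ends of \<open>[0, pi]\<close>, where the formula for
  the derivative degenerates, are covered by \<open>kern_bound\<close>.
\<close>

lemma kern_lipschitz_cos:
  assumes "0 \<le> \<theta>" "\<theta> \<le> pi" "0 \<le> \<theta>'" "\<theta>' \<le> pi" "\<bar>r\<bar> \<le> \<rho>"
  shows "\<bar>kern r \<theta> - kern r \<theta>'\<bar> \<le> (2 + 4 * (\<rho> + real N + 2) * exp (2 * \<rho>)) * \<bar>cos \<theta> - cos \<theta>'\<bar>"
proof -
  let ?C = "2 + 4 * (\<rho> + real N + 2) * exp (2 * \<rho>)"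
  have \<rho>: "0 \<le> \<rho>" using assms by linarith
  have C8: "8 * exp (2 * \<rho>) \<le> ?C" using \<rho> by (simp add: algebra_simps)
  have ends: "\<bar>kern r x - kern r y\<bar> \<le> ?C * \<bar>cos x - cos y\<bar>"
    if xy: "0 \<le> x" "x \<le> pi" "y = 0 \<or> y = pi" for x y
  proof -
    have y0: "kern r y = 0" "\<bar>cos y\<bar> = 1" "(cos y)\<^sup>2 = 1" using xy by (auto simp: kern_def)
    have "\<bar>kern r x\<bar> \<le> 4 * exp (2 * \<rho>) * (sin x)\<^sup>2" by (intro kern_bound xy assms)
    also have "(sin x)\<^sup>2 = (cos y - cos x) * (cos y + cos x)"
      using y0(3) by (simp add: sin_squared_eq algebra_simps power2_eq_square)
    also have "\<dots> \<le> \<bar>cos y - cos x\<bar> * 2"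
    proof -
      have "\<bar>(cos y - cos x) * (cos y + cos x)\<bar> \<le> \<bar>cos y - cos x\<bar> * 2"
        unfolding abs_mult using abs_cos_le_one[of x] y0(2) by (intro mult_left_mono) linarith+
      then show ?thesis by linarith
    qed
    finally have "\<bar>kern r x\<bar> \<le> 8 * exp (2 * \<rho>) * \<bar>cos x - cos y\<bar>"
      by (simp add: abs_minus_commute)
    also have "\<dots> \<le> ?C * \<bar>cos x - cos y\<bar>" by (intro mult_right_mono C8) simp
    finally show ?thesis using y0(1) by simp
  qed
  have inner: "\<bar>kern r x - kern r y\<bar> \<le> ?C * (cos x - cos y)" if xy: "0 < x" "x \<le> y" "y < pi" for x y
  proof -
    let ?k' = "\<lambda>z. sin z * (cos z - mag r) + r * sin z * kern r z - (real N - 3) * cos z * (kern r z / sin z)"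
    have k': "\<bar>?k' z\<bar> \<le> ?C * sin z" if z: "x \<le> z" "z \<le> y" for z
    proof -
      have s: "0 < sin z" "sin z \<le> 1" using xy z by (auto intro: sin_gt_zero)
      have kb: "\<bar>kern r z\<bar> \<le> 4 * exp (2 * \<rho>) * (sin z)\<^sup>2" using xy z assms by (intro kern_bound) auto
      also have "\<dots> = (4 * exp (2 * \<rho>) * sin z) * sin z" by (simp add: power2_eq_square)
      finally have kb': "\<bar>kern r z\<bar> / sin z \<le> 4 * exp (2 * \<rho>) * sin z" using s by (simp add: field_simps)
      have kb1: "\<bar>kern r z\<bar> \<le> 4 * exp (2 * \<rho>)"
        by (rule order_trans[OF kb]) (use s in \<open>auto simp: abs_square_le_1 intro!: mult_left_le\<close>)
      have 1: "\<bar>sin z * (cos z - mag r)\<bar> \<le> sin z * 2"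
        unfolding abs_mult using s abs_cos_le_one[of z] abs_mag_le_1[of r] by (intro mult_mono) linarith+
      have 2: "\<bar>r * sin z * kern r z\<bar> \<le> \<rho> * sin z * (4 * exp (2 * \<rho>))"
        unfolding abs_mult using s assms kb1 by (intro mult_mono) auto
      have 3: "\<bar>(real N - 3) * cos z * (kern r z / sin z)\<bar> \<le> (real N + 2) * 1 * (4 * exp (2 * \<rho>) * sin z)"
        unfolding abs_mult abs_divide using s kb' N_ge_2 by (intro mult_mono) (auto simp: abs_le_iff)
      have "\<bar>?k' z\<bar> \<le> sin z * 2 + \<rho> * sin z * (4 * exp (2 * \<rho>)) + (real N + 2) * 1 * (4 * exp (2 * \<rho>) * sin z)"
        using 1 2 3 by linarith
      then show ?thesis by (simp add: algebra_simps)
    qed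
    have d: "(kern r has_real_derivative ?k' z) (at z)" if "x \<le> z" "z \<le> y" for z
      using that xy by (intro kern_deriv) auto
    have "kern r y + ?C * cos y \<le> kern r x + ?C * cos x"
    proof (rule DERIV_nonpos_imp_nonincreasing[OF xy(2)])
      fix z assume z: "x \<le> z" "z \<le> y"
      have "((\<lambda>z. kern r z + ?C * cos z) has_real_derivative ?k' z - ?C * sin z) (at z)"
        using d[OF z] by (auto intro!: derivative_eq_intros)
      moreover have "?k' z - ?C * sin z \<le> 0" using k'[OF z] by linarith
      ultimately show "\<exists>D. ((\<lambda>z. kern r z + ?C * cos z) has_real_derivative D) (at z) \<and> D \<le> 0"
        by blast
    qed
    moreover have "kern r x - ?C * cos x \<le> kern r y - ?C * cos y"
    proof (rule DERIV_nonneg_imp_nondecreasing[OF xy(2)])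
      fix z assume z: "x \<le> z" "z \<le> y"
      have "((\<lambda>z. kern r z - ?C * cos z) has_real_derivative ?k' z + ?C * sin z) (at z)"
        using d[OF z] by (auto intro!: derivative_eq_intros)
      moreover have "0 \<le> d + c" if "\<bar>d\<bar> \<le> c" for c d :: real using that by linarith
      note this[OF k'[OF z]]
      ultimately show "\<exists>D. ((\<lambda>z. kern r z - ?C * cos z) has_real_derivative D) (at z) \<and> 0 \<le> D"
        by blast
    qed
    ultimately show ?thesis by (simp add: abs_le_iff right_diff_distrib)
  qed
  consider "\<theta> = 0 \<or> \<theta> = pi" | "\<theta>' = 0 \<or> \<theta>' = pi" | "0 < \<theta>" "\<theta> \<le> \<theta>'" "\<theta>' < pi" | "0 < \<theta>'" "\<theta>' \<le> \<theta>" "\<theta> < pi"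
    using assms by linarith
  then show ?thesis
  proof cases
    case 1 then show ?thesis using ends[of \<theta>' \<theta>] assms by (simp add: abs_minus_commute)
  next
    case 2 then show ?thesis using ends[of \<theta> \<theta>'] assms by simp
  next
    case 3
    have "\<bar>kern r \<theta> - kern r \<theta>'\<bar> \<le> ?C * (cos \<theta> - cos \<theta>')" by (rule inner[OF 3])
    also have "\<dots> \<le> ?C * \<bar>cos \<theta> - cos \<theta>'\<bar>" using \<rho> by (intro mult_left_mono) auto
    finally show ?thesis .
  next
    case 4
    have "\<bar>kern r \<theta>' - kern r \<theta>\<bar> \<le> ?C * (cos \<theta>' - cos \<theta>)" by (rule inner[OF 4])
    also have "\<dots> \<le> ?C * \<bar>cos \<theta>' - cos \<theta>\<bar>" using \<rho> by (intro mult_left_mono) auto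
    finally show ?thesis by (simp add: abs_minus_commute)
  qed
qed

lemma kern_density:
  "0 \<le> \<theta> \<Longrightarrow> \<theta> \<le> pi \<Longrightarrow> kern r \<theta> * exp (r * cos \<theta>) * sin \<theta> ^ (N - 2) = sin \<theta> * prim r \<theta>"
  by (cases "sin \<theta> = 0") (simp_all add: kern_def exp_minus)

text \<open>
  The function \<open>h\<close> may have a kink at one point \<open>z\<close>, as the solutions of the Stein equation for
  indicators of half-lines have.
\<close>

lemma stein_identity_angular:
  assumes h: "continuous_on UNIV h" and h': "\<And>u. u \<noteq> z \<Longrightarrow> (h has_real_derivative h' u) (at u)"
  shows "((\<lambda>\<theta>. ((cos \<theta> - mag r) * h (A + B * cos \<theta>) - B * h' (A + B * cos \<theta>) * kern r \<theta>)
      * (exp (r * cos \<theta>) * sin \<theta> ^ (N - 2))) has_integral 0) {0..pi}"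
proof (cases "B = 0")
  case True
  have "((\<lambda>\<theta>. h A * centred r \<theta>) has_integral h A * integral {0..pi} (centred r)) {0..pi}"
    by (intro has_integral_mult_right integrable_integral centred_integrable)
  then have "((\<lambda>\<theta>. h A * centred r \<theta>) has_integral 0) {0..pi}"
    using prim_pi[of r] by (simp add: prim_def)
  then show ?thesis
    by (rule has_integral_eq[rotated]) (simp add: True centred_def)
next
  case False
  let ?F = "\<lambda>\<theta>. h (A + B * cos \<theta>) * prim r \<theta>"
  let ?f = "\<lambda>\<theta>. h (A + B * cos \<theta>) * centred r \<theta> - B * h' (A + B * cos \<theta>) * (sin \<theta> * prim r \<theta>)"
  have p: "(prim r has_real_derivative centred r \<theta>) (at \<theta> within {0..pi})" if "\<theta> \<in> {0..pi}" for \<theta>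
    unfolding prim_def[abs_def] by (rule integral_has_real_derivative[OF continuous_centred that])
  have "(?f has_integral ?F pi - ?F 0) {0..pi}"
  proof (rule fundamental_theorem_of_calculus_interior_strong[of "{arccos ((z - A) / B)}"])
    show "continuous_on {0..pi} ?F"
      by (intro continuous_intros continuous_on_compose2[OF h] DERIV_continuous_on[OF p]) auto
    fix \<theta> assume \<theta>: "\<theta> \<in> {0<..<pi} - {arccos ((z - A) / B)}"
    have "A + B * cos \<theta> \<noteq> z"
    proof
      assume "A + B * cos \<theta> = z"
      then have "(z - A) / B = cos \<theta>" using False by auto
      then have "arccos ((z - A) / B) = \<theta>" using \<theta> by (simp add: arccos_cos)
      then show False using \<theta> by simp
    qed
    note dh = h'[OF this]
    have dp: "(prim r has_real_derivative centred r \<theta>) (at \<theta>)"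
      using p[of \<theta>] \<theta> by (simp add: at_within_Icc_at)
    have "((\<lambda>\<theta>. h (A + B * cos \<theta>)) has_real_derivative h' (A + B * cos \<theta>) * (- B * sin \<theta>)) (at \<theta>)"
      by (rule DERIV_chain2[where f = h and g = "\<lambda>\<theta>. A + B * cos \<theta>", OF dh]) (auto intro!: derivative_eq_intros)
    from DERIV_mult[OF this dp] show "(?F has_vector_derivative ?f \<theta>) (at \<theta>)"
      unfolding has_real_derivative_iff_has_vector_derivative[symmetric] by (simp add: algebra_simps)
  qed auto
  then have "(?f has_integral 0) {0..pi}" by simp
  then show ?thesis
  proof (rule has_integral_eq[rotated])
    fix \<theta> assume "\<theta> \<in> {0..pi}"
    then have "sin \<theta> * prim r \<theta> = kern r \<theta> * exp (r * cos \<theta>) * sin \<theta> ^ (N - 2)"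
      using kern_density by simp
    then show "?f \<theta> = ((cos \<theta> - mag r) * h (A + B * cos \<theta>) - B * h' (A + B * cos \<theta>) * kern r \<theta>)
      * (exp (r * cos \<theta>) * sin \<theta> ^ (N - 2))"
      by (simp add: centred_def algebra_simps)
  qed
qed

text \<open>The Stein identity for \<open>h x = x\<close>.\<close>

lemma kern_mean:
  "((\<lambda>\<theta>. (kern r \<theta> - mag' r) * (exp (r * cos \<theta>) * sin \<theta> ^ (N - 2))) has_integral 0) {0..pi}"
proof -
  let ?w = "\<lambda>\<theta>. exp (r * cos \<theta>) * sin \<theta> ^ (N - 2)"
  have 1: "((\<lambda>\<theta>. ((cos \<theta> - mag r) * (0 + 1 * cos \<theta>) - 1 * 1 * kern r \<theta>) * ?w \<theta>) has_integral 0) {0..pi}"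
    by (rule stein_identity_angular[of "\<lambda>x. x" 0 "\<lambda>_. 1"]) (auto intro!: continuous_intros)
  have 2: "((\<lambda>\<theta>. cos \<theta> ^ 2 * exp (r * cos \<theta>) * sin \<theta> ^ (N - 2)
      - mag r * (cos \<theta> ^ 1 * exp (r * cos \<theta>) * sin \<theta> ^ (N - 2))
      - mag' r * (cos \<theta> ^ 0 * exp (r * cos \<theta>) * sin \<theta> ^ (N - 2)))
      has_integral ang 2 r - mag r * ang 1 r - mag' r * ang 0 r) {0..pi}"
    by (intro has_integral_diff has_integral_mult_right ang_has_integral)
  have "ang 2 r - mag r * ang 1 r - mag' r * ang 0 r = 0"
    using ang_0_pos[of r] by (simp add: mag'_def mag_def field_simps power2_eq_square)
  with has_integral_diff[OF 2 1] have "((\<lambda>\<theta>. (cos \<theta> ^ 2 * exp (r * cos \<theta>) * sin \<theta> ^ (N - 2)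
      - mag r * (cos \<theta> ^ 1 * exp (r * cos \<theta>) * sin \<theta> ^ (N - 2))
      - mag' r * (cos \<theta> ^ 0 * exp (r * cos \<theta>) * sin \<theta> ^ (N - 2)))
      - ((cos \<theta> - mag r) * (0 + 1 * cos \<theta>) - 1 * 1 * kern r \<theta>) * ?w \<theta>) has_integral 0) {0..pi}"
    by simp
  then show ?thesis by (rule has_integral_eq[rotated]) (simp add: algebra_simps power2_eq_square)
qed

end

section \<open>The law of a coordinate on the sphere\<close>

lemma measurable_uniform_sphere_borel [measurable]: "(\<lambda>s. s) \<in> measurable uniform_sphere borel"
  unfolding measurable_cong_sets[OF sets_uniform_sphere refl] by (rule measurable_restrict_space1) simp

interpretation sphere: prob_space uniform_sphere
  by (rule prob_space_uniform_sphere)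

lemma sphere_integrable_bounded:
  fixes F :: "real ^ 'n \<Rightarrow> real"
  assumes "F \<in> borel_measurable uniform_sphere" "\<And>s. norm s = 1 \<Longrightarrow> \<bar>F s\<bar> \<le> C"
  shows "integrable uniform_sphere F"
  by (rule sphere.integrable_const_bound[of F C]) (use assms in auto)

lemma sphere_integral_orthogonal:
  fixes F :: "real ^ 'n \<Rightarrow> real" and T :: "real ^ 'n \<Rightarrow> real ^ 'n"
  assumes T: "orthogonal_transformation T" and F: "F \<in> borel_measurable borel"
  shows "(\<integral>s. F (T s) \<partial>uniform_sphere) = (\<integral>s. F s \<partial>uniform_sphere)"
proof -
  have T_borel: "T \<in> borel_measurable borel"
    using orthogonal_transformation_linear[OF T]
    by (simp add: borel_measurable_continuous_onI linear_continuous_on linear_conv_bounded_linear)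
  have [measurable]: "T \<in> measurable uniform_sphere uniform_sphere"
    unfolding measurable_cong_sets[OF sets_uniform_sphere sets_uniform_sphere]
    by (rule measurable_restrict_space3[OF T_borel]) (auto simp: orthogonal_transformation_norm[OF T])
  have "(\<integral>s. F s \<partial>uniform_sphere) = (\<integral>s. F s \<partial>distr uniform_sphere uniform_sphere T)"
    by (simp add: uniform_sphere_rotation_invariant[OF T])
  also have "\<dots> = (\<integral>s. F (T s) \<partial>uniform_sphere)"
    using F by (intro integral_distr) auto
  finally show ?thesis ..
qed

definition plane_rotation :: "'n \<Rightarrow> 'n \<Rightarrow> real \<Rightarrow> real ^ 'n \<Rightarrow> real ^ 'n" where
  "plane_rotation i j \<theta> x =
     (\<chi> k. if k = i then cos \<theta> * x $ i + sin \<theta> * x $ j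
           else if k = j then cos \<theta> * x $ j - sin \<theta> * x $ i else x $ k)"

lemma orthogonal_plane_rotation:
  fixes i j :: "'n::finite"
  assumes "i \<noteq> j"
  shows "orthogonal_transformation (plane_rotation i j \<theta>)"
  unfolding orthogonal_transformation_def
proof (intro conjI allI)
  show "linear (plane_rotation i j \<theta>)"
    by (rule linearI) (auto simp: plane_rotation_def vec_eq_iff algebra_simps)
  fix v w :: "real ^ 'n"
  have split: "(\<Sum>k\<in>UNIV. g k) = g i + g j + (\<Sum>k\<in>UNIV - {i} - {j}. g k)" for g :: "'n \<Rightarrow> real"
    using assms by (simp add: sum.remove[of UNIV i] sum.remove[of "UNIV - {i}" j] add.assoc)
  have cs: "cos \<theta> * cos \<theta> = 1 - sin \<theta> * sin \<theta>"
    using sin_cos_squared_add[of \<theta>] by (simp add: power2_eq_square algebra_simps)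
  have "(cos \<theta> * v $ i + sin \<theta> * v $ j) * (cos \<theta> * w $ i + sin \<theta> * w $ j)
      + (cos \<theta> * v $ j - sin \<theta> * v $ i) * (cos \<theta> * w $ j - sin \<theta> * w $ i)
      = (cos \<theta> * cos \<theta> + sin \<theta> * sin \<theta>) * (v $ i * w $ i + v $ j * w $ j)"
    by algebra
  also have "cos \<theta> * cos \<theta> + sin \<theta> * sin \<theta> = 1" by (simp add: cs)
  finally have *: "(cos \<theta> * v $ i + sin \<theta> * v $ j) * (cos \<theta> * w $ i + sin \<theta> * w $ j)
      + (cos \<theta> * v $ j - sin \<theta> * v $ i) * (cos \<theta> * w $ j - sin \<theta> * w $ i)
      = v $ i * w $ i + v $ j * w $ j" by simp
  show "plane_rotation i j \<theta> v \<bullet> plane_rotation i j \<theta> w = v \<bullet> w"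
    unfolding inner_vec_def split inner_real_def plane_rotation_def using assms *
    by (simp cong: sum.cong_simp)
qed

lemma borel_measurable_component [measurable (raw)]:
  fixes f :: "'a \<Rightarrow> real ^ 'n"
  assumes [measurable]: "f \<in> borel_measurable M"
  shows "(\<lambda>x. f x $ i) \<in> borel_measurable M"
  unfolding cart_eq_inner_axis by measurable

lemma abs_component_sphere: "norm s = 1 \<Longrightarrow> \<bar>s $ i\<bar> \<le> 1" for s :: "real ^ 'n"
  using component_le_norm_cart[of s i] by simp

lemma sphere_integrable_monomial:
  "integrable uniform_sphere (\<lambda>s :: real ^ 'n. s $ j ^ l * s $ i ^ m)"
proof (rule sphere_integrable_bounded[of _ 1])
  show "(\<lambda>s :: real ^ 'n. s $ j ^ l * s $ i ^ m) \<in> borel_measurable uniform_sphere" by measurable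
  show "\<bar>s $ j ^ l * s $ i ^ m\<bar> \<le> 1" if "norm s = 1" for s :: "real ^ 'n"
    unfolding abs_mult power_abs using abs_component_sphere[OF that]
    by (intro mult_le_one power_le_one) auto
qed

text \<open>
  The mean of \<open>s\<^sub>j * s\<^sub>i ^ k\<close> over a rotated point does not depend on the angle of the rotation in the
  plane of the coordinates \<open>i\<close> and \<open>j\<close>; this is the derivative at the angle 0.
\<close>

lemma sphere_rotation_derivative:
  fixes i j :: "'n::finite"
  assumes ij: "i \<noteq> j"
  shows "(\<integral>s. s $ i ^ Suc k \<partial>uniform_sphere) = real k * (\<integral>s. (s $ j)\<^sup>2 * s $ i ^ (k - 1) \<partial>uniform_sphere)"
proof -
  define F :: "real \<Rightarrow> real ^ 'n \<Rightarrow> real" where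
    "F \<theta> s = (cos \<theta> * s $ j - sin \<theta> * s $ i) * (cos \<theta> * s $ i + sin \<theta> * s $ j) ^ k" for \<theta> s
  define D :: "real \<Rightarrow> real ^ 'n \<Rightarrow> real" where
    "D \<theta> s = (- sin \<theta> * s $ j - cos \<theta> * s $ i) * (cos \<theta> * s $ i + sin \<theta> * s $ j) ^ k
      + (cos \<theta> * s $ j - sin \<theta> * s $ i) * (real k * (cos \<theta> * s $ i + sin \<theta> * s $ j) ^ (k - 1) * (- sin \<theta> * s $ i + cos \<theta> * s $ j))" for \<theta> s
  have [measurable]: "F \<theta> \<in> borel_measurable uniform_sphere" for \<theta>
    unfolding F_def by measurable
  have D: "((\<lambda>\<theta>. F \<theta> s) has_real_derivative D \<theta> s) (at \<theta>)" for \<theta> s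
    unfolding F_def D_def by (rule derivative_eq_intros refl)+ (simp add: algebra_simps)
  let ?C = "2 * 2 ^ k + 2 * (real k * 2 ^ (k - 1) * 2)"
  have lin: "\<bar>p * x + q * y\<bar> \<le> 2" "\<bar>p * x - q * y\<bar> \<le> 2" "\<bar>- p * x - q * y\<bar> \<le> 2" "\<bar>- p * x + q * y\<bar> \<le> 2"
    if "\<bar>p\<bar> \<le> 1" "\<bar>q\<bar> \<le> 1" "\<bar>x\<bar> \<le> 1" "\<bar>y\<bar> \<le> 1" for p q x y :: real
  proof -
    have "\<bar>p * x\<bar> \<le> 1" "\<bar>q * y\<bar> \<le> 1"
      using that by (auto simp: abs_mult intro!: mult_le_one)
    then show "\<bar>p * x + q * y\<bar> \<le> 2" "\<bar>p * x - q * y\<bar> \<le> 2" "\<bar>- p * x - q * y\<bar> \<le> 2" "\<bar>- p * x + q * y\<bar> \<le> 2"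
      by auto
  qed
  have D_bound: "\<bar>D \<theta> s\<bar> \<le> ?C" if s: "norm s = 1" for \<theta> s
  proof -
    note c = abs_component_sphere[OF s, of i] abs_component_sphere[OF s, of j]
    note t = abs_sin_le_one[of \<theta>] abs_cos_le_one[of \<theta>]
    have "\<bar>D \<theta> s\<bar> \<le> \<bar>- sin \<theta> * s $ j - cos \<theta> * s $ i\<bar> * \<bar>cos \<theta> * s $ i + sin \<theta> * s $ j\<bar> ^ k
      + \<bar>cos \<theta> * s $ j - sin \<theta> * s $ i\<bar> * (real k * \<bar>cos \<theta> * s $ i + sin \<theta> * s $ j\<bar> ^ (k - 1) * \<bar>- sin \<theta> * s $ i + cos \<theta> * s $ j\<bar>)"
      unfolding D_def by (rule order_trans[OF abs_triangle_ineq]) (simp add: abs_mult power_abs)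
    also have "\<dots> \<le> ?C"
      by (intro add_mono mult_mono power_mono lin t c) auto
    finally show ?thesis .
  qed
  \<comment> \<open>\<open>F \<theta>\<close> is \<open>F 0\<close> composed with a rotation.\<close>
  have const: "(\<integral>s. F \<theta> s \<partial>uniform_sphere) = (\<integral>s. F 0 s \<partial>uniform_sphere)" for \<theta>
  proof -
    have "(\<integral>s. F 0 (plane_rotation i j \<theta> s) \<partial>uniform_sphere) = (\<integral>s. F 0 s \<partial>uniform_sphere)"
      by (rule sphere_integral_orthogonal[OF orthogonal_plane_rotation[OF ij]]) (simp add: F_def)
    moreover have "F 0 (plane_rotation i j \<theta> s) = F \<theta> s" for s
      using ij by (simp add: F_def plane_rotation_def)
    ultimately show ?thesis by simp
  qed
  have F_int: "integrable uniform_sphere (F \<theta>)" for \<theta>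
  proof (rule sphere_integrable_bounded[of _ "2 * 2 ^ k"])
    fix s :: "real ^ 'n" assume s: "norm s = 1"
    show "\<bar>F \<theta> s\<bar> \<le> 2 * 2 ^ k"
      unfolding F_def abs_mult power_abs
      using abs_component_sphere[OF s, of i] abs_component_sphere[OF s, of j]
      by (intro mult_mono power_mono lin) auto
  qed simp
  define h where "h n = inverse (real (Suc n))" for n
  have h0: "h n > 0" for n by (simp add: h_def)
  have h_lim: "h \<longlonglongrightarrow> 0" unfolding h_def by (rule LIMSEQ_inverse_real_of_nat)
  let ?Q = "\<lambda>n s. (F (h n) s - F 0 s) / h n"
  have "(\<lambda>n. \<integral>s. ?Q n s \<partial>uniform_sphere) \<longlonglongrightarrow> (\<integral>s. D 0 s \<partial>uniform_sphere)"
  proof (rule integral_dominated_convergence[where w = "\<lambda>_. ?C"])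
    show "D 0 \<in> borel_measurable uniform_sphere" unfolding D_def by measurable
    show "AE s in uniform_sphere. (\<lambda>n. ?Q n s) \<longlonglongrightarrow> D 0 s"
    proof (rule AE_I2)
      fix s :: "real ^ 'n"
      have "((\<lambda>x. (F (0 + x) s - F 0 s) / x) \<longlongrightarrow> D 0 s) (at 0)"
        using D[of s 0] unfolding DERIV_def .
      moreover have "filterlim h (at 0) sequentially"
        using h_lim h0 by (simp add: filterlim_at less_imp_neq[THEN not_sym])
      ultimately show "(\<lambda>n. ?Q n s) \<longlonglongrightarrow> D 0 s"
        by (simp add: filterlim_compose[of "\<lambda>x. (F (0 + x) s - F 0 s) / x" _ "at 0" h, simplified])
    qed
    fix n
    show "AE s in uniform_sphere. norm (?Q n s) \<le> ?C"
    proof (rule AE_I2)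
      fix s :: "real ^ 'n" assume "s \<in> space uniform_sphere"
      then have s: "norm s = 1" by simp
      have "norm (F (h n) s - F 0 s) \<le> ?C * norm (h n - 0)"
        by (rule field_differentiable_bound[of UNIV "\<lambda>\<theta>. F \<theta> s" "\<lambda>\<theta>. D \<theta> s"])
          (use D D_bound[OF s] in auto)
      then show "norm (?Q n s) \<le> ?C" using h0[of n] by (simp add: field_simps)
    qed
  qed (auto intro!: sphere.integrable_const)
  moreover have "(\<integral>s. ?Q n s \<partial>uniform_sphere) = 0" for n
    using const[of "h n"] by (simp add: F_int)
  ultimately have "(\<lambda>n::nat. 0::real) \<longlonglongrightarrow> (\<integral>s. D 0 s \<partial>uniform_sphere)"
    by (simp only:)
  then have "(\<integral>s. D 0 s \<partial>uniform_sphere) = 0"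
    by (simp add: LIMSEQ_const_iff)
  moreover have "(\<integral>s. D 0 s \<partial>uniform_sphere)
      = (\<integral>s. real k * ((s $ j)\<^sup>2 * s $ i ^ (k - 1)) - s $ i ^ Suc k \<partial>uniform_sphere)"
    by (intro Bochner_Integration.integral_cong) (auto simp: D_def power2_eq_square algebra_simps)
  moreover have "\<dots> = real k * (\<integral>s. (s $ j)\<^sup>2 * s $ i ^ (k - 1) \<partial>uniform_sphere) - (\<integral>s. s $ i ^ Suc k \<partial>uniform_sphere)"
  proof (subst Bochner_Integration.integral_diff)
    show "integrable uniform_sphere (\<lambda>s::real ^ 'n. real k * ((s $ j)\<^sup>2 * s $ i ^ (k - 1)))"
      by (intro integrable_mult_right sphere_integrable_monomial)
    show "integrable uniform_sphere (\<lambda>s::real ^ 'n. s $ i ^ Suc k)"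
      using sphere_integrable_monomial[of i 0 i "Suc k"] by simp
  qed simp
  ultimately show ?thesis by simp
qed

text \<open>
  Summation over the coordinates \<open>j\<close> other than \<open>i\<close>, whose squares add up to \<open>1 - s\<^sub>i\<^sup>2\<close>, yields the
  recursion satisfied by the moments of \<open>cos t\<close>.
\<close>

lemma sphere_moment_rec:
  fixes i :: "'n::finite"
  shows "(real CARD('n) - 1) * (\<integral>s. s $ i ^ Suc k \<partial>uniform_sphere)
    = real k * ((\<integral>s. s $ i ^ (k - 1) \<partial>uniform_sphere) - (\<integral>s. s $ i ^ Suc k \<partial>uniform_sphere))"
proof (cases k)
  case 0
  then show ?thesis
  proof (cases "\<exists>j. j \<noteq> i")
    case True
    then obtain j where "i \<noteq> j" by metis
    from sphere_rotation_derivative[OF this, of 0] show ?thesis using 0 by simp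
  next
    case False
    then have "UNIV = {i}" by auto
    then have "CARD('n) = card {i}" by (rule arg_cong)
    then show ?thesis using 0 by simp
  qed
next
  case (Suc l)
  have int: "integrable uniform_sphere (\<lambda>s::real ^ 'n. (s $ j)\<^sup>2 * s $ i ^ m)" "integrable uniform_sphere (\<lambda>s::real ^ 'n. s $ i ^ m)" for j m
    using sphere_integrable_monomial[of j 2 i m] sphere_integrable_monomial[of j 0 i m] by simp_all
  have "(real CARD('n) - 1) * (\<integral>s. s $ i ^ Suc k \<partial>uniform_sphere)
      = (\<Sum>j\<in>UNIV - {i}. (\<integral>s. s $ i ^ Suc k \<partial>uniform_sphere))"
    by (simp add: card_Diff_singleton of_nat_diff Suc_leI)
  also have "\<dots> = (\<Sum>j\<in>UNIV - {i}. real k * (\<integral>s. (s $ j)\<^sup>2 * s $ i ^ l \<partial>uniform_sphere))"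
    using sphere_rotation_derivative[of i _ k] Suc by (intro sum.cong) auto
  also have "\<dots> = real k * (\<integral>s. (\<Sum>j\<in>UNIV - {i}. (s $ j)\<^sup>2 * s $ i ^ l) \<partial>uniform_sphere)"
    by (subst Bochner_Integration.integral_sum) (auto simp: int sum_distrib_left)
  also have "(\<integral>s. (\<Sum>j\<in>UNIV - {i}. (s $ j)\<^sup>2 * s $ i ^ l) \<partial>uniform_sphere)
      = (\<integral>s. s $ i ^ l - s $ i ^ Suc k \<partial>uniform_sphere)"
  proof (intro Bochner_Integration.integral_cong refl)
    fix s :: "real ^ 'n" assume "s \<in> space uniform_sphere"
    then have "s \<bullet> s = 1" by (simp add: dot_square_norm)
    then have "(\<Sum>j\<in>UNIV. (s $ j)\<^sup>2) = 1" by (simp add: inner_vec_def power2_eq_square)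
    then have "(\<Sum>j\<in>UNIV - {i}. (s $ j)\<^sup>2) = 1 - (s $ i)\<^sup>2"
      by (simp add: sum.remove[of UNIV i])
    moreover have "(\<Sum>j\<in>UNIV - {i}. (s $ j)\<^sup>2 * s $ i ^ l) = (\<Sum>j\<in>UNIV - {i}. (s $ j)\<^sup>2) * s $ i ^ l"
      by (rule sum_distrib_right[symmetric])
    ultimately show "(\<Sum>j\<in>UNIV - {i}. (s $ j)\<^sup>2 * s $ i ^ l) = s $ i ^ l - s $ i ^ Suc k"
      by (simp only:) (simp add: Suc algebra_simps power2_eq_square)
  qed
  also have "\<dots> = (\<integral>s. s $ i ^ l \<partial>uniform_sphere) - (\<integral>s. s $ i ^ Suc k \<partial>uniform_sphere)"
    by (intro Bochner_Integration.integral_diff int)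
  finally show ?thesis by (simp add: Suc)
qed

text \<open>
  The Taylor expansion of the characteristic function converges, since the moments are at most 1.
\<close>

lemma bounded_laws_eq_of_moments:
  assumes M: "real_distribution M1" "real_distribution M2"
    and b: "AE x in M1. \<bar>x\<bar> \<le> 1" "AE x in M2. \<bar>x\<bar> \<le> 1"
    and m: "\<And>k. (\<integral>x. x ^ k \<partial>M1) = (\<integral>x. x ^ k \<partial>M2)"
  shows "M1 = M2"
proof (rule Levy_uniqueness[OF M])
  have appr: "cmod (char M t - (\<Sum>k\<le>n. ((\<i> * t)^k / fact k) * (\<integral>x. x ^ k \<partial>M))) \<le> 2 * \<bar>t\<bar>^n / fact n"
    if M: "real_distribution M" and b: "AE x in M. \<bar>x\<bar> \<le> 1" for M t n
  proof -
    interpret real_distribution M by fact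
    have int: "integrable M (\<lambda>x. x ^ k)" for k
      by (rule integrable_const_bound[of _ 1]) (use b in \<open>auto simp: power_abs intro!: power_le_one\<close>)
    have "expectation (\<lambda>x. \<bar>x\<bar>^n) \<le> expectation (\<lambda>x. 1)"
    proof (rule integral_mono_AE)
      show "integrable M (\<lambda>x. \<bar>x\<bar> ^ n)" using integrable_abs[OF int[of n]] by (simp add: power_abs)
      show "AE x in M. \<bar>x\<bar> ^ n \<le> 1" using b by eventually_elim (simp add: power_le_one)
    qed simp
    then have "expectation (\<lambda>x. \<bar>x\<bar>^n) \<le> 1" using prob_space by simp
    then have "(2*\<bar>t\<bar>^n / fact n) * expectation (\<lambda>x. \<bar>x\<bar>^n) \<le> (2*\<bar>t\<bar>^n / fact n) * 1"
      by (intro mult_left_mono) auto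
    with char_approx1[of n t, OF int] show ?thesis by simp
  qed
  show "char M1 = char M2"
  proof
    fix t
    have "dist (char M1 t) (char M2 t) \<le> 4 * (\<bar>t\<bar>^n / fact n)" for n
      using norm_triangle_ineq4[of "char M1 t - (\<Sum>k\<le>n. ((\<i> * t)^k / fact k) * (\<integral>x. x ^ k \<partial>M1))"
          "char M2 t - (\<Sum>k\<le>n. ((\<i> * t)^k / fact k) * (\<integral>x. x ^ k \<partial>M2))"]
        appr[OF M(1) b(1), of t n] appr[OF M(2) b(2), of t n]
      by (simp add: m dist_norm)
    moreover have "(\<lambda>n. 4 * (\<bar>t\<bar>^n / fact n)) \<longlonglongrightarrow> 0"
      by (rule tendsto_mult_right_zero) (use summable_LIMSEQ_zero[OF summable_exp[of "\<bar>t\<bar>"]] in \<open>simp add: field_simps\<close>)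
    ultimately have "dist (char M1 t) (char M2 t) \<le> 0"
      by (intro LIMSEQ_le_const) auto
    then show "char M1 t = char M2 t" by simp
  qed
qed

context angular
begin

definition angle_law :: "real measure" where
  "angle_law = density lborel (\<lambda>t. ennreal (indicator {0..pi} t * sin t ^ (N - 2) / ang 0 0))"

lemma angle_density_nonneg: "0 \<le> indicator {0..pi} t * sin t ^ (N - 2) / ang 0 0"
  using ang_0_pos[of 0] by (auto simp: indicator_def intro!: divide_nonneg_pos zero_le_power sin_ge_zero)

lemma sets_angle_law [simp, measurable_cong]: "sets angle_law = sets borel"
  by (simp add: angle_law_def)

lemma integral_angle_law:
  fixes g :: "real \<Rightarrow> real"
  assumes [measurable]: "g \<in> borel_measurable borel" and C: "\<And>t. t \<in> {0..pi} \<Longrightarrow> \<bar>g t\<bar> \<le> C"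
    and g: "((\<lambda>t. g t * sin t ^ (N - 2)) has_integral I) {0..pi}"
  shows "(\<integral>t. g t \<partial>angle_law) = I / ang 0 0"
proof -
  have "(\<integral>t. g t \<partial>angle_law) = (\<integral>t. (indicator {0..pi} t * sin t ^ (N - 2) / ang 0 0) *\<^sub>R g t \<partial>lborel)"
    unfolding angle_law_def by (rule integral_density) (auto simp: angle_density_nonneg)
  also have "\<dots> = (LINT t:{0..pi}|lborel. g t * sin t ^ (N - 2)) / ang 0 0"
    unfolding set_lebesgue_integral_def integral_divide_zero[symmetric]
    by (intro Bochner_Integration.integral_cong) auto
  also have "set_integrable lborel {0..pi} (\<lambda>t. g t * sin t ^ (N - 2))"
  proof (rule set_integrable_bound[of lborel "{0..pi}" "\<lambda>_. C"])
    show "set_integrable lborel {0..pi} (\<lambda>_. C)" by (intro borel_integrable_atLeastAtMost' continuous_intros)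
    show "AE t in lborel. t \<in> {0..pi} \<longrightarrow> norm (g t * sin t ^ (N - 2)) \<le> norm C"
    proof (intro AE_I2 impI)
      fix t :: real assume t: "t \<in> {0..pi}"
      have "\<bar>g t\<bar> * \<bar>sin t\<bar> ^ (N - 2) \<le> \<bar>C\<bar> * 1"
        using C[OF t] by (intro mult_mono power_le_one) auto
      then show "norm (g t * sin t ^ (N - 2)) \<le> norm C" by (simp add: abs_mult power_abs)
    qed
  qed (simp add: set_borel_measurable_def)
  then have "(LINT t:{0..pi}|lborel. g t * sin t ^ (N - 2)) = I"
    using g by (simp add: set_borel_integral_eq_integral(2) integral_unique)
  finally show ?thesis .
qed

lemma prob_space_angle_law: "prob_space angle_law"
proof
  have i: "integrable lborel (\<lambda>t::real. indicator {0..pi} t * sin t ^ (N - 2) / ang 0 0)"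
  proof -
    have "continuous_on {0..pi} (\<lambda>t. sin t ^ (N - 2) / ang 0 0)"
      by (intro continuous_intros) (use ang_0_pos[of 0] in auto)
    from borel_integrable_atLeastAtMost'[OF this] show ?thesis
      by (simp add: set_integrable_def)
  qed
  have "emeasure angle_law (space angle_law) = (\<integral>\<^sup>+t. ennreal (indicator {0..pi} t * sin t ^ (N - 2) / ang 0 0) \<partial>lborel)"
    by (simp add: angle_law_def emeasure_density)
  also have "\<dots> = ennreal (\<integral>t. indicator {0..pi} t * sin t ^ (N - 2) / ang 0 0 \<partial>lborel)"
    by (rule nn_integral_eq_integral[OF i]) (simp add: angle_density_nonneg)
  also have "(\<integral>t. indicator {0..pi} t * sin t ^ (N - 2) / ang 0 0 \<partial>lborel) = (\<integral>t. 1 \<partial>angle_law)"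
    unfolding angle_law_def by (subst integral_density) (auto simp: angle_density_nonneg)
  also have "\<dots> = ang 0 0 / ang 0 0"
    by (rule integral_angle_law[of _ 1]) (use ang_has_integral[of 0 0] in auto)
  finally show "emeasure angle_law (space angle_law) = 1" using ang_0_pos[of 0] by simp
qed

end

text \<open>A rotation takes \<open>u\<close> to a coordinate vector, and the moments of a coordinate obey the same recursion
  as those of \<open>cos t\<close>.\<close>

lemma distr_inner_sphere:
  fixes u :: "real ^ 'n"
  assumes u: "norm u = 1" and N: "2 \<le> CARD('n)"
  shows "distr uniform_sphere borel (\<lambda>s. s \<bullet> u) = distr (angular.angle_law CARD('n)) borel cos"
proof -
  interpret angular "CARD('n)" by standard (rule N)
  interpret angle: prob_space angle_law by (rule prob_space_angle_law)
  obtain i :: 'n where True by simp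
  obtain T :: "real ^ 'n \<Rightarrow> real ^ 'n" where T: "orthogonal_transformation T" "T u = axis i 1"
    using orthogonal_transformation_exists_1[OF u, of "axis i 1"] by (auto simp: norm_axis_1)
  have T_inner: "s \<bullet> u = T s $ i" for s
  proof -
    have "s \<bullet> u = T s \<bullet> T u" using T(1) by (simp add: orthogonal_transformation_def)
    then show ?thesis by (simp add: T(2) inner_axis)
  qed
  show ?thesis
  proof (rule bounded_laws_eq_of_moments)
    show "real_distribution (distr uniform_sphere borel (\<lambda>s. s \<bullet> u))"
      by (rule sphere.real_distribution_distr) measurable
    show "real_distribution (distr angle_law borel cos)"
      by (rule angle.real_distribution_distr) simp
    show "AE x in distr uniform_sphere borel (\<lambda>s. s \<bullet> u). \<bar>x\<bar> \<le> 1"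
      using Cauchy_Schwarz_ineq2[of _ u] u by (subst AE_distr_iff) (auto intro!: AE_I2, metis mult.right_neutral)
    show "AE x in distr angle_law borel cos. \<bar>x\<bar> \<le> 1"
      by (subst AE_distr_iff) auto
    fix k
    let ?m = "\<lambda>k. (\<integral>s. s $ i ^ k \<partial>(uniform_sphere :: (real ^ 'n) measure))"
    have "?m k = ang k 0 / ang 0 0"
    proof (induction k rule: less_induct)
      case (less k)
      show ?case
      proof (cases k)
        case 0
        then show ?thesis using ang_0_pos[of 0] sphere.prob_space by simp
      next
        case (Suc l)
        have N1: "real CARD('n) - 1 + real l > 0" using N by linarith
        have "(real CARD('n) - 1 + real l) * ?m k = real l * ?m (l - 1)"
          using sphere_moment_rec[of i l] unfolding Suc by (simp add: algebra_simps)
        also have "real l * ?m (l - 1) = real l * (ang (l - 1) 0 / ang 0 0)"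
          using less.IH[of "l - 1"] Suc by (cases l) auto
        also have "\<dots> = (real CARD('n) - 1 + real l) * (ang k 0 / ang 0 0)"
          using ang_moment_rec[of l] unfolding Suc by (simp add: algebra_simps add_divide_distrib[symmetric] diff_divide_distrib[symmetric])
        finally show ?thesis by (rule mult_left_cancel[THEN iffD1, rotated]) (use N1 in simp)
      qed
    qed
    moreover have "(\<integral>x. x ^ k \<partial>distr uniform_sphere borel (\<lambda>s. s \<bullet> u)) = ?m k"
    proof -
      have "(\<integral>x. x ^ k \<partial>distr uniform_sphere borel (\<lambda>s. s \<bullet> u)) = (\<integral>s. (s \<bullet> u) ^ k \<partial>uniform_sphere)"
        by (subst integral_distr) auto
      also have "\<dots> = ?m k"
        unfolding T_inner by (rule sphere_integral_orthogonal[OF T(1), of "\<lambda>s. s $ i ^ k"]) simp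
      finally show ?thesis .
    qed
    moreover have "(\<integral>x. x ^ k \<partial>distr angle_law borel cos) = ang k 0 / ang 0 0"
    proof (subst integral_distr)
      show "(\<integral>x. cos x ^ k \<partial>angle_law) = ang k 0 / ang 0 0"
        by (rule integral_angle_law[of _ 1]) (use ang_has_integral[of k 0] in \<open>auto simp: power_abs intro!: power_le_one\<close>)
    qed auto
    ultimately show "(\<integral>x. x ^ k \<partial>distr uniform_sphere borel (\<lambda>s. s \<bullet> u)) = (\<integral>x. x ^ k \<partial>distr angle_law borel cos)"
      by simp
  qed
qed

lemma sphere_integral_inner:
  fixes u :: "real ^ 'n"
  assumes u: "norm u = 1" and N: "2 \<le> CARD('n)"
    and G: "G \<in> borel_measurable borel" and C: "\<And>x. \<bar>x\<bar> \<le> 1 \<Longrightarrow> \<bar>G x\<bar> \<le> C"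
    and I: "((\<lambda>t. G (cos t) * sin t ^ (CARD('n) - 2)) has_integral 0) {0..pi}"
  shows "(\<integral>s. G (s \<bullet> u) \<partial>uniform_sphere) = 0"
proof -
  interpret angular "CARD('n)" by standard (rule N)
  have "(\<integral>s. G (s \<bullet> u) \<partial>uniform_sphere) = (\<integral>x. G x \<partial>distr uniform_sphere borel (\<lambda>s. s \<bullet> u))"
    by (subst integral_distr) (auto simp: G)
  also have "\<dots> = (\<integral>t. G (cos t) \<partial>angle_law)"
    unfolding distr_inner_sphere[OF u N] by (subst integral_distr) (auto simp: G)
  also have "\<dots> = 0 / ang 0 0"
    using G by (intro integral_angle_law[of _ C] I C) auto
  finally show ?thesis by simp
qed

section \<open>The Stein identity for one spin\<close>

context angular
begin

text \<open>Clamping \<open>x = cos \<theta>\<close> to \<open>[-1, 1]\<close> makes the kernel continuous on the whole plane, hence measurable.\<close>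

definition xkern :: "real \<Rightarrow> real \<Rightarrow> real" where
  "xkern r x = kern r (arccos (max (- 1) (min 1 x)))"

lemma xkern_cos: "0 \<le> \<theta> \<Longrightarrow> \<theta> \<le> pi \<Longrightarrow> xkern r (cos \<theta>) = kern r \<theta>"
  by (simp add: xkern_def arccos_cos min_absorb2 max_absorb2)

lemma xkern_bound:
  assumes "\<bar>r\<bar> \<le> \<rho>"
  shows "\<bar>xkern r x\<bar> \<le> 4 * exp (2 * \<rho>)"
proof -
  let ?t = "arccos (max (- 1) (min 1 x))"
  have "\<bar>xkern r x\<bar> \<le> 4 * exp (2 * \<rho>) * (sin ?t)\<^sup>2"
    unfolding xkern_def using arccos_bounded[of "max (- 1) (min 1 x)"] assms by (intro kern_bound) auto
  also have "\<dots> \<le> 4 * exp (2 * \<rho>) * 1" by (intro mult_left_mono) (auto simp: abs_square_le_1)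
  finally show ?thesis by simp
qed

lemma xkern_lipschitz:
  obtains K where "K \<ge> 0" "\<And>r r' x x'. \<bar>r\<bar> \<le> \<rho> \<Longrightarrow> \<bar>r'\<bar> \<le> \<rho> \<Longrightarrow>
    \<bar>xkern r x - xkern r' x'\<bar> \<le> K * (\<bar>r - r'\<bar> + \<bar>x - x'\<bar>)"
proof
  let ?K1 = "10 * exp (2 * \<rho>)" and ?K2 = "2 + 4 * (\<bar>\<rho>\<bar> + real N + 2) * exp (2 * \<bar>\<rho>\<bar>)"
  have K2: "0 \<le> ?K2" by (intro add_nonneg_nonneg mult_nonneg_nonneg) auto
  then show "0 \<le> ?K1 + ?K2" by (smt (verit) exp_gt_zero)
  fix r r' x x' :: real assume r: "\<bar>r\<bar> \<le> \<rho>" "\<bar>r'\<bar> \<le> \<rho>"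
  define X where "X = max (- 1) (min 1 x)"
  define X' where "X' = max (- 1) (min 1 x')"
  have X: "\<bar>X\<bar> \<le> 1" "\<bar>X'\<bar> \<le> 1" "\<bar>X - X'\<bar> \<le> \<bar>x - x'\<bar>" unfolding X_def X'_def by auto
  have a: "0 \<le> arccos X" "arccos X \<le> pi" "0 \<le> arccos X'" "arccos X' \<le> pi" "cos (arccos X) = X" "cos (arccos X') = X'"
    using X(1,2) by (auto simp: cos_arccos_abs arccos_lbound arccos_ubound abs_le_iff)
  have "\<bar>kern r (arccos X) - kern r' (arccos X)\<bar> \<le> ?K1 * \<bar>r - r'\<bar>"
    by (intro kern_lipschitz_tilt a r)
  moreover have "\<bar>kern r' (arccos X) - kern r' (arccos X')\<bar> \<le> ?K2 * \<bar>cos (arccos X) - cos (arccos X')\<bar>"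
    by (intro kern_lipschitz_cos a) (use r in auto)
  moreover have "?K2 * \<bar>cos (arccos X) - cos (arccos X')\<bar> \<le> ?K2 * \<bar>x - x'\<bar>"
    unfolding a by (intro mult_left_mono X K2)
  ultimately have "\<bar>xkern r x - xkern r' x'\<bar> \<le> ?K1 * \<bar>r - r'\<bar> + ?K2 * \<bar>x - x'\<bar>"
    unfolding xkern_def X_def[symmetric] X'_def[symmetric] by linarith
  also have "\<dots> \<le> (?K1 + ?K2) * (\<bar>r - r'\<bar> + \<bar>x - x'\<bar>)"
    using K2 by (simp add: algebra_simps)
  finally show "\<bar>xkern r x - xkern r' x'\<bar> \<le> (?K1 + ?K2) * (\<bar>r - r'\<bar> + \<bar>x - x'\<bar>)" .
qed

lemma continuous_xkern: "continuous_on UNIV (\<lambda>p. xkern (fst p) (snd p))"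
proof (rule continuous_at_imp_continuous_on, rule ballI)
  fix p :: "real \<times> real"
  obtain K where K: "K \<ge> 0" "\<And>r r' x x'. \<bar>r\<bar> \<le> \<bar>fst p\<bar> + 1 \<Longrightarrow> \<bar>r'\<bar> \<le> \<bar>fst p\<bar> + 1 \<Longrightarrow>
    \<bar>xkern r x - xkern r' x'\<bar> \<le> K * (\<bar>r - r'\<bar> + \<bar>x - x'\<bar>)"
    using xkern_lipschitz by blast
  have "((\<lambda>q. K * (\<bar>fst q - fst p\<bar> + \<bar>snd q - snd p\<bar>)) \<longlongrightarrow> K * (\<bar>fst p - fst p\<bar> + \<bar>snd p - snd p\<bar>)) (at p)"
    by (intro tendsto_intros)
  then have lim: "((\<lambda>q. K * (\<bar>fst q - fst p\<bar> + \<bar>snd q - snd p\<bar>)) \<longlongrightarrow> 0) (at p)" by simp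
  have "\<forall>\<^sub>F q in at p. dist q p < 1" by (rule tendstoD[OF tendsto_ident_at]) simp
  then have "\<forall>\<^sub>F q in at p. norm (xkern (fst q) (snd q) - xkern (fst p) (snd p)) \<le> K * (\<bar>fst q - fst p\<bar> + \<bar>snd q - snd p\<bar>)"
  proof eventually_elim
    case (elim q)
    then have "dist (fst q) (fst p) < 1" using dist_fst_le[of q p] by linarith
    then have "\<bar>fst q\<bar> \<le> \<bar>fst p\<bar> + 1" by (simp add: dist_real_def)
    then show ?case using K(2)[of "fst q" "fst p" "snd q" "snd p"] by simp
  qed
  then have "((\<lambda>q. xkern (fst q) (snd q) - xkern (fst p) (snd p)) \<longlongrightarrow> 0) (at p)"
    by (rule Lim_null_comparison[OF _ lim])
  then show "isCont (\<lambda>p. xkern (fst p) (snd p)) p"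
    unfolding isCont_def by (rule LIM_zero_cancel)
qed

lemma borel_measurable_xkern [measurable (raw)]:
  assumes "f \<in> borel_measurable M" "g \<in> borel_measurable M"
  shows "(\<lambda>x. xkern (f x) (g x)) \<in> borel_measurable M"
  using assms continuous_xkern by (rule borel_measurable_continuous_Pair)

lemma borel_measurable_mag [measurable (raw)]: "f \<in> borel_measurable M \<Longrightarrow> (\<lambda>x. mag (f x)) \<in> borel_measurable M"
  using borel_measurable_continuous_onI[OF continuous_mag[of UNIV]] by measurable

lemma borel_measurable_mag' [measurable (raw)]: "f \<in> borel_measurable M \<Longrightarrow> (\<lambda>x. mag' (f x)) \<in> borel_measurable M"
proof -
  have c: "continuous_on UNIV (ang j)" for j
    by (rule DERIV_continuous_on) (rule DERIV_subset[OF ang_deriv], simp)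
  have "continuous_on UNIV mag'"
    unfolding mag'_def using ang_0_pos by (intro continuous_intros c continuous_mag) (metis less_irrefl)
  then have "mag' \<in> borel_measurable borel" by (rule borel_measurable_continuous_onI)
  then show "f \<in> borel_measurable M \<Longrightarrow> (\<lambda>x. mag' (f x)) \<in> borel_measurable M" by measurable
qed

end

context low_temperature
begin

subsection \<open>The drift\<close>

text \<open>The limit of the norm of the mean spin.\<close>

definition s0 :: real where "s0 = b / \<beta>"

lemma s0_pos: "0 < s0" and s0_less_1: "s0 < 1"
  using b_pos \<beta>_pos b_less_\<beta> by (simp_all add: s0_def)

text \<open>The rate at which the drift grows with the deviation of the squared mean spin from \<open>s0\<^sup>2\<close>.\<close>

definition \<kappa> :: real where "\<kappa> = (1 - \<beta> * mag' b) / 2"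

lemma \<kappa>_pos: "0 < \<kappa>" using \<beta>_mag'_b by (simp add: \<kappa>_def)

text \<open>
  As \<open>\<beta> * slope b = 1\<close>, the second factor on the right is a multiple of the difference of the slopes at
  \<open>b\<close> and at \<open>\<beta> * t\<close>, and has the sign of the first.
\<close>

lemma slope_restoring:
  obtains c where "c > 0" "\<And>t. 0 \<le> t \<Longrightarrow> t \<le> 1 \<Longrightarrow>
    c * (t\<^sup>2 - s0\<^sup>2)\<^sup>2 \<le> (t\<^sup>2 - s0\<^sup>2) * (1 - \<beta> * slope (\<beta> * t))"
proof -
  obtain c where c: "c > 0"
    "\<And>r s. 0 \<le> r \<Longrightarrow> r \<le> s \<Longrightarrow> s \<le> \<beta> \<Longrightarrow> c * (s\<^sup>2 - r\<^sup>2) \<le> slope r - slope s"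
    using slope_decrease[OF \<beta>_pos] by blast
  have "c * \<beta>^3 * (t\<^sup>2 - s0\<^sup>2)\<^sup>2 \<le> (t\<^sup>2 - s0\<^sup>2) * (1 - \<beta> * slope (\<beta> * t))" if t: "0 \<le> t" "t \<le> 1" for t
  proof -
    have bt: "(\<beta> * t)\<^sup>2 - b\<^sup>2 = \<beta>\<^sup>2 * (t\<^sup>2 - s0\<^sup>2)"
      using \<beta>_pos by (simp add: s0_def power_mult_distrib power_divide right_diff_distrib)
    have sl: "\<beta> * (slope b - slope (\<beta> * t)) = 1 - \<beta> * slope (\<beta> * t)"
      using \<beta>_slope_b by (simp add: right_diff_distrib)
    have t\<beta>: "0 \<le> \<beta> * t" "\<beta> * t \<le> \<beta>" using t \<beta>_pos by (auto intro: mult_left_le)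
    have b3: "\<beta> * (c * (\<beta>\<^sup>2 * d)) = c * \<beta>^3 * d" for d by (simp add: power2_eq_square power3_eq_cube)
    show ?thesis
    proof (cases "b \<le> \<beta> * t")
      case True
      have "\<beta> * (c * ((\<beta> * t)\<^sup>2 - b\<^sup>2)) \<le> \<beta> * (slope b - slope (\<beta> * t))"
        using c(2)[of b "\<beta> * t"] True t\<beta> b_pos \<beta>_pos by (intro mult_left_mono) auto
      then have *: "c * \<beta>^3 * (t\<^sup>2 - s0\<^sup>2) \<le> 1 - \<beta> * slope (\<beta> * t)" unfolding sl bt b3 .
      have "s0 \<le> t" using True \<beta>_pos by (simp add: s0_def field_simps)
      then have "0 \<le> t\<^sup>2 - s0\<^sup>2" using s0_pos by (simp add: power_mono)
      from mult_left_mono[OF * this] show ?thesis by (simp add: power2_eq_square mult_ac)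
    next
      case False
      have "\<beta> * (c * (b\<^sup>2 - (\<beta> * t)\<^sup>2)) \<le> \<beta> * (slope (\<beta> * t) - slope b)"
        using c(2)[of "\<beta> * t" b] False t\<beta> b_less_\<beta> \<beta>_pos by (intro mult_left_mono) auto
      then have "\<beta> * (slope b - slope (\<beta> * t)) \<le> \<beta> * (c * ((\<beta> * t)\<^sup>2 - b\<^sup>2))"
        by (simp add: right_diff_distrib)
      then have *: "1 - \<beta> * slope (\<beta> * t) \<le> c * \<beta>^3 * (t\<^sup>2 - s0\<^sup>2)" unfolding sl bt b3 .
      have "t \<le> s0" using False \<beta>_pos by (simp add: s0_def field_simps)
      then have "t\<^sup>2 - s0\<^sup>2 \<le> 0" using t by (simp add: power_mono)
      from mult_left_mono_neg[OF * this] show ?thesis by (simp add: power2_eq_square mult_ac)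
    qed
  qed
  moreover have "c * \<beta>^3 > 0" using c \<beta>_pos by simp
  ultimately show ?thesis using that by blast
qed

lemma \<beta>_slope_lipschitz:
  obtains C where "C \<ge> 0" "\<And>t t'. t \<in> {0..1} \<Longrightarrow> t' \<in> {0..1} \<Longrightarrow>
    \<bar>\<beta> * slope (\<beta> * t) - \<beta> * slope (\<beta> * t')\<bar> \<le> C * \<bar>t - t'\<bar>"
proof -
  obtain C where C: "C \<ge> 0" "\<And>r s. r \<in> {0..\<beta>} \<Longrightarrow> s \<in> {0..\<beta>} \<Longrightarrow> \<bar>slope r - slope s\<bar> \<le> C * \<bar>r - s\<bar>"
    using slope_lipschitz by blast
  have "\<bar>\<beta> * slope (\<beta> * t) - \<beta> * slope (\<beta> * t')\<bar> \<le> (C * \<beta>\<^sup>2) * \<bar>t - t'\<bar>" if "t \<in> {0..1}" "t' \<in> {0..1}" for t t'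
  proof -
    have "\<bar>\<beta> * slope (\<beta> * t) - \<beta> * slope (\<beta> * t')\<bar> = \<beta> * \<bar>slope (\<beta> * t) - slope (\<beta> * t')\<bar>"
      using \<beta>_pos by (simp add: abs_mult flip: right_diff_distrib)
    also have "\<dots> \<le> \<beta> * (C * \<bar>\<beta> * t - \<beta> * t'\<bar>)"
      using that \<beta>_pos by (intro mult_left_mono C) (auto intro: mult_left_le)
    also have "\<bar>\<beta> * t - \<beta> * t'\<bar> = \<beta> * \<bar>t - t'\<bar>"
      using \<beta>_pos by (simp add: abs_mult flip: right_diff_distrib)
    finally show ?thesis by (simp add: power2_eq_square mult_ac)
  qed
  then show ?thesis using that[of "C * \<beta>\<^sup>2"] C(1) by simp
qed

text \<open>
  The drift vanishes at \<open>s0\<close>, where its derivative with respect to \<open>t\<^sup>2\<close> is \<open>\<kappa>\<close>. By the Riccati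
  equation the second derivative need not be computed: the first one is a Lipschitz function.
\<close>

lemma drift_linearisation:
  obtains C where "C \<ge> 0" "\<And>t. 0 \<le> t \<Longrightarrow> t \<le> 1 \<Longrightarrow>
    \<bar>t\<^sup>2 - t * mag (\<beta> * t) - \<kappa> * (t\<^sup>2 - s0\<^sup>2)\<bar> \<le> C * (t\<^sup>2 - s0\<^sup>2)\<^sup>2"
proof -
  define \<Xi> where "\<Xi> r = r\<^sup>2 - \<beta> * (r * mag r) - \<kappa> * (r\<^sup>2 - b\<^sup>2)" for r
  define \<Xi>' where "\<Xi>' r = (2 - \<beta> - 2 * \<kappa>) * r + \<beta> * (real N - 2) * mag r + \<beta> * (r * (mag r)\<^sup>2)" for r
  let ?L = "\<bar>2 - \<beta> - 2 * \<kappa>\<bar> + \<beta> * (real N - 2) + \<beta> * (1 + 2 * \<beta>)"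
  have N2: "0 \<le> real N - 2" using N_ge_2 by simp
  have L0: "0 \<le> ?L" using N2 \<beta>_pos by simp
  have d: "(\<Xi> has_real_derivative \<Xi>' r) (at r within S)" for r S
  proof -
    have "(\<Xi> has_real_derivative 2 * r - \<beta> * (mag r + r * mag' r) - \<kappa> * (2 * r)) (at r within S)"
      unfolding \<Xi>_def[abs_def] by (rule derivative_eq_intros mag_has_derivative refl)+ simp
    also have "2 * r - \<beta> * (mag r + r * mag' r) - \<kappa> * (2 * r) = \<Xi>' r"
      unfolding riccati \<Xi>'_def by (simp add: algebra_simps)
    finally show ?thesis .
  qed
  have \<Xi>'_b: "\<Xi>' b = 0"
  proof -
    have "\<Xi>' b = 2 * b - \<beta> * mag b - \<beta> * (b * mag' b) - 2 * \<kappa> * b"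
      unfolding riccati \<Xi>'_def by (simp add: algebra_simps)
    then show ?thesis unfolding \<beta>_mag_b by (simp add: \<kappa>_def field_simps)
  qed
  have lip: "\<bar>\<Xi>' r - \<Xi>' s\<bar> \<le> ?L * \<bar>r - s\<bar>" if rs: "r \<in> {0..\<beta>}" "s \<in> {0..\<beta>}" for r s
  proof -
    have m: "\<bar>mag r - mag s\<bar> \<le> \<bar>r - s\<bar>" by (rule mag_lipschitz)
    have m2: "\<bar>r * (mag r)\<^sup>2 - s * (mag s)\<^sup>2\<bar> \<le> (1 + 2 * \<beta>) * \<bar>r - s\<bar>"
    proof -
      have "r * (mag r)\<^sup>2 - s * (mag s)\<^sup>2 = (r - s) * (mag r)\<^sup>2 + s * ((mag r + mag s) * (mag r - mag s))"
        by (simp add: algebra_simps power2_eq_square)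
      also have "\<bar>\<dots>\<bar> \<le> \<bar>r - s\<bar> * \<bar>mag r\<bar>\<^sup>2 + \<bar>s\<bar> * (\<bar>mag r + mag s\<bar> * \<bar>mag r - mag s\<bar>)"
        by (rule order_trans[OF abs_triangle_ineq]) (simp add: abs_mult)
      also have "\<dots> \<le> \<bar>r - s\<bar> * 1 + \<beta> * (2 * \<bar>r - s\<bar>)"
        using rs \<beta>_pos abs_mag_le_1[of r] abs_mag_le_1[of s] m
        by (intro add_mono mult_mono power_le_one) auto
      finally show ?thesis by (simp add: algebra_simps)
    qed
    have "\<Xi>' r - \<Xi>' s = (2 - \<beta> - 2 * \<kappa>) * (r - s) + \<beta> * (real N - 2) * (mag r - mag s)
        + \<beta> * (r * (mag r)\<^sup>2 - s * (mag s)\<^sup>2)"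
      by (simp add: \<Xi>'_def algebra_simps)
    also have "\<bar>\<dots>\<bar> \<le> \<bar>2 - \<beta> - 2 * \<kappa>\<bar> * \<bar>r - s\<bar> + \<beta> * (real N - 2) * \<bar>mag r - mag s\<bar>
        + \<beta> * \<bar>r * (mag r)\<^sup>2 - s * (mag s)\<^sup>2\<bar>"
      using N2 \<beta>_pos by (intro order_trans[OF abs_triangle_ineq] add_mono) (auto simp: abs_mult)
    also have "\<dots> \<le> \<bar>2 - \<beta> - 2 * \<kappa>\<bar> * \<bar>r - s\<bar> + \<beta> * (real N - 2) * \<bar>r - s\<bar> + \<beta> * ((1 + 2 * \<beta>) * \<bar>r - s\<bar>)"
      using N2 \<beta>_pos m m2 by (intro add_mono mult_left_mono) auto
    finally show ?thesis by (simp add: algebra_simps)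
  qed
  have \<Xi>_bound: "\<bar>\<Xi> r\<bar> \<le> ?L / b\<^sup>2 * (r\<^sup>2 - b\<^sup>2)\<^sup>2" if r: "r \<in> {0..\<beta>}" for r
  proof -
    let ?S = "{0..\<beta>} \<inter> cball b \<bar>r - b\<bar>"
    have b: "b \<in> {0..\<beta>}" using b_pos b_less_\<beta> by simp
    have "norm (\<Xi> r - \<Xi> b) \<le> (?L * \<bar>r - b\<bar>) * norm (r - b)"
    proof (rule field_differentiable_bound[of ?S \<Xi> \<Xi>'])
      show "norm (\<Xi>' z) \<le> ?L * \<bar>r - b\<bar>" if z: "z \<in> ?S" for z
      proof -
        have "\<bar>\<Xi>' z - \<Xi>' b\<bar> \<le> ?L * \<bar>z - b\<bar>" using z b by (intro lip) auto
        also have "\<dots> \<le> ?L * \<bar>r - b\<bar>" using z by (intro mult_left_mono L0) (auto simp: dist_real_def abs_minus_commute)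
        finally show ?thesis by (simp add: \<Xi>'_b)
      qed
    qed (use r b d in \<open>auto simp: dist_real_def abs_minus_commute intro: convex_Int\<close>)
    moreover have "\<Xi> b = 0" using \<beta>_mag_b by (simp add: \<Xi>_def power2_eq_square mult_ac)
    ultimately have "\<bar>\<Xi> r\<bar> \<le> ?L * (r - b)\<^sup>2" by (simp add: power2_eq_square mult.assoc)
    also have "\<dots> \<le> ?L * ((r\<^sup>2 - b\<^sup>2)\<^sup>2 / b\<^sup>2)"
    proof (intro mult_left_mono L0)
      have "(r - b)\<^sup>2 * b\<^sup>2 \<le> (r - b)\<^sup>2 * (r + b)\<^sup>2"
        using r b_pos by (intro mult_left_mono power_mono) auto
      also have "\<dots> = (r\<^sup>2 - b\<^sup>2)\<^sup>2" by (simp add: power2_eq_square algebra_simps)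
      finally show "(r - b)\<^sup>2 \<le> (r\<^sup>2 - b\<^sup>2)\<^sup>2 / b\<^sup>2" using b_pos by (simp add: field_simps)
    qed
    finally show ?thesis by simp
  qed
  have "\<bar>t\<^sup>2 - t * mag (\<beta> * t) - \<kappa> * (t\<^sup>2 - s0\<^sup>2)\<bar> \<le> (?L / b\<^sup>2 * \<beta>\<^sup>2) * (t\<^sup>2 - s0\<^sup>2)\<^sup>2" if t: "0 \<le> t" "t \<le> 1" for t
  proof -
    have bt: "(\<beta> * t)\<^sup>2 - b\<^sup>2 = \<beta>\<^sup>2 * (t\<^sup>2 - s0\<^sup>2)"
      using \<beta>_pos by (simp add: s0_def power_mult_distrib power_divide right_diff_distrib)
    have "\<Xi> (\<beta> * t) = \<beta>\<^sup>2 * (t\<^sup>2 - t * mag (\<beta> * t) - \<kappa> * (t\<^sup>2 - s0\<^sup>2))"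
      unfolding \<Xi>_def bt by (simp add: power2_eq_square algebra_simps)
    moreover have "\<bar>\<Xi> (\<beta> * t)\<bar> \<le> ?L / b\<^sup>2 * (\<beta>\<^sup>2 * (t\<^sup>2 - s0\<^sup>2))\<^sup>2"
      unfolding bt[symmetric] using t \<beta>_pos by (intro \<Xi>_bound) (auto intro: mult_left_le)
    ultimately have "\<beta>\<^sup>2 * \<bar>t\<^sup>2 - t * mag (\<beta> * t) - \<kappa> * (t\<^sup>2 - s0\<^sup>2)\<bar> \<le> \<beta>\<^sup>2 * ((?L / b\<^sup>2 * \<beta>\<^sup>2) * (t\<^sup>2 - s0\<^sup>2)\<^sup>2)"
      by (simp add: abs_mult power_mult_distrib power2_eq_square mult_ac)
    then show ?thesis using \<beta>_pos by (simp only: mult_le_cancel_left_pos zero_less_power)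
  qed
  moreover have "0 \<le> ?L / b\<^sup>2 * \<beta>\<^sup>2" using L0 by simp
  ultimately show ?thesis using that by blast
qed

end

locale vector_model =
  fixes \<beta> :: real and T :: "'n::finite itself"
  assumes dim_ge_2: "2 \<le> CARD('n)" and \<beta>_gt_dim: "real CARD('n) < \<beta>"
begin

sublocale low_temperature "CARD('n)" \<beta>
  by unfold_locales (rule dim_ge_2, rule \<beta>_gt_dim)

text \<open>
  The conditional mean and the conditional variance of \<open>y \<bullet> s\<close> for a spin \<open>s\<close> of density
  proportional to \<open>exp (\<beta> * (y \<bullet> s))\<close>, and the Stein kernel of \<open>y \<bullet> s\<close>.
\<close>

definition spin_mean :: "real ^ 'n \<Rightarrow> real" where
  "spin_mean y = norm y * mag (\<beta> * norm y)"

definition spin_var :: "real ^ 'n \<Rightarrow> real" where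
  "spin_var y = (norm y)\<^sup>2 * mag' (\<beta> * norm y)"

definition spin_kern :: "real ^ 'n \<Rightarrow> real ^ 'n \<Rightarrow> real" where
  "spin_kern y s = (norm y)\<^sup>2 * xkern (\<beta> * norm y) (s \<bullet> sgn y)"

lemma spin_measurable [measurable (raw)]:
  assumes [measurable]: "f \<in> borel_measurable M" "g \<in> borel_measurable M"
  shows "(\<lambda>x. spin_mean (f x)) \<in> borel_measurable M"
    "(\<lambda>x. spin_var (f x)) \<in> borel_measurable M"
    "(\<lambda>x. spin_kern (f x) (g x)) \<in> borel_measurable M"
  unfolding spin_mean_def spin_var_def spin_kern_def by measurable

lemma \<beta>_norm_le:
  assumes "norm y \<le> 1"
  shows "\<bar>\<beta> * norm y\<bar> \<le> \<beta>"
  using assms \<beta>_pos by (simp add: abs_mult mult_left_le)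

lemma spin_kern_bound: "norm y \<le> 1 \<Longrightarrow> \<bar>spin_kern y s\<bar> \<le> 4 * exp (2 * \<beta>) * (norm y)\<^sup>2"
  using mult_left_mono[OF xkern_bound[OF \<beta>_norm_le], of y "(norm y)\<^sup>2"]
  by (simp add: spin_kern_def abs_mult mult.commute)

lemma norm_sgn_diff_le:
  fixes y z :: "'a::real_normed_vector"
  assumes "y \<noteq> 0" "z \<noteq> 0"
  shows "norm z * norm (sgn y - sgn z) \<le> 2 * norm (y - z)"
proof -
  have "norm z *\<^sub>R (sgn y - sgn z) = (norm z - norm y) *\<^sub>R sgn y + (y - z)"
    using assms by (simp add: sgn_div_norm algebra_simps)
  then have "norm (norm z *\<^sub>R (sgn y - sgn z)) \<le> norm ((norm z - norm y) *\<^sub>R sgn y) + norm (y - z)"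
    by (metis norm_triangle_ineq)
  also have "\<dots> \<le> norm (y - z) + norm (y - z)"
    using assms norm_triangle_ineq3[of z y] by (simp add: norm_sgn norm_minus_commute)
  finally show ?thesis by simp
qed

text \<open>The factor \<open>(norm y)\<^sup>2\<close> compensates the singularity at 0 of the direction of \<open>y\<close>.\<close>

lemma spin_kern_lipschitz:
  obtains C where "C \<ge> 0" "\<And>y z s. norm y \<le> 1 \<Longrightarrow> norm z \<le> 1 \<Longrightarrow> norm s = 1 \<Longrightarrow>
    \<bar>spin_kern y s - spin_kern z s\<bar> \<le> C * norm (y - z)"
proof -
  obtain K where K: "K \<ge> 0" "\<And>r r' x x'. \<bar>r\<bar> \<le> \<beta> \<Longrightarrow> \<bar>r'\<bar> \<le> \<beta> \<Longrightarrow>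
    \<bar>xkern r x - xkern r' x'\<bar> \<le> K * (\<bar>r - r'\<bar> + \<bar>x - x'\<bar>)"
    using xkern_lipschitz by blast
  let ?C = "8 * exp (2 * \<beta>) + K * (\<beta> + 2)"
  have "\<bar>spin_kern y s - spin_kern z s\<bar> \<le> ?C * norm (y - z)"
    if n: "norm y \<le> 1" "norm z \<le> 1" "norm s = 1" for y z s :: "real ^ 'n"
  proof -
    have nd: "\<bar>norm y - norm z\<bar> \<le> norm (y - z)" by (rule norm_triangle_ineq3)
    let ?ky = "xkern (\<beta> * norm y) (s \<bullet> sgn y)" and ?kz = "xkern (\<beta> * norm z) (s \<bullet> sgn z)"
    have 1: "\<bar>((norm y)\<^sup>2 - (norm z)\<^sup>2) * ?ky\<bar> \<le> (2 * norm (y - z)) * (4 * exp (2 * \<beta>))"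
    proof -
      have "\<bar>(norm y)\<^sup>2 - (norm z)\<^sup>2\<bar> = (norm y + norm z) * \<bar>norm y - norm z\<bar>"
        by (simp add: power2_eq_square square_diff_square_factored abs_mult)
      also have "\<dots> \<le> 2 * norm (y - z)" using n nd by (intro mult_mono) auto
      finally show ?thesis unfolding abs_mult by (intro mult_mono xkern_bound \<beta>_norm_le n) auto
    qed
    have 2: "\<bar>(norm z)\<^sup>2 * (?ky - ?kz)\<bar> \<le> K * (\<beta> + 2) * norm (y - z)"
    proof (cases "y = 0 \<or> z = 0")
      case True
      show ?thesis
      proof (cases "z = 0")
        case False
        then have y0: "y = 0" using True by simp
        have "\<bar>?ky - ?kz\<bar> \<le> K * (\<bar>\<beta> * norm y - \<beta> * norm z\<bar> + \<bar>s \<bullet> sgn y - s \<bullet> sgn z\<bar>)"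
          by (intro K \<beta>_norm_le n)
        also have "\<dots> \<le> K * (\<beta> + 2)"
        proof (intro mult_left_mono K add_mono)
          show "\<bar>\<beta> * norm y - \<beta> * norm z\<bar> \<le> \<beta>" using \<beta>_norm_le[OF n(2)] by (simp add: y0)
          show "\<bar>s \<bullet> sgn y - s \<bullet> sgn z\<bar> \<le> 2"
            using Cauchy_Schwarz_ineq2[of s "sgn z"] n(3) norm_sgn[of z] by (simp add: y0 split: if_splits)
        qed
        finally have k: "\<bar>?ky - ?kz\<bar> \<le> K * (\<beta> + 2)" .
        have "\<bar>(norm z)\<^sup>2 * (?ky - ?kz)\<bar> = (norm z)\<^sup>2 * \<bar>?ky - ?kz\<bar>" by (simp add: abs_mult)
        also have "\<dots> \<le> norm z * (K * (\<beta> + 2))"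
          using n(2) by (intro mult_mono k) (auto simp: power2_eq_square mult_left_le)
        finally show ?thesis by (simp add: y0 mult.commute)
      qed (use K \<beta>_pos in simp)
    next
      case False
      have "\<bar>?ky - ?kz\<bar> \<le> K * (\<bar>\<beta> * norm y - \<beta> * norm z\<bar> + \<bar>s \<bullet> sgn y - s \<bullet> sgn z\<bar>)"
        by (intro K \<beta>_norm_le n)
      also have "\<dots> \<le> K * (\<beta> * norm (y - z) + norm (sgn y - sgn z))"
      proof (intro mult_left_mono K add_mono)
        show "\<bar>\<beta> * norm y - \<beta> * norm z\<bar> \<le> \<beta> * norm (y - z)"
          using nd \<beta>_pos by (simp add: abs_mult flip: right_diff_distrib)
        show "\<bar>s \<bullet> sgn y - s \<bullet> sgn z\<bar> \<le> norm (sgn y - sgn z)"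
          using Cauchy_Schwarz_ineq2[of s "sgn y - sgn z"] n(3) by (simp add: inner_diff_right)
      qed
      finally have "norm z * (norm z * \<bar>?ky - ?kz\<bar>) \<le> norm z * (norm z * (K * (\<beta> * norm (y - z) + norm (sgn y - sgn z))))"
        by (intro mult_left_mono) auto
      also have "\<dots> \<le> 1 * (norm z * (K * (\<beta> * norm (y - z) + norm (sgn y - sgn z))))"
        using n K \<beta>_pos by (intro mult_right_mono) auto
      also have "\<dots> = K * (\<beta> * (norm z * norm (y - z)) + norm z * norm (sgn y - sgn z))"
        by (simp add: algebra_simps)
      also have "\<dots> \<le> K * (\<beta> * (1 * norm (y - z)) + 2 * norm (y - z))"
        using n \<beta>_pos False K by (intro mult_left_mono add_mono norm_sgn_diff_le mult_right_mono) auto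
      finally have "norm z * (norm z * \<bar>?ky - ?kz\<bar>) \<le> K * (\<beta> + 2) * norm (y - z)"
        by (simp add: algebra_simps)
      moreover have "\<bar>(norm z)\<^sup>2 * (?ky - ?kz)\<bar> = norm z * (norm z * \<bar>?ky - ?kz\<bar>)"
        by (simp add: abs_mult power2_eq_square mult.assoc)
      ultimately show ?thesis by (simp only:)
    qed
    have "spin_kern y s - spin_kern z s = ((norm y)\<^sup>2 - (norm z)\<^sup>2) * ?ky + (norm z)\<^sup>2 * (?ky - ?kz)"
      by (simp add: spin_kern_def algebra_simps)
    then show ?thesis using 1 2 abs_triangle_ineq[of "((norm y)\<^sup>2 - (norm z)\<^sup>2) * ?ky" "(norm z)\<^sup>2 * (?ky - ?kz)"]
      by (simp add: algebra_simps)
  qed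
  moreover have "0 \<le> ?C" using K \<beta>_pos by simp
  ultimately show ?thesis using that by blast
qed

lemma spin_mean_lipschitz:
  assumes "norm y \<le> 1" "norm z \<le> 1"
  shows "\<bar>spin_mean y - spin_mean z\<bar> \<le> (1 + \<beta>) * \<bar>norm y - norm z\<bar>"
proof -
  have "spin_mean y - spin_mean z = (norm y - norm z) * mag (\<beta> * norm y)
      + norm z * (mag (\<beta> * norm y) - mag (\<beta> * norm z))"
    by (simp add: spin_mean_def algebra_simps)
  also have "\<bar>\<dots>\<bar> \<le> \<bar>norm y - norm z\<bar> * \<bar>mag (\<beta> * norm y)\<bar> + norm z * \<bar>mag (\<beta> * norm y) - mag (\<beta> * norm z)\<bar>"
    by (rule order_trans[OF abs_triangle_ineq]) (simp add: abs_mult)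
  also have "\<dots> \<le> \<bar>norm y - norm z\<bar> * 1 + 1 * \<bar>\<beta> * norm y - \<beta> * norm z\<bar>"
    using assms by (intro add_mono mult_mono abs_mag_le_1 mag_lipschitz) auto
  also have "\<bar>\<beta> * norm y - \<beta> * norm z\<bar> = \<beta> * \<bar>norm y - norm z\<bar>"
    using \<beta>_pos by (simp add: abs_mult flip: right_diff_distrib)
  finally show ?thesis by (simp add: algebra_simps)
qed

lemma spin_mean_abs_le: "norm y \<le> 1 \<Longrightarrow> \<bar>spin_mean y\<bar> \<le> 1"
  using abs_mag_le_1[of "\<beta> * norm y"] by (auto simp: spin_mean_def abs_mult intro!: mult_le_one)

text \<open>
  By the Riccati equation the variance is a Lipschitz function of \<open>norm y\<close>, without a bound on the
  derivative of \<open>mag'\<close>.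
\<close>

lemma spin_var_eq: "spin_var y = (norm y)\<^sup>2 - (spin_mean y)\<^sup>2 - (real CARD('n) - 1) / \<beta> * spin_mean y"
proof -
  have "\<beta> * spin_var y = norm y * (\<beta> * norm y * mag' (\<beta> * norm y))"
    by (simp add: spin_var_def power2_eq_square)
  also have "\<dots> = \<beta> * ((norm y)\<^sup>2 - (spin_mean y)\<^sup>2 - (real CARD('n) - 1) / \<beta> * spin_mean y)"
    unfolding riccati using \<beta>_pos by (simp add: spin_mean_def power2_eq_square field_simps)
  finally show ?thesis using \<beta>_pos by simp
qed

lemma spin_var_lipschitz:
  assumes "norm y \<le> 1" "norm z \<le> 1"
  shows "\<bar>spin_var y - spin_var z\<bar> \<le> (2 + 2 * (1 + \<beta>) + (1 + \<beta>)) * \<bar>norm y - norm z\<bar>"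
proof -
  let ?m = "spin_mean y - spin_mean z" and ?q = "(real CARD('n) - 1) / \<beta>"
  have q: "0 \<le> ?q" "?q \<le> 1" using dim_ge_2 \<beta>_gt_dim by (auto simp: field_simps)
  have sq: "\<bar>p\<^sup>2 - p'\<^sup>2\<bar> \<le> 2 * \<bar>p - p'\<bar>" if "\<bar>p\<bar> \<le> 1" "\<bar>p'\<bar> \<le> 1" for p p' :: real
  proof -
    have "\<bar>p\<^sup>2 - p'\<^sup>2\<bar> = \<bar>p + p'\<bar> * \<bar>p - p'\<bar>"
      by (simp add: power2_eq_square square_diff_square_factored abs_mult)
    also have "\<dots> \<le> 2 * \<bar>p - p'\<bar>" using that by (intro mult_right_mono) linarith+
    finally show ?thesis .
  qed
  have m: "\<bar>?m\<bar> \<le> (1 + \<beta>) * \<bar>norm y - norm z\<bar>" by (rule spin_mean_lipschitz[OF assms])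
  have 1: "\<bar>(norm y)\<^sup>2 - (norm z)\<^sup>2\<bar> \<le> 2 * \<bar>norm y - norm z\<bar>"
    using assms by (intro sq) auto
  have 2: "\<bar>(spin_mean y)\<^sup>2 - (spin_mean z)\<^sup>2\<bar> \<le> 2 * \<bar>?m\<bar>"
    using assms by (intro sq spin_mean_abs_le)
  have "\<bar>?q * ?m\<bar> \<le> 1 * \<bar>?m\<bar>" unfolding abs_mult using q by (intro mult_right_mono) auto
  then have 3: "\<bar>?q * ?m\<bar> \<le> \<bar>?m\<bar>" by simp
  have tri: "\<bar>u - v - w\<bar> \<le> \<bar>u\<bar> + \<bar>v\<bar> + \<bar>w\<bar>" for u v w :: real by linarith
  have "spin_var y - spin_var z = ((norm y)\<^sup>2 - (norm z)\<^sup>2) - ((spin_mean y)\<^sup>2 - (spin_mean z)\<^sup>2) - ?q * ?m"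
    unfolding spin_var_eq by (simp add: right_diff_distrib)
  then have "\<bar>spin_var y - spin_var z\<bar> \<le> 2 * \<bar>norm y - norm z\<bar> + 2 * \<bar>?m\<bar> + \<bar>?m\<bar>"
    by (simp only:) (intro order_trans[OF tri] add_mono 1 2 3)
  also have "\<dots> \<le> 2 * \<bar>norm y - norm z\<bar> + 2 * ((1 + \<beta>) * \<bar>norm y - norm z\<bar>) + (1 + \<beta>) * \<bar>norm y - norm z\<bar>"
    using m by (intro add_mono mult_left_mono) auto
  finally show ?thesis by (simp add: algebra_simps)
qed

text \<open>
  The constants \<open>A\<close> and \<open>D\<close> are later those for which \<open>A + D * (y \<bullet> s)\<close> is the squared norm of \<open>y + s / n\<close>,
  for unit vectors \<open>s\<close>.
\<close>

lemma one_spin_stein: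
  assumes h: "continuous_on UNIV h" and h': "\<And>u. u \<noteq> z \<Longrightarrow> (h has_real_derivative h' u) (at u)"
    and h'_meas: "h' \<in> borel_measurable borel"
    and h'_bound: "\<And>K. \<exists>C. \<forall>u. \<bar>u\<bar> \<le> K \<longrightarrow> \<bar>h' u\<bar> \<le> C"
  shows "(\<integral>s. (h (A + D * (y \<bullet> s)) * (y \<bullet> s - spin_mean y) - D * h' (A + D * (y \<bullet> s)) * spin_kern y s)
    * exp (\<beta> * (y \<bullet> s)) \<partial>uniform_sphere) = 0"
proof (cases "y = 0")
  case True
  then show ?thesis by (simp add: spin_mean_def spin_kern_def)
next
  case False
  define u where "u = sgn y"
  have u: "norm u = 1" using False by (simp add: u_def norm_sgn)
  define r where "r = \<beta> * norm y"
  define B where "B = D * norm y"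
  have ys: "y \<bullet> s = norm y * (s \<bullet> u)" for s
    using False by (simp add: u_def sgn_div_norm inner_commute)
  define G where "G x = ((x - mag r) * h (A + B * x) - B * h' (A + B * x) * xkern r x) * exp (r * x)" for x
  have [measurable]: "h \<in> borel_measurable borel" "h' \<in> borel_measurable borel"
    using h by (auto intro: borel_measurable_continuous_onI h'_meas)
  obtain C' where C': "\<And>v. \<bar>v\<bar> \<le> \<bar>A\<bar> + \<bar>B\<bar> \<Longrightarrow> \<bar>h' v\<bar> \<le> C'" using h'_bound[of "\<bar>A\<bar> + \<bar>B\<bar>"] by blast
  have "compact (h ` {- (\<bar>A\<bar> + \<bar>B\<bar>)..\<bar>A\<bar> + \<bar>B\<bar>})"
    by (intro compact_continuous_image continuous_on_subset[OF h]) auto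
  then obtain C where C: "\<And>v. v \<in> {- (\<bar>A\<bar> + \<bar>B\<bar>)..\<bar>A\<bar> + \<bar>B\<bar>} \<Longrightarrow> \<bar>h v\<bar> \<le> C"
    using compact_imp_bounded[of "h ` {- (\<bar>A\<bar> + \<bar>B\<bar>)..\<bar>A\<bar> + \<bar>B\<bar>}"] unfolding bounded_iff
    by (metis imageI real_norm_def)
  have "(\<integral>s. G (s \<bullet> u) \<partial>uniform_sphere) = 0"
  proof (rule sphere_integral_inner[OF u dim_ge_2])
    show "G \<in> borel_measurable borel" unfolding G_def by measurable
    fix x :: real assume x: "\<bar>x\<bar> \<le> 1"
    have "\<bar>A + B * x\<bar> \<le> \<bar>A\<bar> + \<bar>B\<bar> * \<bar>x\<bar>" by (rule order_trans[OF abs_triangle_ineq]) (simp add: abs_mult)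
    also have "\<dots> \<le> \<bar>A\<bar> + \<bar>B\<bar>" using x by (simp add: mult_left_le)
    finally have AB: "\<bar>A + B * x\<bar> \<le> \<bar>A\<bar> + \<bar>B\<bar>" .
    have hx: "\<bar>h (A + B * x)\<bar> \<le> C" 
    proof (rule C)
      show "A + B * x \<in> {- (\<bar>A\<bar> + \<bar>B\<bar>)..\<bar>A\<bar> + \<bar>B\<bar>}"
        unfolding atLeastAtMost_iff using AB by linarith
    qed
    have hx': "\<bar>h' (A + B * x)\<bar> \<le> C'" using C' AB by auto
    have "\<bar>(x - mag r) * h (A + B * x)\<bar> \<le> 2 * C"
      unfolding abs_mult using x abs_mag_le_1[of r] by (intro mult_mono hx) (linarith | simp)+
    moreover have "\<bar>B * h' (A + B * x) * xkern r x\<bar> \<le> \<bar>B\<bar> * C' * (4 * exp (2 * \<bar>r\<bar>))"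
      unfolding abs_mult using hx' by (intro mult_mono xkern_bound) (auto intro: order_trans[OF abs_ge_zero])
    ultimately have "\<bar>(x - mag r) * h (A + B * x) - B * h' (A + B * x) * xkern r x\<bar>
        \<le> 2 * C + \<bar>B\<bar> * C' * (4 * exp (2 * \<bar>r\<bar>))" by linarith
    moreover have "\<bar>r * x\<bar> \<le> \<bar>r\<bar>" unfolding abs_mult using x by (simp add: mult_left_le)
    then have "exp (r * x) \<le> exp \<bar>r\<bar>" by simp
    ultimately show "\<bar>G x\<bar> \<le> (2 * C + \<bar>B\<bar> * C' * (4 * exp (2 * \<bar>r\<bar>))) * exp \<bar>r\<bar>"
      unfolding G_def abs_mult by (intro mult_mono) auto
  next
    show "((\<lambda>t. G (cos t) * sin t ^ (CARD('n) - 2)) has_integral 0) {0..pi}"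
      by (rule has_integral_eq[OF _ stein_identity_angular[OF h h', of z r A B]])
        (simp_all add: G_def xkern_cos mult_ac)
  qed
  then have "(\<integral>s. norm y * G (s \<bullet> u) \<partial>uniform_sphere) = 0" by simp
  then show ?thesis
    unfolding ys G_def B_def r_def spin_mean_def spin_kern_def u_def[symmetric]
    by (simp add: algebra_simps power2_eq_square)
qed

lemma one_spin_kern_mean:
  "(\<integral>s. (spin_kern y s - spin_var y) * exp (\<beta> * (y \<bullet> s)) \<partial>uniform_sphere) = 0"
proof (cases "y = 0")
  case True
  then show ?thesis by (simp add: spin_var_def spin_kern_def)
next
  case False
  define u where "u = sgn y"
  have u: "norm u = 1" using False by (simp add: u_def norm_sgn)
  define r where "r = \<beta> * norm y"
  have ys: "y \<bullet> s = norm y * (s \<bullet> u)" for s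
    using False by (simp add: u_def sgn_div_norm inner_commute)
  define G where "G x = (xkern r x - mag' r) * exp (r * x)" for x
  have "(\<integral>s. G (s \<bullet> u) \<partial>uniform_sphere) = 0"
  proof (rule sphere_integral_inner[OF u dim_ge_2])
    show "G \<in> borel_measurable borel" unfolding G_def by measurable
    fix x :: real assume x: "\<bar>x\<bar> \<le> 1"
    have "\<bar>xkern r x - mag' r\<bar> \<le> 4 * exp (2 * \<bar>r\<bar>) + 1"
      using xkern_bound[of r "\<bar>r\<bar>" x] mag'_nonneg[of r] mag'_le_1[of r] by linarith
    moreover have "\<bar>r * x\<bar> \<le> \<bar>r\<bar>" unfolding abs_mult using x by (simp add: mult_left_le)
    then have "exp (r * x) \<le> exp \<bar>r\<bar>" by simp
    ultimately show "\<bar>G x\<bar> \<le> (4 * exp (2 * \<bar>r\<bar>) + 1) * exp \<bar>r\<bar>"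
      unfolding G_def abs_mult by (intro mult_mono) auto
  next
    show "((\<lambda>t. G (cos t) * sin t ^ (CARD('n) - 2)) has_integral 0) {0..pi}"
      by (rule has_integral_eq[OF _ kern_mean[of r]]) (simp add: G_def xkern_cos mult_ac)
  qed
  then have "(\<integral>s. (norm y)\<^sup>2 * G (s \<bullet> u) \<partial>uniform_sphere) = 0" by simp
  then show ?thesis
    unfolding ys G_def r_def spin_var_def spin_kern_def u_def[symmetric]
    by (simp add: algebra_simps power2_eq_square)
qed

end

section \<open>The Gibbs measure\<close>

text \<open>The contribution to the mean spin of the spins outside \<open>A\<close>.\<close>

definition cavity :: "nat \<Rightarrow> nat set \<Rightarrow> (nat \<Rightarrow> real ^ 'n) \<Rightarrow> real ^ 'n" where
  "cavity n A \<sigma> = (1 / real n) *\<^sub>R (\<Sum>k\<in>{1..n} - A. \<sigma> k)"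

definition sq_mean_spin :: "nat \<Rightarrow> (nat \<Rightarrow> real ^ 'n) \<Rightarrow> real" where
  "sq_mean_spin n \<sigma> = (norm (cavity n {} \<sigma>))\<^sup>2"

lemma cavity_upd: "i \<in> A \<Longrightarrow> cavity n A (\<sigma>(i := s)) = cavity n A \<sigma>"
  unfolding cavity_def by (auto intro!: arg_cong[where f = "scaleR _"] sum.cong)

lemma cavity_insert:
  assumes "i \<in> {1..n}" "i \<notin> A"
  shows "cavity n A \<sigma> = cavity n (insert i A) \<sigma> + (1 / real n) *\<^sub>R \<sigma> i"
proof -
  have eq: "{1..n} - A = insert i ({1..n} - insert i A)" using assms by auto
  have "(\<Sum>k\<in>{1..n} - A. \<sigma> k) = \<sigma> i + (\<Sum>k\<in>{1..n} - insert i A. \<sigma> k)"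
    by (subst eq) simp
  then show ?thesis by (simp add: cavity_def scaleR_add_right)
qed

lemma space_config: "space (config_measure n) = (\<Pi>\<^sub>E i\<in>{1..n}. sphere 0 1)"
  by (simp add: config_measure_def space_PiM)

lemma norm_spin: "\<sigma> \<in> space (config_measure n) \<Longrightarrow> i \<in> {1..n} \<Longrightarrow> norm (\<sigma> i) = 1"
  by (auto simp: space_config PiE_iff)

lemma norm_cavity_le:
  assumes "\<sigma> \<in> space (config_measure n)"
  shows "norm (cavity n A \<sigma>) \<le> 1"
proof -
  have "norm (\<Sum>k\<in>{1..n} - A. \<sigma> k) \<le> (\<Sum>k\<in>{1..n} - A. norm (\<sigma> k))" by (rule norm_sum)
  also have "\<dots> = real (card ({1..n} - A))" using norm_spin[OF assms] by simp
  also have "\<dots> \<le> real n" using card_mono[of "{1..n}" "{1..n} - A"] by simp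
  finally show ?thesis by (cases "n = 0") (auto simp: cavity_def field_simps)
qed

lemma norm_cavity_diff:
  assumes "\<sigma> \<in> space (config_measure n)" "i \<in> {1..n}" "i \<notin> A"
  shows "norm (cavity n A \<sigma> - cavity n (insert i A) \<sigma>) = 1 / real n"
  using norm_spin[OF assms(1,2)] by (simp add: cavity_insert[OF assms(2,3)])

lemma sq_mean_spin_bounds:
  assumes "\<sigma> \<in> space (config_measure n)"
  shows "0 \<le> sq_mean_spin n \<sigma>" "sq_mean_spin n \<sigma> \<le> 1"
  using norm_cavity_le[OF assms, of "{}"] by (auto simp: sq_mean_spin_def power_le_one)

lemma sq_mean_spin_eq:
  assumes "i \<in> {1..n}" "norm (\<sigma> i) = 1"
  shows "sq_mean_spin n \<sigma> = ((norm (cavity n {i} \<sigma>))\<^sup>2 + 1 / (real n)\<^sup>2) + 2 / real n * (cavity n {i} \<sigma> \<bullet> \<sigma> i)"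
proof -
  have e: "cavity n {} \<sigma> = cavity n {i} \<sigma> + (1 / real n) *\<^sub>R \<sigma> i"
    using cavity_insert[OF assms(1), of "{}"] by simp
  have "\<sigma> i \<bullet> \<sigma> i = 1" using assms(2) by (simp add: dot_square_norm)
  then show ?thesis
    unfolding sq_mean_spin_def e power2_norm_eq_inner
    by (simp add: inner_add_left inner_add_right inner_commute power2_eq_square)
qed

lemma total_spin_eq: "total_spin n \<sigma> = real n *\<^sub>R cavity n {} \<sigma>"
  by (cases "n = 0") (simp_all add: total_spin_def cavity_def)

lemma hamiltonian_eq:
  assumes "1 \<le> n"
  shows "hamiltonian n \<sigma> = - (real n / 2) * sq_mean_spin n \<sigma>"
proof -
  have "(\<Sum>i = 1..n. \<Sum>j = 1..n. \<sigma> i \<bullet> \<sigma> j) = total_spin n \<sigma> \<bullet> total_spin n \<sigma>"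
    unfolding total_spin_def inner_sum_left inner_sum_right by (rule sum.swap)
  also have "\<dots> = (real n)\<^sup>2 * sq_mean_spin n \<sigma>"
    by (simp add: total_spin_eq sq_mean_spin_def power2_norm_eq_inner power2_eq_square[of "real n"])
  finally show ?thesis using assms by (simp add: hamiltonian_def power2_eq_square)
qed

text \<open>These two averages depend on the configuration through the mean spin only.\<close>

lemma mean_cavity_inner:
  assumes "1 \<le> n" "\<sigma> \<in> space (config_measure n)"
  shows "(\<Sum>i = 1..n. cavity n {i} \<sigma> \<bullet> \<sigma> i) / real n = sq_mean_spin n \<sigma> - 1 / real n"
proof -
  have "cavity n {i} \<sigma> \<bullet> \<sigma> i = cavity n {} \<sigma> \<bullet> \<sigma> i - 1 / real n" if "i \<in> {1..n}" for i
    using cavity_insert[OF that, of "{}" \<sigma>] norm_spin[OF assms(2) that]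
    by (simp add: inner_add_left dot_square_norm)
  then have "(\<Sum>i = 1..n. cavity n {i} \<sigma> \<bullet> \<sigma> i) = (\<Sum>i = 1..n. cavity n {} \<sigma> \<bullet> \<sigma> i) - 1"
    using assms(1) by (simp add: sum_subtractf)
  also have "(\<Sum>i = 1..n. cavity n {} \<sigma> \<bullet> \<sigma> i) = cavity n {} \<sigma> \<bullet> total_spin n \<sigma>"
    by (simp add: total_spin_def inner_sum_right)
  also have "\<dots> = real n * sq_mean_spin n \<sigma>"
    by (simp add: total_spin_eq sq_mean_spin_def power2_norm_eq_inner)
  finally show ?thesis using assms(1) by (simp add: field_simps)
qed

lemma mean_cavity_norm:
  assumes "1 \<le> n" "\<sigma> \<in> space (config_measure n)"
  shows "(\<Sum>i = 1..n. (norm (cavity n {i} \<sigma>))\<^sup>2) / real n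
    = (1 - 2 / real n) * sq_mean_spin n \<sigma> + 1 / (real n)\<^sup>2"
proof -
  have "(norm (cavity n {i} \<sigma>))\<^sup>2 = sq_mean_spin n \<sigma> - 1 / (real n)\<^sup>2 - 2 / real n * (cavity n {i} \<sigma> \<bullet> \<sigma> i)"
    if "i \<in> {1..n}" for i
    using sq_mean_spin_eq[of i n \<sigma>, OF that norm_spin[OF assms(2) that]] by linarith
  then have "(\<Sum>i = 1..n. (norm (cavity n {i} \<sigma>))\<^sup>2)
      = (\<Sum>i = 1..n. sq_mean_spin n \<sigma> - 1 / (real n)\<^sup>2 - 2 / real n * (cavity n {i} \<sigma> \<bullet> \<sigma> i))"
    by (intro sum.cong refl)
  also have "\<dots> = real n * (sq_mean_spin n \<sigma> - 1 / (real n)\<^sup>2)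
      - 2 * ((\<Sum>i = 1..n. cavity n {i} \<sigma> \<bullet> \<sigma> i) / real n)"
    unfolding sum_subtractf[of _ "\<lambda>i. 2 / real n * (cavity n {i} \<sigma> \<bullet> \<sigma> i)"] sum_distrib_left[symmetric] by simp
  finally have eq: "(\<Sum>i = 1..n. (norm (cavity n {i} \<sigma>))\<^sup>2)
      = real n * (sq_mean_spin n \<sigma> - 1 / (real n)\<^sup>2) - 2 * (sq_mean_spin n \<sigma> - 1 / real n)"
    unfolding mean_cavity_inner[OF assms] .
  show ?thesis unfolding eq using assms(1) by (simp add: field_simps power2_eq_square)
qed

lemma measurable_spin [measurable]:
  assumes "i \<in> {1..n}"
  shows "(\<lambda>\<sigma>. \<sigma> i) \<in> borel_measurable (config_measure n)"
  using measurable_compose[OF measurable_component_singleton[OF assms, of "\<lambda>_. uniform_sphere"]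
      measurable_uniform_sphere_borel]
  unfolding config_measure_def .

lemma measurable_cavity [measurable]: "cavity n A \<in> borel_measurable (config_measure n)"
  unfolding cavity_def[abs_def] by (intro borel_measurable_scaleR borel_measurable_sum measurable_const measurable_spin) auto

lemma measurable_sq_mean_spin [measurable]: "sq_mean_spin n \<in> borel_measurable (config_measure n)"
  unfolding sq_mean_spin_def[abs_def] by measurable

lemma prob_space_config: "prob_space (config_measure n)"
  unfolding config_measure_def by (intro prob_space_PiM prob_space_uniform_sphere)

lemma config_integrable_bounded:
  fixes F :: "(nat \<Rightarrow> real ^ 'n) \<Rightarrow> real"
  assumes "F \<in> borel_measurable (config_measure n)" "\<And>\<sigma>. \<sigma> \<in> space (config_measure n) \<Longrightarrow> \<bar>F \<sigma>\<bar> \<le> C"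
  shows "integrable (config_measure n) F"
proof -
  interpret prob_space "config_measure n :: (nat \<Rightarrow> real ^ 'n) measure" by (rule prob_space_config)
  show ?thesis by (rule integrable_const_bound[of F C]) (use assms in auto)
qed

lemma config_integral_insert:
  fixes F :: "(nat \<Rightarrow> real ^ 'n) \<Rightarrow> real"
  assumes i: "i \<in> {1..n}" and F: "F \<in> borel_measurable (config_measure n)"
    and C: "\<And>\<sigma>. \<sigma> \<in> space (config_measure n) \<Longrightarrow> \<bar>F \<sigma>\<bar> \<le> C"
    and 0: "\<And>\<sigma>. (\<integral>s. F (\<sigma>(i := s)) \<partial>uniform_sphere) = 0"
  shows "(\<integral>\<sigma>. F \<sigma> \<partial>config_measure n) = 0"
proof -
  interpret product_sigma_finite "\<lambda>_::nat. uniform_sphere :: (real ^ 'n) measure"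
    by standard
  have ins: "{1..n} = insert i ({1..n} - {i})" using i by auto
  have int: "integrable (PiM (insert i ({1..n} - {i})) (\<lambda>_. uniform_sphere)) F"
    using config_integrable_bounded[OF F C] unfolding config_measure_def ins[symmetric] by simp
  have "(\<integral>\<sigma>. F \<sigma> \<partial>config_measure n)
      = (\<integral>\<sigma>. F \<sigma> \<partial>PiM (insert i ({1..n} - {i})) (\<lambda>_. uniform_sphere))"
    unfolding config_measure_def ins[symmetric] ..
  also have "\<dots> = (\<integral>\<sigma>. (\<integral>s. F (\<sigma>(i := s)) \<partial>uniform_sphere) \<partial>PiM ({1..n} - {i}) (\<lambda>_. uniform_sphere))"
    by (rule product_integral_insert[OF _ _ int]) auto
  finally show ?thesis by (simp add: 0)
qed

context vector_model
begin

abbreviation gibbs :: "nat \<Rightarrow> (nat \<Rightarrow> real ^ 'n) measure" where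
  "gibbs n \<equiv> gibbs_measure n \<beta>"

abbreviation weight :: "nat \<Rightarrow> (nat \<Rightarrow> real ^ 'n) \<Rightarrow> real" where
  "weight n \<sigma> \<equiv> exp (- \<beta> * hamiltonian n \<sigma>)"

definition Z :: "nat \<Rightarrow> real" where
  "Z n = partition_function TYPE('n) n \<beta>"

lemma weight_eq: "1 \<le> n \<Longrightarrow> weight n \<sigma> = exp (\<beta> * real n / 2 * sq_mean_spin n \<sigma>)"
  by (simp add: hamiltonian_eq)

lemma weight_bounds:
  assumes "1 \<le> n" "\<sigma> \<in> space (config_measure n)"
  shows "1 \<le> weight n \<sigma>" "weight n \<sigma> \<le> exp (\<beta> * real n / 2)"
  unfolding weight_eq[OF assms(1)]
  using sq_mean_spin_bounds[OF assms(2)] \<beta>_pos by (auto simp: mult_left_le)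

lemma measurable_weight: "1 \<le> n \<Longrightarrow> weight n \<in> borel_measurable (config_measure n)"
  unfolding weight_eq by measurable

lemma Z_ge_1:
  assumes n: "1 \<le> n"
  shows "1 \<le> Z n"
proof -
  interpret prob_space "config_measure n :: (nat \<Rightarrow> real ^ 'n) measure" by (rule prob_space_config)
  have "(\<integral>\<sigma>. 1 \<partial>(config_measure n :: (nat \<Rightarrow> real ^ 'n) measure)) \<le> Z n"
    unfolding Z_def partition_function_def
  proof (intro integral_mono config_integrable_bounded[of _ _ "exp (\<beta> * real n / 2)"] measurable_weight n)
    show "\<bar>weight n \<sigma>\<bar> \<le> exp (\<beta> * real n / 2)" if "\<sigma> \<in> space (config_measure n)" for \<sigma>
      using weight_bounds[OF n that] by simp
  qed (use weight_bounds[OF n] \<beta>_pos in auto)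
  then show ?thesis by (simp add: prob_space)
qed

lemma sets_gibbs [measurable_cong]: "sets (gibbs n) = sets (config_measure n)"
  by (simp add: gibbs_measure_def)

lemma space_gibbs: "space (gibbs n) = space (config_measure n)"
  by (simp add: gibbs_measure_def)

lemma gibbs_integral:
  fixes F :: "(nat \<Rightarrow> real ^ 'n) \<Rightarrow> real"
  assumes n: "1 \<le> n" and F: "F \<in> borel_measurable (config_measure n)"
  shows "(\<integral>\<sigma>. F \<sigma> \<partial>gibbs n) = (\<integral>\<sigma>. weight n \<sigma> * F \<sigma> \<partial>config_measure n) / Z n"
proof -
  have "(\<integral>\<sigma>. F \<sigma> \<partial>gibbs n) = (\<integral>\<sigma>. (weight n \<sigma> / Z n) *\<^sub>R F \<sigma> \<partial>config_measure n)"
    unfolding gibbs_measure_def Z_def[symmetric] using Z_ge_1[OF n] measurable_weight[OF n]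
    by (intro integral_density F) auto
  then show ?thesis by (simp flip: integral_divide_zero)
qed

lemma prob_space_gibbs:
  assumes n: "1 \<le> n"
  shows "prob_space (gibbs n)"
proof
  have int: "integrable (config_measure n :: (nat \<Rightarrow> real ^ 'n) measure) (\<lambda>\<sigma>. weight n \<sigma> / Z n)"
    by (intro integrable_divide config_integrable_bounded[of _ _ "exp (\<beta> * real n / 2)"] measurable_weight n)
      (use weight_bounds[OF n] in auto)
  have "emeasure (gibbs n) (space (gibbs n)) = (\<integral>\<^sup>+\<sigma>. ennreal (weight n \<sigma> / Z n) \<partial>config_measure n)"
    unfolding gibbs_measure_def Z_def[symmetric] using measurable_weight[OF n] by (simp add: emeasure_density)
  also have "\<dots> = ennreal (\<integral>\<sigma>. weight n \<sigma> / Z n \<partial>(config_measure n :: (nat \<Rightarrow> real ^ 'n) measure))"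
    by (rule nn_integral_eq_integral[OF int]) (use Z_ge_1[OF n] in auto)
  also have "(\<integral>\<sigma>. weight n \<sigma> / Z n \<partial>(config_measure n :: (nat \<Rightarrow> real ^ 'n) measure)) = Z n / Z n"
    by (simp add: Z_def partition_function_def)
  finally show "emeasure (gibbs n) (space (gibbs n)) = 1" using Z_ge_1[OF n] by simp
qed

lemma gibbs_integrable_bounded:
  fixes F :: "(nat \<Rightarrow> real ^ 'n) \<Rightarrow> real"
  assumes n: "1 \<le> n" and "F \<in> borel_measurable (config_measure n)"
    "\<And>\<sigma>. \<sigma> \<in> space (config_measure n) \<Longrightarrow> \<bar>F \<sigma>\<bar> \<le> C"
  shows "integrable (gibbs n) F"
proof -
  interpret prob_space "gibbs n" by (rule prob_space_gibbs[OF n])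
  show ?thesis by (rule integrable_const_bound[of F C]) (use assms in \<open>auto simp: space_gibbs\<close>)
qed

text \<open>
  Given the other spins, the spin \<open>i\<close> has density proportional to \<open>exp (\<beta> * (y \<bullet> s))\<close> with
  \<open>y = cavity n {i} \<sigma>\<close>: a function whose mean under that density vanishes has mean zero.
\<close>

lemma gibbs_conditional_mean_zero:
  fixes F :: "(nat \<Rightarrow> real ^ 'n) \<Rightarrow> real"
  assumes i: "i \<in> {1..n}" and F: "F \<in> borel_measurable (config_measure n)"
    and C: "\<And>\<sigma>. \<sigma> \<in> space (config_measure n) \<Longrightarrow> \<bar>F \<sigma>\<bar> \<le> C"
    and 0: "\<And>\<sigma>. (\<integral>s. (if norm s = 1 then F (\<sigma>(i := s)) else 0) * exp (\<beta> * (cavity n {i} \<sigma> \<bullet> s)) \<partial>uniform_sphere) = 0"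
  shows "(\<integral>\<sigma>. F \<sigma> \<partial>gibbs n) = 0"
proof -
  have n: "1 \<le> n" using i by simp
  have "(\<integral>\<sigma>. weight n \<sigma> * F \<sigma> \<partial>config_measure n) = 0"
  proof (rule config_integral_insert[OF i])
    show "(\<lambda>\<sigma>. weight n \<sigma> * F \<sigma>) \<in> borel_measurable (config_measure n)"
      using F measurable_weight[OF n] by measurable
    show "\<bar>weight n \<sigma> * F \<sigma>\<bar> \<le> exp (\<beta> * real n / 2) * C" if "\<sigma> \<in> space (config_measure n)" for \<sigma>
      unfolding abs_mult using weight_bounds[OF n that] C[OF that] by (intro mult_mono) auto
    fix \<sigma> :: "nat \<Rightarrow> real ^ 'n"
    let ?Y = "cavity n {i} \<sigma>"
    let ?K = "exp (\<beta> * real n / 2 * ((norm ?Y)\<^sup>2 + 1 / (real n)\<^sup>2))"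
    have "(\<integral>s. weight n (\<sigma>(i := s)) * F (\<sigma>(i := s)) \<partial>uniform_sphere)
        = (\<integral>s. ?K * ((if norm s = 1 then F (\<sigma>(i := s)) else 0) * exp (\<beta> * (?Y \<bullet> s))) \<partial>uniform_sphere)"
    proof (intro Bochner_Integration.integral_cong refl)
      fix s :: "real ^ 'n" assume "s \<in> space uniform_sphere"
      then have s: "norm s = 1" by simp
      have "sq_mean_spin n (\<sigma>(i := s)) = ((norm ?Y)\<^sup>2 + 1 / (real n)\<^sup>2) + 2 / real n * (?Y \<bullet> s)"
        using sq_mean_spin_eq[OF i, of "\<sigma>(i := s)"] s by (simp add: cavity_upd)
      then have "\<beta> * real n / 2 * sq_mean_spin n (\<sigma>(i := s))
          = \<beta> * real n / 2 * ((norm ?Y)\<^sup>2 + 1 / (real n)\<^sup>2) + \<beta> * (?Y \<bullet> s)"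
        using n by (simp add: distrib_left)
      then have "weight n (\<sigma>(i := s)) = ?K * exp (\<beta> * (?Y \<bullet> s))"
        unfolding weight_eq[OF n] by (simp only: exp_add)
      then show "weight n (\<sigma>(i := s)) * F (\<sigma>(i := s))
          = ?K * ((if norm s = 1 then F (\<sigma>(i := s)) else 0) * exp (\<beta> * (?Y \<bullet> s)))"
        using s by simp
    qed
    also have "\<dots> = 0" using 0[of \<sigma>] by simp
    finally show "(\<integral>s. weight n (\<sigma>(i := s)) * F (\<sigma>(i := s)) \<partial>uniform_sphere) = 0" .
  qed
  then show ?thesis by (simp add: gibbs_integral[OF n F])
qed

text \<open>
  Every summand of \<open>drift\<close> has conditional mean zero given the other spins. Seen as a function of the mean
  spin, minus the sum is up to an error of order \<open>1 / n\<close> a force towards the radius \<open>s0\<close>.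
\<close>

definition drift :: "nat \<Rightarrow> (nat \<Rightarrow> real ^ 'n) \<Rightarrow> real" where
  "drift n \<sigma> = (\<Sum>i = 1..n. cavity n {i} \<sigma> \<bullet> \<sigma> i - spin_mean (cavity n {i} \<sigma>)) / real n"

definition mean_kern :: "nat \<Rightarrow> (nat \<Rightarrow> real ^ 'n) \<Rightarrow> real" where
  "mean_kern n \<sigma> = (\<Sum>i = 1..n. spin_kern (cavity n {i} \<sigma>) (\<sigma> i)) / real n"

lemma measurable_drift [measurable]: "drift n \<in> borel_measurable (config_measure n)"
  unfolding drift_def[abs_def] by measurable

lemma measurable_mean_kern [measurable]: "mean_kern n \<in> borel_measurable (config_measure n)"
  unfolding mean_kern_def[abs_def] by measurable

lemma drift_eq:
  assumes "1 \<le> n" "\<sigma> \<in> space (config_measure n)"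
  shows "drift n \<sigma> = sq_mean_spin n \<sigma> - 1 / real n - (\<Sum>i = 1..n. spin_mean (cavity n {i} \<sigma>)) / real n"
  using mean_cavity_inner[OF assms] by (simp add: drift_def sum_subtractf diff_divide_distrib)

lemma spin_centred_bound:
  assumes "\<sigma> \<in> space (config_measure n)" "i \<in> {1..n}"
  shows "\<bar>cavity n {i} \<sigma> \<bullet> \<sigma> i - spin_mean (cavity n {i} \<sigma>)\<bar> \<le> 2"
proof -
  have "\<bar>cavity n {i} \<sigma> \<bullet> \<sigma> i\<bar> \<le> 1 * 1"
    using Cauchy_Schwarz_ineq2[of "cavity n {i} \<sigma>" "\<sigma> i"] norm_cavity_le[OF assms(1), of "{i}"] norm_spin[OF assms]
    by simp
  then show ?thesis using spin_mean_abs_le[OF norm_cavity_le[OF assms(1), of "{i}"]] by linarith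
qed

lemma spin_kern_cavity_bound:
  assumes "\<sigma> \<in> space (config_measure n)"
  shows "\<bar>spin_kern (cavity n A \<sigma>) s\<bar> \<le> 4 * exp (2 * \<beta>)"
proof -
  have "\<bar>spin_kern (cavity n A \<sigma>) s\<bar> \<le> 4 * exp (2 * \<beta>) * (norm (cavity n A \<sigma>))\<^sup>2"
    by (intro spin_kern_bound norm_cavity_le assms)
  also have "\<dots> \<le> 4 * exp (2 * \<beta>) * 1"
    using norm_cavity_le[OF assms, of A] by (intro mult_left_mono power_le_one) auto
  finally show ?thesis by simp
qed

lemma mean_abs_le:
  fixes g :: "nat \<Rightarrow> real"
  assumes "\<And>i. i \<in> {1..n} \<Longrightarrow> \<bar>g i\<bar> \<le> C" "0 \<le> C"
  shows "\<bar>(\<Sum>i = 1..n. g i) / real n\<bar> \<le> C"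
proof (cases "n = 0")
  case False
  have "\<bar>\<Sum>i = 1..n. g i\<bar> \<le> (\<Sum>i = 1..n. \<bar>g i\<bar>)" by (rule sum_abs)
  also have "\<dots> \<le> real n * C" using sum_bounded_above[of "{1..n}" "\<lambda>i. \<bar>g i\<bar>" C] assms by simp
  finally show ?thesis using False by (simp add: field_simps)
qed (use assms in simp)

lemma drift_bound: "\<sigma> \<in> space (config_measure n) \<Longrightarrow> \<bar>drift n \<sigma>\<bar> \<le> 2"
  unfolding drift_def by (intro mean_abs_le spin_centred_bound) auto

lemma mean_kern_bound:
  assumes n: "1 \<le> n" and \<sigma>: "\<sigma> \<in> space (config_measure n)"
  shows "\<bar>mean_kern n \<sigma>\<bar> \<le> 4 * exp (2 * \<beta>) * (sq_mean_spin n \<sigma> + 1 / real n)"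
proof -
  have "\<bar>mean_kern n \<sigma>\<bar> \<le> (\<Sum>i = 1..n. 4 * exp (2 * \<beta>) * (norm (cavity n {i} \<sigma>))\<^sup>2) / real n"
    unfolding mean_kern_def abs_divide using n
    by (intro divide_mono order_trans[OF sum_abs] sum_mono spin_kern_bound norm_cavity_le \<sigma>) (auto intro!: sum_nonneg)
  also have "\<dots> = 4 * exp (2 * \<beta>) * ((1 - 2 / real n) * sq_mean_spin n \<sigma> + 1 / (real n)\<^sup>2)"
    unfolding mean_cavity_norm[OF assms, symmetric] by (simp add: sum_distrib_left)
  also have "\<dots> \<le> 4 * exp (2 * \<beta>) * (sq_mean_spin n \<sigma> + 1 / real n)"
  proof (intro mult_left_mono add_mono)
    show "(1 - 2 / real n) * sq_mean_spin n \<sigma> \<le> sq_mean_spin n \<sigma>"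
      using sq_mean_spin_bounds(1)[OF \<sigma>] by (simp add: left_diff_distrib)
    show "1 / (real n)\<^sup>2 \<le> 1 / real n" using n by (simp add: field_simps power2_eq_square)
  qed auto
  finally show ?thesis .
qed

lemma mean_kern_bound':
  assumes n: "1 \<le> n" and \<sigma>: "\<sigma> \<in> space (config_measure n)"
  shows "\<bar>mean_kern n \<sigma>\<bar> \<le> 4 * exp (2 * \<beta>)"
  unfolding mean_kern_def by (intro mean_abs_le spin_kern_cavity_bound \<sigma>) auto

text \<open>
  The squared mean spin is an affine function of the component of the spin \<open>i\<close> along its cavity field,
  so that the identity for one spin applies conditionally on the others.
\<close>

lemma gibbs_stein_identity:
  assumes n: "1 \<le> n"
    and h: "continuous_on UNIV h" and h': "\<And>u. u \<noteq> z \<Longrightarrow> (h has_real_derivative h' u) (at u)"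
    and h'_meas: "h' \<in> borel_measurable borel"
    and h'_bound: "\<And>K. \<exists>C. \<forall>u. \<bar>u\<bar> \<le> K \<longrightarrow> \<bar>h' u\<bar> \<le> C"
  shows "(\<integral>\<sigma>. h (sq_mean_spin n \<sigma>) * drift n \<sigma> \<partial>gibbs n)
    = 2 / real n * (\<integral>\<sigma>. h' (sq_mean_spin n \<sigma>) * mean_kern n \<sigma> \<partial>gibbs n)"
proof -
  have [measurable]: "h \<in> borel_measurable borel" "h' \<in> borel_measurable borel"
    using h by (auto intro: borel_measurable_continuous_onI h'_meas)
  obtain C' where C': "\<And>v. \<bar>v\<bar> \<le> 1 \<Longrightarrow> \<bar>h' v\<bar> \<le> C'" using h'_bound[of 1] by blast
  have "compact (h ` {- 1..1})"
    by (intro compact_continuous_image continuous_on_subset[OF h]) auto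
  then obtain C where C: "\<And>v. v \<in> {- 1..1} \<Longrightarrow> \<bar>h v\<bar> \<le> C"
    using compact_imp_bounded[of "h ` {- 1..1}"] unfolding bounded_iff
    by (metis imageI real_norm_def)
  have hb: "\<bar>h (sq_mean_spin n \<sigma>)\<bar> \<le> C" "\<bar>h' (sq_mean_spin n \<sigma>)\<bar> \<le> C'" if "\<sigma> \<in> space (config_measure n)" for \<sigma>
    using sq_mean_spin_bounds[OF that] by (auto intro!: C C')
  have C0: "0 \<le> C" "0 \<le> C'" using C[of 0] C'[of 0] by auto
  let ?E = "4 * exp (2 * \<beta>)"
  let ?a = "\<lambda>i \<sigma>. h (sq_mean_spin n \<sigma>) * (cavity n {i} \<sigma> \<bullet> \<sigma> i - spin_mean (cavity n {i} \<sigma>))"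
  let ?b = "\<lambda>i \<sigma>. h' (sq_mean_spin n \<sigma>) * spin_kern (cavity n {i} \<sigma>) (\<sigma> i)"
  have ab: "\<bar>?a i \<sigma>\<bar> \<le> C * 2" "\<bar>?b i \<sigma>\<bar> \<le> C' * ?E" if "i \<in> {1..n}" "\<sigma> \<in> space (config_measure n)" for i \<sigma>
    unfolding abs_mult using that C0
    by (auto intro!: mult_mono hb spin_centred_bound spin_kern_cavity_bound)
  have int: "integrable (gibbs n) (?a i)" "integrable (gibbs n) (?b i)" if i: "i \<in> {1..n}" for i
    using i by (auto intro!: gibbs_integrable_bounded[OF n] ab)
  have one: "(\<integral>\<sigma>. ?a i \<sigma> \<partial>gibbs n) = 2 / real n * (\<integral>\<sigma>. ?b i \<sigma> \<partial>gibbs n)" if i: "i \<in> {1..n}" for i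
  proof -
    have "(\<integral>\<sigma>. ?a i \<sigma> - 2 / real n * ?b i \<sigma> \<partial>gibbs n) = 0"
    proof (rule gibbs_conditional_mean_zero[OF i])
      show "(\<lambda>\<sigma>. ?a i \<sigma> - 2 / real n * ?b i \<sigma>) \<in> borel_measurable (config_measure n)"
        using i by measurable
      fix \<sigma> :: "nat \<Rightarrow> real ^ 'n"
      assume \<sigma>: "\<sigma> \<in> space (config_measure n)"
      have "\<bar>2 / real n * ?b i \<sigma>\<bar> \<le> 2 / real n * (C' * ?E)"
        unfolding abs_mult[of "2 / real n"] using ab(2)[OF i \<sigma>] by (intro mult_mono) auto
      then show "\<bar>?a i \<sigma> - 2 / real n * ?b i \<sigma>\<bar> \<le> C * 2 + 2 / real n * (C' * ?E)"
        using ab(1)[OF i \<sigma>] by linarith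
    next
      fix \<sigma> :: "nat \<Rightarrow> real ^ 'n"
      let ?y = "cavity n {i} \<sigma>" and ?D = "2 / real n"
      let ?A = "(norm ?y)\<^sup>2 + 1 / (real n)\<^sup>2"
      have "(\<integral>s. (if norm s = 1 then ?a i (\<sigma>(i := s)) - 2 / real n * ?b i (\<sigma>(i := s)) else 0) * exp (\<beta> * (?y \<bullet> s)) \<partial>uniform_sphere)
        = (\<integral>s. (h (?A + ?D * (?y \<bullet> s)) * (?y \<bullet> s - spin_mean ?y) - ?D * h' (?A + ?D * (?y \<bullet> s)) * spin_kern ?y s)
          * exp (\<beta> * (?y \<bullet> s)) \<partial>uniform_sphere)"
      proof (intro Bochner_Integration.integral_cong refl)
        fix s :: "real ^ 'n" assume "s \<in> space uniform_sphere"
        then have s: "norm s = 1" by simp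
        have "sq_mean_spin n (\<sigma>(i := s)) = ?A + ?D * (?y \<bullet> s)"
          using sq_mean_spin_eq[OF i, of "\<sigma>(i := s)"] s by (simp add: cavity_upd)
        then show "(if norm s = 1 then ?a i (\<sigma>(i := s)) - 2 / real n * ?b i (\<sigma>(i := s)) else 0) * exp (\<beta> * (?y \<bullet> s))
          = (h (?A + ?D * (?y \<bullet> s)) * (?y \<bullet> s - spin_mean ?y) - ?D * h' (?A + ?D * (?y \<bullet> s)) * spin_kern ?y s)
            * exp (\<beta> * (?y \<bullet> s))"
          using s by (simp add: cavity_upd)
      qed
      also have "\<dots> = 0" by (rule one_spin_stein[OF h h' h'_meas h'_bound])
      finally show "(\<integral>s. (if norm s = 1 then ?a i (\<sigma>(i := s)) - 2 / real n * ?b i (\<sigma>(i := s)) else 0) * exp (\<beta> * (?y \<bullet> s)) \<partial>uniform_sphere) = 0" .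
    qed
    then show ?thesis
      by (subst (asm) Bochner_Integration.integral_diff) (use int[OF i] in auto)
  qed
  have "(\<integral>\<sigma>. h (sq_mean_spin n \<sigma>) * drift n \<sigma> \<partial>gibbs n) = (\<integral>\<sigma>. (\<Sum>i = 1..n. ?a i \<sigma>) / real n \<partial>gibbs n)"
    by (simp add: drift_def sum_distrib_left)
  also have "\<dots> = (\<Sum>i = 1..n. (\<integral>\<sigma>. ?a i \<sigma> \<partial>gibbs n)) / real n"
    unfolding integral_divide_zero by (subst Bochner_Integration.integral_sum) (use int in auto)
  also have "\<dots> = 2 / real n * ((\<Sum>i = 1..n. (\<integral>\<sigma>. ?b i \<sigma> \<partial>gibbs n)) / real n)"
    using one by (simp add: sum_distrib_left sum_divide_distrib)
  also have "(\<Sum>i = 1..n. (\<integral>\<sigma>. ?b i \<sigma> \<partial>gibbs n)) / real n = (\<integral>\<sigma>. (\<Sum>i = 1..n. ?b i \<sigma>) / real n \<partial>gibbs n)"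
    unfolding integral_divide_zero by (subst Bochner_Integration.integral_sum) (use int in auto)
  also have "\<dots> = (\<integral>\<sigma>. h' (sq_mean_spin n \<sigma>) * mean_kern n \<sigma> \<partial>gibbs n)"
    by (simp add: mean_kern_def sum_distrib_left)
  finally show ?thesis .
qed

end

section \<open>Concentration of the mean spin\<close>

text \<open>
  In the application \<open>R\<close> is the squared length of the mean spin, \<open>\<omega> = R + q\<close> with \<open>q = 1 / n\<close>, and
  the term \<open>- (R - r) * q\<close> is the effect of the repulsion of the mean spin from 0, which makes up for the
  factor \<open>R\<close> near \<open>R = 0\<close>.
\<close>

lemma restoring_weight:
  fixes c R r q :: real
  assumes c: "0 < c" and r: "0 < r" "r \<le> 1" and R: "0 \<le> R" "R \<le> 1" and q: "0 \<le> q" "q \<le> 1"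
  shows "min c 1 * r / 2 * ((R - r)\<^sup>2 * (R + q)) - 1 / r * (q * (\<bar>R - r\<bar> * (R + q)))
    \<le> c * (R - r)\<^sup>2 * R - (R - r) * q"
proof (cases "R < r")
  case True
  let ?V = "R - r"
  have V: "?V < 0" "\<bar>?V\<bar> \<le> 1" using True r R by auto
  have "?V\<^sup>2 = \<bar>?V\<bar> * \<bar>?V\<bar>" by (simp add: power2_eq_square)
  also have "\<dots> \<le> \<bar>?V\<bar> * 1" using V by (intro mult_left_mono) auto
  finally have "?V\<^sup>2 * q \<le> - ?V * q" using V q by (intro mult_right_mono) auto
  moreover have "min c 1 * r / 2 * (?V\<^sup>2 * (R + q)) \<le> c * ?V\<^sup>2 * R + ?V\<^sup>2 * q"
  proof -
    have m: "min c 1 * r / 2 \<le> c" "min c 1 * r / 2 \<le> 1"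
      using c r by (auto simp: min_def mult_le_one intro: order_trans[OF mult_left_le])
    have "min c 1 * r / 2 * (?V\<^sup>2 * R) \<le> c * (?V\<^sup>2 * R)" "min c 1 * r / 2 * (?V\<^sup>2 * q) \<le> 1 * (?V\<^sup>2 * q)"
      using R q by (intro mult_right_mono m; simp)+
    then show ?thesis by (simp add: distrib_left mult.assoc)
  qed
  moreover have "0 \<le> 1 / r * (q * (\<bar>?V\<bar> * (R + q)))" using r R q by simp
  ultimately show ?thesis by linarith
next
  case False
  let ?V = "R - r"
  have V: "0 \<le> ?V" using False by simp
  have "?V * q * r \<le> ?V * q * (R + q)" using V q False by (intro mult_left_mono) auto
  then have 1: "?V * q \<le> 1 / r * (q * (\<bar>?V\<bar> * (R + q)))" using r V by (simp add: field_simps)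
  have "r * (?V\<^sup>2 * (R + q)) \<le> 2 * (?V\<^sup>2 * R)"
  proof -
    have "r * R \<le> 1 * R" "r * q \<le> r * 1"
      using r R q by (intro mult_right_mono mult_left_mono; simp)+
    then have "r * (R + q) \<le> R + R" using False by (simp add: distrib_left)
    from mult_left_mono[OF this, of "?V\<^sup>2"] show ?thesis by (simp add: algebra_simps)
  qed
  then have "min c 1 / 2 * (r * (?V\<^sup>2 * (R + q))) \<le> min c 1 / 2 * (2 * (?V\<^sup>2 * R))"
    using c by (intro mult_left_mono) auto
  also have "\<dots> \<le> c * (?V\<^sup>2 * R)" using R by (simp add: mult_right_mono)
  finally have "min c 1 * r / 2 * (?V\<^sup>2 * (R + q)) \<le> c * ?V\<^sup>2 * R" by (simp add: mult_ac)
  then show ?thesis using 1 by linarith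
qed

context vector_model
begin

definition dev :: "nat \<Rightarrow> (nat \<Rightarrow> real ^ 'n) \<Rightarrow> real" where
  "dev n \<sigma> = sq_mean_spin n \<sigma> - s0\<^sup>2"

definition \<omega> :: "nat \<Rightarrow> (nat \<Rightarrow> real ^ 'n) \<Rightarrow> real" where
  "\<omega> n \<sigma> = sq_mean_spin n \<sigma> + 1 / real n"

lemma measurable_dev [measurable]: "dev n \<in> borel_measurable (config_measure n)"
  unfolding dev_def[abs_def] by measurable

lemma measurable_\<omega> [measurable]: "\<omega> n \<in> borel_measurable (config_measure n)"
  unfolding \<omega>_def[abs_def] by measurable

lemma s0_sq: "0 < s0\<^sup>2" "s0\<^sup>2 < 1"
  using s0_pos s0_less_1 by (auto simp: abs_square_less_1)

lemma dev_abs_le_1: "\<sigma> \<in> space (config_measure n) \<Longrightarrow> \<bar>dev n \<sigma>\<bar> \<le> 1"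
  using sq_mean_spin_bounds[of \<sigma> n] s0_sq unfolding dev_def abs_le_iff by linarith

lemma \<omega>_bounds:
  assumes "1 \<le> n" "\<sigma> \<in> space (config_measure n)"
  shows "1 / real n \<le> \<omega> n \<sigma>" "0 \<le> \<omega> n \<sigma>" "\<omega> n \<sigma> \<le> 2"
proof -
  have "1 / real n \<le> 1" using assms(1) by simp
  then show "1 / real n \<le> \<omega> n \<sigma>" "0 \<le> \<omega> n \<sigma>" "\<omega> n \<sigma> \<le> 2"
    using sq_mean_spin_bounds[OF assms(2)] by (auto simp: \<omega>_def intro: add_mono)
qed

lemma norm_cavity_close:
  assumes "\<sigma> \<in> space (config_measure n)" "i \<in> {1..n}"
  shows "\<bar>norm (cavity n {i} \<sigma>) - norm (cavity n {} \<sigma>)\<bar> \<le> 1 / real n"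
  using norm_triangle_ineq3[of "cavity n {i} \<sigma>" "cavity n {} \<sigma>"] norm_cavity_diff[OF assms, of "{}"]
  by (simp add: norm_minus_commute)

text \<open>
  Since \<open>spin_mean y\<close> is the product of \<open>(norm y)\<^sup>2\<close> and a Lipschitz function of \<open>norm y\<close>, replacing the
  norms of the cavity fields by that of the mean spin in this function changes the drift by an error
  of order \<open>\<omega> / n\<close>, which is small compared with the drift also where the mean spin is small.
\<close>

lemma drift_restoring:
  obtains c K where "c > 0" "K \<ge> 0" "\<And>n \<sigma>. 1 \<le> n \<Longrightarrow> \<sigma> \<in> space (config_measure n) \<Longrightarrow>
    c * ((dev n \<sigma>)\<^sup>2 * \<omega> n \<sigma>) - K / real n * (\<bar>dev n \<sigma>\<bar> * \<omega> n \<sigma>) \<le> dev n \<sigma> * drift n \<sigma>"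
proof -
  define P where "P t = \<beta> * slope (\<beta> * t)" for t
  obtain c where c: "c > 0" "\<And>t. 0 \<le> t \<Longrightarrow> t \<le> 1 \<Longrightarrow> c * (t\<^sup>2 - s0\<^sup>2)\<^sup>2 \<le> (t\<^sup>2 - s0\<^sup>2) * (1 - P t)"
    using slope_restoring unfolding P_def by blast
  obtain L where L: "L \<ge> 0" "\<And>t t'. t \<in> {0..1} \<Longrightarrow> t' \<in> {0..1} \<Longrightarrow> \<bar>P t - P t'\<bar> \<le> L * \<bar>t - t'\<bar>"
    using \<beta>_slope_lipschitz unfolding P_def by blast
  have "P s0 = 1" using \<beta>_slope_b \<beta>_pos by (simp add: P_def s0_def)
  have P_bound: "\<bar>P t\<bar> \<le> 1 + L" if "t \<in> {0..1}" for t
  proof -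
    have "\<bar>P t - P s0\<bar> \<le> L * \<bar>t - s0\<bar>" using that s0_pos s0_less_1 by (intro L) auto
    also have "\<dots> \<le> L * 1" using that s0_pos s0_less_1 L(1) by (intro mult_left_mono) (auto simp: abs_le_iff)
    finally show ?thesis using \<open>P s0 = 1\<close> by linarith
  qed
  let ?c = "min c 1 * s0\<^sup>2 / 2" and ?K = "1 / s0\<^sup>2 + (2 + 3 * L)"
  have "?c * ((dev n \<sigma>)\<^sup>2 * \<omega> n \<sigma>) - ?K / real n * (\<bar>dev n \<sigma>\<bar> * \<omega> n \<sigma>) \<le> dev n \<sigma> * drift n \<sigma>"
    if n: "1 \<le> n" and \<sigma>: "\<sigma> \<in> space (config_measure n)" for n \<sigma>
  proof -
    define R where "R = sq_mean_spin n \<sigma>"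
    define t where "t = norm (cavity n {} \<sigma>)"
    define V where "V = dev n \<sigma>"
    define q where "q = 1 / real n"
    define w where "w = \<omega> n \<sigma>"
    have t: "t \<in> {0..1}" and tR: "t\<^sup>2 = R"
      using norm_cavity_le[OF \<sigma>] by (auto simp: t_def R_def sq_mean_spin_def)
    have VR: "V = R - s0\<^sup>2" and wR: "w = R + q" by (simp_all add: V_def dev_def R_def w_def \<omega>_def q_def)
    have q: "0 \<le> q" "q \<le> 1" using n by (auto simp: q_def)
    have R: "0 \<le> R" "R \<le> 1" using sq_mean_spin_bounds[OF \<sigma>] by (auto simp: R_def)
    have w: "0 \<le> w" using R q by (simp add: wR)
    define Y where "Y i = norm (cavity n {i} \<sigma>)" for i
    have Y: "Y i \<in> {0..1}" for i using norm_cavity_le[OF \<sigma>] by (auto simp: Y_def)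
    have sm: "spin_mean (cavity n {i} \<sigma>) = (Y i)\<^sup>2 * P (Y i)" for i
      by (simp add: spin_mean_def Y_def P_def mag_eq_slope power2_eq_square)
    define E where "E = (\<Sum>i = 1..n. (Y i)\<^sup>2 * (P (Y i) - P t)) / real n"
    have avg: "(\<Sum>i = 1..n. (Y i)\<^sup>2) / real n = (1 - 2 * q) * R + q\<^sup>2"
      using mean_cavity_norm[OF n \<sigma>] by (simp add: Y_def R_def q_def power_divide)
    have "(1 - 2 * q) * R + q\<^sup>2 \<le> w"
    proof -
      have "0 \<le> q * R" "q * q \<le> q * 1" using R q by (auto intro: mult_left_le)
      moreover have "(1 - 2 * q) * R + q\<^sup>2 = R - 2 * (q * R) + q * q"
        by (simp add: algebra_simps power2_eq_square)
      ultimately show ?thesis unfolding wR by linarith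
    qed
    then have avg_le: "(\<Sum>i = 1..n. (Y i)\<^sup>2) / real n \<le> w" unfolding avg .
    have E: "\<bar>E\<bar> \<le> L * q * w"
    proof -
      have "\<bar>E\<bar> \<le> (\<Sum>i = 1..n. (Y i)\<^sup>2 * (L * q)) / real n"
        unfolding E_def abs_divide
      proof (intro divide_mono order_trans[OF sum_abs] sum_mono)
        fix i assume i: "i \<in> {1..n}"
        have "\<bar>P (Y i) - P t\<bar> \<le> L * \<bar>Y i - t\<bar>" by (intro L Y t)
        also have "\<dots> \<le> L * q" using norm_cavity_close[OF \<sigma> i] by (intro mult_left_mono L) (simp add: Y_def t_def q_def)
        finally show "\<bar>(Y i)\<^sup>2 * (P (Y i) - P t)\<bar> \<le> (Y i)\<^sup>2 * (L * q)"
          by (simp add: abs_mult mult_left_mono)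
      qed (use n L q in \<open>auto intro!: sum_nonneg\<close>)
      also have "\<dots> = L * q * ((\<Sum>i = 1..n. (Y i)\<^sup>2) / real n)" by (simp add: sum_distrib_right[symmetric])
      also have "\<dots> \<le> L * q * w" using L q by (intro mult_left_mono avg_le) auto
      finally show ?thesis .
    qed
    have "(\<Sum>i = 1..n. spin_mean (cavity n {i} \<sigma>)) / real n = P t * ((\<Sum>i = 1..n. (Y i)\<^sup>2) / real n) + E"
    proof -
      have "(\<Sum>i = 1..n. spin_mean (cavity n {i} \<sigma>)) = (\<Sum>i = 1..n. P t * (Y i)\<^sup>2 + (Y i)\<^sup>2 * (P (Y i) - P t))"
        unfolding sm by (intro sum.cong) (auto simp: algebra_simps)
      then show ?thesis by (simp add: E_def sum.distrib sum_distrib_left add_divide_distrib)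
    qed
    then have drift: "drift n \<sigma> = (1 - P t) * R - q + (P t * (2 * q * R - q\<^sup>2) - E)"
      unfolding avg using drift_eq[OF n \<sigma>] by (simp add: R_def[symmetric] q_def[symmetric] algebra_simps)
    have "\<bar>P t * (2 * q * R - q\<^sup>2)\<bar> \<le> (1 + L) * (2 * q * w)"
      unfolding abs_mult
    proof (intro mult_mono P_bound t)
      have "0 \<le> q * (q + 4 * R)" "0 \<le> q * (3 * q)" using q R by auto
      then show "\<bar>2 * q * R - q\<^sup>2\<bar> \<le> 2 * q * w"
        unfolding wR by (simp add: abs_le_iff algebra_simps power2_eq_square)
    qed (use L in auto)
    then have rest: "\<bar>P t * (2 * q * R - q\<^sup>2) - E\<bar> \<le> (2 + 3 * L) * (q * w)"
      using E by (simp add: algebra_simps abs_le_iff)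
    have "V * drift n \<sigma> = (V * (1 - P t)) * R - V * q + V * (P t * (2 * q * R - q\<^sup>2) - E)"
      unfolding drift by (simp add: algebra_simps)
    moreover have "c * V\<^sup>2 * R \<le> (V * (1 - P t)) * R"
      using c(2)[of t] t R by (intro mult_right_mono) (auto simp: tR VR)
    moreover have "- (\<bar>V\<bar> * ((2 + 3 * L) * (q * w))) \<le> V * (P t * (2 * q * R - q\<^sup>2) - E)"
    proof -
      have "\<bar>V * (P t * (2 * q * R - q\<^sup>2) - E)\<bar> \<le> \<bar>V\<bar> * ((2 + 3 * L) * (q * w))"
        unfolding abs_mult by (intro mult_left_mono rest) auto
      then show ?thesis by linarith
    qed
    moreover have "?c * (V\<^sup>2 * w) - 1 / s0\<^sup>2 * (q * (\<bar>V\<bar> * w)) \<le> c * V\<^sup>2 * R - V * q"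
      unfolding VR wR using s0_sq by (intro restoring_weight c R q) auto
    ultimately have "?c * (V\<^sup>2 * w) - 1 / s0\<^sup>2 * (q * (\<bar>V\<bar> * w)) - \<bar>V\<bar> * ((2 + 3 * L) * (q * w)) \<le> V * drift n \<sigma>"
      by linarith
    moreover have "?K / real n * (\<bar>V\<bar> * w) = 1 / s0\<^sup>2 * (q * (\<bar>V\<bar> * w)) + \<bar>V\<bar> * ((2 + 3 * L) * (q * w))"
    proof -
      have "(d + e) / real n * (v * w) = d * (q * (v * w)) + v * (e * (q * w))" for d e v :: real
        by (simp add: q_def add_divide_distrib distrib_left distrib_right mult_ac)
      then show ?thesis .
    qed
    ultimately show ?thesis unfolding V_def[symmetric] w_def[symmetric] by linarith
  qed
  moreover have "?c > 0" "?K \<ge> 0" using c s0_sq L by auto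
  ultimately show ?thesis using that by blast
qed

lemma dev_power_\<omega>:
  assumes "1 \<le> n" "\<sigma> \<in> space (config_measure n)"
  shows "0 \<le> dev n \<sigma> ^ (2 * k) * \<omega> n \<sigma>" "\<bar>dev n \<sigma> ^ j * \<omega> n \<sigma>\<bar> \<le> 2"
proof -
  show "0 \<le> dev n \<sigma> ^ (2 * k) * \<omega> n \<sigma>" using \<omega>_bounds[OF assms] by (simp add: power_mult)
  have "\<bar>dev n \<sigma>\<bar> ^ j * \<bar>\<omega> n \<sigma>\<bar> \<le> 1 * 2"
    using \<omega>_bounds[OF assms] dev_abs_le_1[OF assms(2)] by (intro mult_mono power_le_one) auto
  then show "\<bar>dev n \<sigma> ^ j * \<omega> n \<sigma>\<bar> \<le> 2" by (simp add: abs_mult power_abs)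
qed

lemma integrable_dev_power_\<omega>: "1 \<le> n \<Longrightarrow> integrable (gibbs n) (\<lambda>\<sigma>. dev n \<sigma> ^ j * \<omega> n \<sigma>)"
  by (rule gibbs_integrable_bounded[of _ _ 2]) (use dev_power_\<omega> in auto)

lemma integrable_dev_power: "1 \<le> n \<Longrightarrow> integrable (gibbs n) (\<lambda>\<sigma>. dev n \<sigma> ^ j)"
  by (rule gibbs_integrable_bounded[of _ _ 1]) (auto simp: power_abs intro!: power_le_one dev_abs_le_1)

text \<open>
  The Stein identity for odd powers of the deviation: the restoring drift on the left has one
  power of the squared deviation more than the kernel term on the right, which carries the factor
  \<open>1 / n\<close>. The weight \<open>\<omega>\<close> occurs on both sides.
\<close>

lemma weighted_moment_step:
  "\<exists>C\<ge>0. \<forall>n\<ge>1. (\<integral>\<sigma>. dev n \<sigma> ^ (2 * Suc k) * \<omega> n \<sigma> \<partial>gibbs n)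
     \<le> C / real n * (\<integral>\<sigma>. dev n \<sigma> ^ (2 * k) * \<omega> n \<sigma> \<partial>gibbs n)"
proof -
  obtain c K where cK: "c > 0" "K \<ge> 0" "\<And>n \<sigma>. 1 \<le> n \<Longrightarrow> \<sigma> \<in> space (config_measure n) \<Longrightarrow>
    c * ((dev n \<sigma>)\<^sup>2 * \<omega> n \<sigma>) - K / real n * (\<bar>dev n \<sigma>\<bar> * \<omega> n \<sigma>) \<le> dev n \<sigma> * drift n \<sigma>"
    using drift_restoring by blast
  define M where "M = 4 * exp (2 * \<beta>)"
  define m where "m = real (2 * k + 1)"
  have M: "0 \<le> M" "0 \<le> m" by (auto simp: M_def m_def)
  let ?h = "\<lambda>u. (u - s0\<^sup>2) ^ (2 * k + 1)" and ?h' = "\<lambda>u. m * (u - s0\<^sup>2) ^ (2 * k)"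
  show ?thesis
  proof (intro exI[of _ "(K + 2 * m * M) / c"] conjI allI impI)
    show "0 \<le> (K + 2 * m * M) / c" using cK M by simp
    fix n :: nat assume n: "1 \<le> n"
    interpret prob_space "gibbs n" by (rule prob_space_gibbs[OF n])
    let ?a = "\<lambda>k. (\<integral>\<sigma>. dev n \<sigma> ^ (2 * k) * \<omega> n \<sigma> \<partial>gibbs n)"
    have id: "(\<integral>\<sigma>. ?h (sq_mean_spin n \<sigma>) * drift n \<sigma> \<partial>gibbs n)
        = 2 / real n * (\<integral>\<sigma>. ?h' (sq_mean_spin n \<sigma>) * mean_kern n \<sigma> \<partial>gibbs n)"
    proof (rule gibbs_stein_identity[OF n, of _ 0])
      show "(?h has_real_derivative ?h' u) (at u)" for u
        by (rule derivative_eq_intros refl)+ (simp add: m_def)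
      show "\<exists>C. \<forall>u. \<bar>u\<bar> \<le> K \<longrightarrow> \<bar>?h' u\<bar> \<le> C" for K
      proof -
        have "continuous_on {- K..K} ?h'" by (intro continuous_intros)
        then have "bounded (?h' ` {- K..K})" by (intro compact_imp_bounded compact_continuous_image) auto
        then obtain B where B: "\<And>u. u \<in> {- K..K} \<Longrightarrow> \<bar>?h' u\<bar> \<le> B"
          unfolding bounded_iff by (metis imageI real_norm_def)
        show ?thesis
        proof (intro exI[of _ B] allI impI)
          fix u :: real assume "\<bar>u\<bar> \<le> K"
          then show "\<bar>?h' u\<bar> \<le> B" by (intro B) (simp add: abs_le_iff)
        qed
      qed
    qed (auto intro!: continuous_intros)
    have i1: "integrable (gibbs n) (\<lambda>\<sigma>. ?h (sq_mean_spin n \<sigma>) * drift n \<sigma>)"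
    proof (rule gibbs_integrable_bounded[OF n, of _ 2])
      fix \<sigma> :: "nat \<Rightarrow> real ^ 'n" assume \<sigma>: "\<sigma> \<in> space (config_measure n)"
      have "\<bar>dev n \<sigma>\<bar> ^ (2 * k + 1) * \<bar>drift n \<sigma>\<bar> \<le> 1 * 2"
        by (intro mult_mono power_le_one dev_abs_le_1 drift_bound \<sigma>) auto
      then show "\<bar>?h (sq_mean_spin n \<sigma>) * drift n \<sigma>\<bar> \<le> 2" by (simp add: abs_mult power_abs dev_def)
    qed measurable
    have i2: "integrable (gibbs n) (\<lambda>\<sigma>. ?h' (sq_mean_spin n \<sigma>) * mean_kern n \<sigma>)"
    proof (rule gibbs_integrable_bounded[OF n, of _ "m * M"])
      fix \<sigma> :: "nat \<Rightarrow> real ^ 'n" assume \<sigma>: "\<sigma> \<in> space (config_measure n)"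
      have "m * \<bar>dev n \<sigma>\<bar> ^ (2 * k) * \<bar>mean_kern n \<sigma>\<bar> \<le> m * 1 * M"
        unfolding M_def by (intro mult_mono power_le_one dev_abs_le_1 mean_kern_bound' n \<sigma>) (auto simp: m_def)
      then show "\<bar>?h' (sq_mean_spin n \<sigma>) * mean_kern n \<sigma>\<bar> \<le> m * M"
        using M by (simp add: abs_mult power_abs dev_def)
    qed measurable
    have "c * ?a (Suc k) - K / real n * ?a k
        = (\<integral>\<sigma>. c * (dev n \<sigma> ^ (2 * Suc k) * \<omega> n \<sigma>) - K / real n * (dev n \<sigma> ^ (2 * k) * \<omega> n \<sigma>) \<partial>gibbs n)"
      by (subst Bochner_Integration.integral_diff) (auto intro!: integrable_mult_right integrable_dev_power_\<omega> n simp del: power_Suc mult_Suc_right)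
    also have "\<dots> \<le> (\<integral>\<sigma>. ?h (sq_mean_spin n \<sigma>) * drift n \<sigma> \<partial>gibbs n)"
    proof (rule integral_mono[OF _ i1])
      show "integrable (gibbs n) (\<lambda>\<sigma>. c * (dev n \<sigma> ^ (2 * Suc k) * \<omega> n \<sigma>) - K / real n * (dev n \<sigma> ^ (2 * k) * \<omega> n \<sigma>))"
        by (intro Bochner_Integration.integrable_diff integrable_mult_right integrable_dev_power_\<omega> n)
      fix \<sigma> assume "\<sigma> \<in> space (gibbs n)"
      then have \<sigma>: "\<sigma> \<in> space (config_measure n)" by (simp add: space_gibbs)
      let ?V = "dev n \<sigma>"
      have V0: "0 \<le> ?V ^ (2 * k)" by (simp add: power_mult)
      have "K / real n * (\<bar>?V\<bar> * \<omega> n \<sigma>) \<le> K / real n * (1 * \<omega> n \<sigma>)"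
        using cK \<omega>_bounds[OF n \<sigma>] dev_abs_le_1[OF \<sigma>] by (intro mult_left_mono mult_right_mono) auto
      then have "c * (?V\<^sup>2 * \<omega> n \<sigma>) - K / real n * \<omega> n \<sigma> \<le> ?V * drift n \<sigma>"
        using cK(3)[OF n \<sigma>] by simp
      from mult_left_mono[OF this V0]
      show "c * (?V ^ (2 * Suc k) * \<omega> n \<sigma>) - K / real n * (?V ^ (2 * k) * \<omega> n \<sigma>) \<le> ?h (sq_mean_spin n \<sigma>) * drift n \<sigma>"
        unfolding dev_def[symmetric] by (simp add: algebra_simps power2_eq_square)
    qed
    also have "\<dots> \<le> 2 / real n * (m * M * ?a k)"
      unfolding id
    proof (intro mult_left_mono)
      have "(\<integral>\<sigma>. ?h' (sq_mean_spin n \<sigma>) * mean_kern n \<sigma> \<partial>gibbs n)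
          \<le> (\<integral>\<sigma>. m * M * (dev n \<sigma> ^ (2 * k) * \<omega> n \<sigma>) \<partial>gibbs n)"
      proof (rule integral_mono[OF i2])
        show "integrable (gibbs n) (\<lambda>\<sigma>. m * M * (dev n \<sigma> ^ (2 * k) * \<omega> n \<sigma>))"
          by (intro integrable_mult_right integrable_dev_power_\<omega> n)
        fix \<sigma> assume "\<sigma> \<in> space (gibbs n)"
        then have \<sigma>: "\<sigma> \<in> space (config_measure n)" by (simp add: space_gibbs)
        have "mean_kern n \<sigma> \<le> M * \<omega> n \<sigma>"
          using mean_kern_bound[OF n \<sigma>] by (simp add: M_def \<omega>_def)
        then have "(m * dev n \<sigma> ^ (2 * k)) * mean_kern n \<sigma> \<le> (m * dev n \<sigma> ^ (2 * k)) * (M * \<omega> n \<sigma>)"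
          using M by (intro mult_left_mono) (auto simp: power_mult)
        then show "?h' (sq_mean_spin n \<sigma>) * mean_kern n \<sigma> \<le> m * M * (dev n \<sigma> ^ (2 * k) * \<omega> n \<sigma>)"
          by (simp add: dev_def[symmetric] mult_ac)
      qed
      then show "(\<integral>\<sigma>. ?h' (sq_mean_spin n \<sigma>) * mean_kern n \<sigma> \<partial>gibbs n) \<le> m * M * ?a k" by simp
    qed simp
    finally have "c * ?a (Suc k) \<le> (K + 2 * m * M) / real n * ?a k"
      by (simp add: add_divide_distrib distrib_right)
    then show "?a (Suc k) \<le> (K + 2 * m * M) / c / real n * ?a k"
      using cK(1) n by (simp add: field_simps)
  qed
qed

lemma weighted_moment_bound:
  "\<exists>C\<ge>0. \<forall>n\<ge>1. (\<integral>\<sigma>. dev n \<sigma> ^ (2 * k) * \<omega> n \<sigma> \<partial>gibbs n) \<le> C / real n ^ k"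
proof (induction k)
  case 0
  show ?case
  proof (intro exI[of _ 2] conjI allI impI)
    fix n :: nat assume n: "1 \<le> n"
    interpret prob_space "gibbs n" by (rule prob_space_gibbs[OF n])
    have "(\<integral>\<sigma>. dev n \<sigma> ^ (2 * 0) * \<omega> n \<sigma> \<partial>gibbs n) \<le> (\<integral>\<sigma>. 2 \<partial>gibbs n)"
      by (rule integral_mono[OF integrable_dev_power_\<omega>[OF n]]) (use \<omega>_bounds[OF n] space_gibbs in auto)
    then show "(\<integral>\<sigma>. dev n \<sigma> ^ (2 * 0) * \<omega> n \<sigma> \<partial>gibbs n) \<le> 2 / real n ^ 0" by (simp add: prob_space)
  qed simp
next
  case (Suc k)
  then obtain C where C: "C \<ge> 0" "\<And>n. n \<ge> 1 \<Longrightarrow> (\<integral>\<sigma>. dev n \<sigma> ^ (2 * k) * \<omega> n \<sigma> \<partial>gibbs n) \<le> C / real n ^ k"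
    by blast
  obtain D where D: "D \<ge> 0" "\<And>n. n \<ge> 1 \<Longrightarrow> (\<integral>\<sigma>. dev n \<sigma> ^ (2 * Suc k) * \<omega> n \<sigma> \<partial>gibbs n)
     \<le> D / real n * (\<integral>\<sigma>. dev n \<sigma> ^ (2 * k) * \<omega> n \<sigma> \<partial>gibbs n)"
    using weighted_moment_step by blast
  show ?case
  proof (intro exI[of _ "D * C"] conjI allI impI)
    fix n :: nat assume n: "1 \<le> n"
    have "D / real n * (\<integral>\<sigma>. dev n \<sigma> ^ (2 * k) * \<omega> n \<sigma> \<partial>gibbs n) \<le> D / real n * (C / real n ^ k)"
      using D by (intro mult_left_mono C n) auto
    with D(2)[OF n] show "(\<integral>\<sigma>. dev n \<sigma> ^ (2 * Suc k) * \<omega> n \<sigma> \<partial>gibbs n) \<le> D * C / real n ^ Suc k"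
      by simp
  qed (use C D in simp)
qed

text \<open>
  The weight is removed at the cost of one more moment: it is of order 1 unless the deviation is,
  and at least \<open>1 / n\<close> always.
\<close>

lemma moment_bound:
  "\<exists>C\<ge>0. \<forall>n\<ge>1. (\<integral>\<sigma>. dev n \<sigma> ^ (2 * k) \<partial>gibbs n) \<le> C / real n ^ k"
proof -
  obtain C where C: "C \<ge> 0" "\<And>n. n \<ge> 1 \<Longrightarrow> (\<integral>\<sigma>. dev n \<sigma> ^ (2 * k) * \<omega> n \<sigma> \<partial>gibbs n) \<le> C / real n ^ k"
    using weighted_moment_bound by blast
  obtain D where D: "D \<ge> 0" "\<And>n. n \<ge> 1 \<Longrightarrow> (\<integral>\<sigma>. dev n \<sigma> ^ (2 * Suc k) * \<omega> n \<sigma> \<partial>gibbs n) \<le> D / real n ^ Suc k"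
    using weighted_moment_bound by blast
  let ?r = "s0\<^sup>2 / 2"
  have r: "0 < ?r" using s0_sq by simp
  show ?thesis
  proof (intro exI[of _ "1 / ?r * C + 1 / ?r\<^sup>2 * D"] conjI allI impI)
    show "0 \<le> 1 / ?r * C + 1 / ?r\<^sup>2 * D" using C D r by simp
    fix n :: nat assume n: "1 \<le> n"
    interpret prob_space "gibbs n" by (rule prob_space_gibbs[OF n])
    have "(\<integral>\<sigma>. dev n \<sigma> ^ (2 * k) \<partial>gibbs n)
      \<le> (\<integral>\<sigma>. 1 / ?r * (dev n \<sigma> ^ (2 * k) * \<omega> n \<sigma>) + real n / ?r\<^sup>2 * (dev n \<sigma> ^ (2 * Suc k) * \<omega> n \<sigma>) \<partial>gibbs n)"
    proof (rule integral_mono[OF integrable_dev_power[OF n]])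
      show "integrable (gibbs n) (\<lambda>\<sigma>. 1 / ?r * (dev n \<sigma> ^ (2 * k) * \<omega> n \<sigma>) + real n / ?r\<^sup>2 * (dev n \<sigma> ^ (2 * Suc k) * \<omega> n \<sigma>))"
        by (intro Bochner_Integration.integrable_add integrable_mult_right integrable_dev_power_\<omega> n)
      fix \<sigma> assume "\<sigma> \<in> space (gibbs n)"
      then have \<sigma>: "\<sigma> \<in> space (config_measure n)" by (simp add: space_gibbs)
      let ?V = "dev n \<sigma>"
      note w = \<omega>_bounds[OF n \<sigma>]
      have "1 \<le> 1 / ?r * \<omega> n \<sigma> + real n / ?r\<^sup>2 * (?V\<^sup>2 * \<omega> n \<sigma>)"
      proof (cases "?r \<le> \<omega> n \<sigma>")
        case True
        then have "1 \<le> 1 / ?r * \<omega> n \<sigma>" using r by (simp add: field_simps)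
        moreover have "0 \<le> real n / ?r\<^sup>2 * (?V\<^sup>2 * \<omega> n \<sigma>)" using w by simp
        ultimately show ?thesis by linarith
      next
        case False
        have "sq_mean_spin n \<sigma> \<le> \<omega> n \<sigma>" by (simp add: \<omega>_def)
        then have "?r \<le> - ?V" using False by (simp add: dev_def)
        then have "?r\<^sup>2 \<le> (- ?V)\<^sup>2" using r by (intro power_mono) auto
        then have "1 \<le> ?V\<^sup>2 / ?r\<^sup>2" using r by simp
        also have "\<dots> \<le> real n * \<omega> n \<sigma> * (?V\<^sup>2 / ?r\<^sup>2)"
        proof -
          have "1 \<le> real n * \<omega> n \<sigma>" using w(1) n by (simp add: field_simps)
          from mult_right_mono[OF this, of "?V\<^sup>2 / ?r\<^sup>2"] show ?thesis by simp
        qed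
        finally have "1 \<le> real n / ?r\<^sup>2 * (?V\<^sup>2 * \<omega> n \<sigma>)" by (simp add: mult_ac)
        moreover have "0 \<le> 1 / ?r * \<omega> n \<sigma>" using w r by simp
        ultimately show ?thesis by linarith
      qed
      then have "?V ^ (2 * k) * 1 \<le> ?V ^ (2 * k) * (1 / ?r * \<omega> n \<sigma> + real n / ?r\<^sup>2 * (?V\<^sup>2 * \<omega> n \<sigma>))"
        by (intro mult_left_mono) (auto simp: power_mult)
      then show "?V ^ (2 * k) \<le> 1 / ?r * (?V ^ (2 * k) * \<omega> n \<sigma>) + real n / ?r\<^sup>2 * (?V ^ (2 * Suc k) * \<omega> n \<sigma>)"
        by (simp add: algebra_simps power2_eq_square)
    qed
    also have "\<dots> = 1 / ?r * (\<integral>\<sigma>. dev n \<sigma> ^ (2 * k) * \<omega> n \<sigma> \<partial>gibbs n)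
        + real n / ?r\<^sup>2 * (\<integral>\<sigma>. dev n \<sigma> ^ (2 * Suc k) * \<omega> n \<sigma> \<partial>gibbs n)"
      by (subst Bochner_Integration.integral_add) (auto intro!: integrable_mult_right integrable_dev_power_\<omega> n simp del: power_Suc mult_Suc_right)
    also have "\<dots> \<le> 1 / ?r * (C / real n ^ k) + real n / ?r\<^sup>2 * (D / real n ^ Suc k)"
      using r by (intro add_mono mult_left_mono C D n) auto
    also have "\<dots> = (1 / ?r * C + 1 / ?r\<^sup>2 * D) / real n ^ k"
      using n by (simp add: add_divide_distrib)
    finally show "(\<integral>\<sigma>. dev n \<sigma> ^ (2 * k) \<partial>gibbs n) \<le> (1 / ?r * C + 1 / ?r\<^sup>2 * D) / real n ^ k" .
  qed
qed

section \<open>Concentration of the mean kernel\<close>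

definition kern_dev :: "nat \<Rightarrow> nat set \<Rightarrow> nat \<Rightarrow> (nat \<Rightarrow> real ^ 'n) \<Rightarrow> real" where
  "kern_dev n A i \<sigma> = spin_kern (cavity n A \<sigma>) (\<sigma> i) - spin_var (cavity n A \<sigma>)"

lemma measurable_kern_dev [measurable]: "i \<in> {1..n} \<Longrightarrow> kern_dev n A i \<in> borel_measurable (config_measure n)"
  unfolding kern_dev_def[abs_def] by measurable

lemma spin_var_bounds: "norm y \<le> 1 \<Longrightarrow> \<bar>spin_var y\<bar> \<le> 1"
  using mag'_nonneg[of "\<beta> * norm y"] mag'_le_1[of "\<beta> * norm y"]
  by (auto simp: spin_var_def abs_mult intro!: mult_le_one power_le_one)

lemma kern_dev_bound:
  assumes "\<sigma> \<in> space (config_measure n)"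
  shows "\<bar>kern_dev n A i \<sigma>\<bar> \<le> 4 * exp (2 * \<beta>) + 1"
  using spin_kern_cavity_bound[OF assms, of A "\<sigma> i"] spin_var_bounds[OF norm_cavity_le[OF assms, of A]]
  unfolding kern_dev_def by linarith

lemma kern_dev_change:
  obtains C where "C \<ge> 0" "\<And>n \<sigma> i j A. \<sigma> \<in> space (config_measure n) \<Longrightarrow> i \<in> {1..n} \<Longrightarrow> j \<in> {1..n} \<Longrightarrow> i \<notin> A \<Longrightarrow>
    \<bar>kern_dev n A j \<sigma> - kern_dev n (insert i A) j \<sigma>\<bar> \<le> C / real n"
proof -
  obtain C where C: "C \<ge> 0" "\<And>y z s. norm y \<le> 1 \<Longrightarrow> norm z \<le> 1 \<Longrightarrow> norm s = 1 \<Longrightarrow>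
    \<bar>spin_kern y s - spin_kern z s\<bar> \<le> C * norm (y - z)"
    using spin_kern_lipschitz by blast
  define D where "D = 2 + 2 * (1 + \<beta>) + (1 + \<beta>)"
  have D0: "0 \<le> D" using \<beta>_pos by (simp add: D_def)
  have "\<bar>kern_dev n A j \<sigma> - kern_dev n (insert i A) j \<sigma>\<bar> \<le> (C + D) / real n"
    if \<sigma>: "\<sigma> \<in> space (config_measure n)" and ij: "i \<in> {1..n}" "j \<in> {1..n}" "i \<notin> A" for n \<sigma> i j A
  proof -
    let ?y = "cavity n A \<sigma>" and ?z = "cavity n (insert i A) \<sigma>"
    have nd: "norm (?y - ?z) = 1 / real n" by (rule norm_cavity_diff[OF \<sigma> ij(1,3)])
    have "\<bar>spin_kern ?y (\<sigma> j) - spin_kern ?z (\<sigma> j)\<bar> \<le> C * norm (?y - ?z)"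
      by (intro C norm_cavity_le \<sigma> norm_spin[OF \<sigma> ij(2)])
    moreover have "\<bar>spin_var ?y - spin_var ?z\<bar> \<le> D * \<bar>norm ?y - norm ?z\<bar>"
      unfolding D_def by (intro spin_var_lipschitz norm_cavity_le \<sigma>)
    moreover have "D * \<bar>norm ?y - norm ?z\<bar> \<le> D * norm (?y - ?z)"
      by (intro mult_left_mono D0 norm_triangle_ineq3)
    ultimately show ?thesis unfolding kern_dev_def nd by (simp add: add_divide_distrib)
  qed
  then show ?thesis using that[of "C + D"] C D0 by simp
qed

text \<open>
  Given the other spins, \<open>kern_dev n {i} i\<close> has mean zero, and the other factor depends on the spin \<open>i\<close>
  only through the cavity field of \<open>j\<close>. Removing the spin \<open>i\<close> from that field costs an error of order
  \<open>1 / n\<close> and makes the mean of the product vanish.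
\<close>

lemma kern_dev_covariance:
  "\<exists>C\<ge>0. \<forall>n i j. i \<in> {1..n} \<longrightarrow> j \<in> {1..n} \<longrightarrow> i \<noteq> j \<longrightarrow>
    (\<integral>\<sigma>. kern_dev n {i} i \<sigma> * kern_dev n {j} j \<sigma> \<partial>gibbs n) \<le> C / real n"
proof -
  obtain C where C: "C \<ge> 0" "\<And>n \<sigma> i j A. \<sigma> \<in> space (config_measure n) \<Longrightarrow> i \<in> {1..n} \<Longrightarrow> j \<in> {1..n} \<Longrightarrow> i \<notin> A \<Longrightarrow>
    \<bar>kern_dev n A j \<sigma> - kern_dev n (insert i A) j \<sigma>\<bar> \<le> C / real n"
    using kern_dev_change by blast
  define M where "M = 4 * exp (2 * \<beta>) + 1"
  have M: "0 \<le> M" by (simp add: M_def add_nonneg_nonneg)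
  show ?thesis
  proof (intro exI[of _ "M * C"] conjI allI impI)
    show "0 \<le> M * C" using M C by simp
    fix n i j :: nat assume i: "i \<in> {1..n}" and j: "j \<in> {1..n}" and ij: "i \<noteq> j"
    have n: "1 \<le> n" using i by simp
    interpret prob_space "gibbs n" by (rule prob_space_gibbs[OF n])
    have b: "\<bar>kern_dev n A l \<sigma> * kern_dev n B m \<sigma>\<bar> \<le> M * M" if "\<sigma> \<in> space (config_measure n)" for A B l m \<sigma>
      unfolding abs_mult M_def using that by (intro mult_mono kern_dev_bound) auto
    have int: "integrable (gibbs n) (\<lambda>\<sigma>. kern_dev n A i \<sigma> * kern_dev n B j \<sigma>)" for A B
      using i j by (intro gibbs_integrable_bounded[OF n _ b]) measurable
    have zero: "(\<integral>\<sigma>. kern_dev n {i} i \<sigma> * kern_dev n {i, j} j \<sigma> \<partial>gibbs n) = 0"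
    proof (rule gibbs_conditional_mean_zero[OF i _ b])
      show "(\<lambda>\<sigma>. kern_dev n {i} i \<sigma> * kern_dev n {i, j} j \<sigma>) \<in> borel_measurable (config_measure n)"
        using i j by measurable
      fix \<sigma> :: "nat \<Rightarrow> real ^ 'n"
      let ?y = "cavity n {i} \<sigma>"
      have "(\<integral>s. (if norm s = 1 then kern_dev n {i} i (\<sigma>(i := s)) * kern_dev n {i, j} j (\<sigma>(i := s)) else 0)
            * exp (\<beta> * (?y \<bullet> s)) \<partial>uniform_sphere)
          = (\<integral>s. kern_dev n {i, j} j \<sigma> * ((spin_kern ?y s - spin_var ?y) * exp (\<beta> * (?y \<bullet> s))) \<partial>uniform_sphere)"
        using ij by (intro Bochner_Integration.integral_cong refl) (auto simp: kern_dev_def cavity_upd)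
      also have "\<dots> = 0" using one_spin_kern_mean[of ?y] by simp
      finally show "(\<integral>s. (if norm s = 1 then kern_dev n {i} i (\<sigma>(i := s)) * kern_dev n {i, j} j (\<sigma>(i := s)) else 0)
            * exp (\<beta> * (?y \<bullet> s)) \<partial>uniform_sphere) = 0" .
    qed
    have "(\<integral>\<sigma>. kern_dev n {i} i \<sigma> * kern_dev n {j} j \<sigma> \<partial>gibbs n)
        = (\<integral>\<sigma>. kern_dev n {i} i \<sigma> * kern_dev n {j} j \<sigma> - kern_dev n {i} i \<sigma> * kern_dev n {i, j} j \<sigma> \<partial>gibbs n)"
      by (subst Bochner_Integration.integral_diff[OF int int]) (simp add: zero)
    also have "\<dots> \<le> (\<integral>\<sigma>. M * (C / real n) \<partial>gibbs n)"
    proof (rule integral_mono)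
      show "integrable (gibbs n) (\<lambda>\<sigma>. kern_dev n {i} i \<sigma> * kern_dev n {j} j \<sigma> - kern_dev n {i} i \<sigma> * kern_dev n {i, j} j \<sigma>)"
        by (intro Bochner_Integration.integrable_diff int)
      fix \<sigma> assume "\<sigma> \<in> space (gibbs n)"
      then have \<sigma>: "\<sigma> \<in> space (config_measure n)" by (simp add: space_gibbs)
      have "\<bar>kern_dev n {i} i \<sigma> * (kern_dev n {j} j \<sigma> - kern_dev n {i, j} j \<sigma>)\<bar> \<le> M * (C / real n)"
        unfolding abs_mult M_def using C(2)[OF \<sigma> i j, of "{j}"] ij
        by (intro mult_mono kern_dev_bound \<sigma>) (auto simp: add_nonneg_nonneg)
      then show "kern_dev n {i} i \<sigma> * kern_dev n {j} j \<sigma> - kern_dev n {i} i \<sigma> * kern_dev n {i, j} j \<sigma> \<le> M * (C / real n)"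
        by (simp add: right_diff_distrib)
    qed simp
    finally show "(\<integral>\<sigma>. kern_dev n {i} i \<sigma> * kern_dev n {j} j \<sigma> \<partial>gibbs n) \<le> M * C / real n"
      by (simp add: prob_space)
  qed
qed

lemma mean_kern_dev_second_moment:
  "\<exists>C\<ge>0. \<forall>n\<ge>1. (\<integral>\<sigma>. ((\<Sum>i = 1..n. kern_dev n {i} i \<sigma>) / real n)\<^sup>2 \<partial>gibbs n) \<le> C / real n"
proof -
  obtain C where C: "C \<ge> 0" "\<And>n i j. i \<in> {1..n} \<Longrightarrow> j \<in> {1..n} \<Longrightarrow> i \<noteq> j \<Longrightarrow>
    (\<integral>\<sigma>. kern_dev n {i} i \<sigma> * kern_dev n {j} j \<sigma> \<partial>gibbs n) \<le> C / real n"
    using kern_dev_covariance by blast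
  define M where "M = 4 * exp (2 * \<beta>) + 1"
  show ?thesis
  proof (intro exI[of _ "M\<^sup>2 + C"] conjI allI impI)
    show "0 \<le> M\<^sup>2 + C" using C by simp
    fix n :: nat assume n: "1 \<le> n"
    interpret prob_space "gibbs n" by (rule prob_space_gibbs[OF n])
    let ?\<xi> = "\<lambda>i. kern_dev n {i} i"
    have b: "\<bar>?\<xi> i \<sigma> * ?\<xi> j \<sigma>\<bar> \<le> M * M" if "\<sigma> \<in> space (config_measure n)" for i j \<sigma>
      unfolding abs_mult M_def using that by (intro mult_mono kern_dev_bound) auto
    have int: "integrable (gibbs n) (\<lambda>\<sigma>. ?\<xi> i \<sigma> * ?\<xi> j \<sigma>)" if "i \<in> {1..n}" "j \<in> {1..n}" for i j
      using that by (intro gibbs_integrable_bounded[OF n _ b]) measurable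
    have cov: "(\<integral>\<sigma>. ?\<xi> i \<sigma> * ?\<xi> j \<sigma> \<partial>gibbs n) \<le> (if i = j then M\<^sup>2 else 0) + C / real n"
      if ij: "i \<in> {1..n}" "j \<in> {1..n}" for i j
    proof (cases "i = j")
      case True
      have "(\<integral>\<sigma>. ?\<xi> i \<sigma> * ?\<xi> j \<sigma> \<partial>gibbs n) \<le> (\<integral>\<sigma>. M * M \<partial>gibbs n)"
      proof (rule integral_mono[OF int[OF ij]])
        show "?\<xi> i \<sigma> * ?\<xi> j \<sigma> \<le> M * M" if "\<sigma> \<in> space (gibbs n)" for \<sigma>
          using b[of \<sigma> i j] that by (simp add: space_gibbs)
      qed simp
      then have "(\<integral>\<sigma>. ?\<xi> i \<sigma> * ?\<xi> j \<sigma> \<partial>gibbs n) \<le> M\<^sup>2" by (simp add: prob_space power2_eq_square)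
      moreover have "0 \<le> C / real n" using C by simp
      ultimately show ?thesis using True by simp
    qed (use C(2)[OF ij] in simp)
    have "(\<integral>\<sigma>. ((\<Sum>i = 1..n. ?\<xi> i \<sigma>) / real n)\<^sup>2 \<partial>gibbs n)
        = (\<integral>\<sigma>. (\<Sum>i = 1..n. \<Sum>j = 1..n. ?\<xi> i \<sigma> * ?\<xi> j \<sigma>) / (real n)\<^sup>2 \<partial>gibbs n)"
      by (simp only: power_divide) (simp add: power2_eq_square sum_product)
    also have "\<dots> = (\<Sum>i = 1..n. \<Sum>j = 1..n. (\<integral>\<sigma>. ?\<xi> i \<sigma> * ?\<xi> j \<sigma> \<partial>gibbs n)) / (real n)\<^sup>2"
      unfolding integral_divide_zero
      by (subst Bochner_Integration.integral_sum) (auto intro!: int Bochner_Integration.integrable_sum sum.cong Bochner_Integration.integral_sum)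
    also have "\<dots> \<le> (\<Sum>i = 1..n. \<Sum>j = 1..n. (if i = j then M\<^sup>2 else 0) + C / real n) / (real n)\<^sup>2"
      by (intro divide_right_mono sum_mono cov) auto
    also have "(\<Sum>i = 1..n. \<Sum>j = 1..n. (if i = j then M\<^sup>2 else 0) + C / real n) = real n * M\<^sup>2 + real n * C"
      using n by (simp add: sum.distrib distrib_left)
    also have "(real n * M\<^sup>2 + real n * C) / (real n)\<^sup>2 = (M\<^sup>2 + C) / real n"
      using n by (simp add: field_simps power2_eq_square)
    finally show "(\<integral>\<sigma>. ((\<Sum>i = 1..n. ?\<xi> i \<sigma>) / real n)\<^sup>2 \<partial>gibbs n) \<le> (M\<^sup>2 + C) / real n" .
  qed
qed

text \<open>The conditional variance of \<open>y \<bullet> s\<close> at the limiting length \<open>s0\<close> of the field \<open>y\<close>.\<close>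

definition v0 :: real where "v0 = s0\<^sup>2 * mag' b"

lemma v0_pos: "0 < v0"
  using s0_sq mag'_pos[of b] by (simp add: v0_def)

lemma spin_var_close:
  "\<exists>C\<ge>0. \<forall>n \<sigma>. 1 \<le> n \<longrightarrow> \<sigma> \<in> space (config_measure n) \<longrightarrow>
    \<bar>(\<Sum>i = 1..n. spin_var (cavity n {i} \<sigma>)) / real n - v0\<bar> \<le> C * (1 / real n + \<bar>dev n \<sigma>\<bar>)"
proof -
  define D where "D = 2 + 2 * (1 + \<beta>) + (1 + \<beta>)"
  have D0: "0 \<le> D" using \<beta>_pos by (simp add: D_def)
  obtain i0 :: 'n where True by simp
  define y0 :: "real ^ 'n" where "y0 = s0 *\<^sub>R axis i0 1"
  have y0: "norm y0 = s0" using s0_pos by (simp add: y0_def norm_axis_1)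
  have v0: "spin_var y0 = v0" using \<beta>_pos by (simp add: spin_var_def y0 v0_def s0_def)
  let ?C = "D * (1 + 1 / s0)"
  have "\<bar>(\<Sum>i = 1..n. spin_var (cavity n {i} \<sigma>)) / real n - v0\<bar> \<le> ?C * (1 / real n + \<bar>dev n \<sigma>\<bar>)"
    if n: "1 \<le> n" and \<sigma>: "\<sigma> \<in> space (config_measure n)" for n \<sigma>
  proof -
    let ?t = "norm (cavity n {} \<sigma>)"
    have "(?t - s0) * (?t + s0) = dev n \<sigma>" by (simp add: dev_def sq_mean_spin_def power2_eq_square algebra_simps)
    then have "\<bar>?t - s0\<bar> * (?t + s0) = \<bar>dev n \<sigma>\<bar>" using s0_pos by (metis abs_mult abs_of_nonneg add_nonneg_nonneg less_imp_le norm_ge_zero)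
    moreover have "\<bar>?t - s0\<bar> * s0 \<le> \<bar>?t - s0\<bar> * (?t + s0)" by (intro mult_left_mono) auto
    ultimately have ts: "\<bar>?t - s0\<bar> \<le> \<bar>dev n \<sigma>\<bar> / s0" using s0_pos by (simp add: field_simps)
    have "\<bar>spin_var (cavity n {i} \<sigma>) - v0\<bar> \<le> ?C * (1 / real n + \<bar>dev n \<sigma>\<bar>)" if i: "i \<in> {1..n}" for i
    proof -
      have "\<bar>spin_var (cavity n {i} \<sigma>) - v0\<bar> \<le> D * \<bar>norm (cavity n {i} \<sigma>) - s0\<bar>"
        unfolding v0[symmetric] D_def y0[symmetric]
        by (intro spin_var_lipschitz norm_cavity_le \<sigma>) (use y0 s0_less_1 in simp)
      also have "\<dots> \<le> D * (1 / real n + \<bar>dev n \<sigma>\<bar> / s0)"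
        using norm_cavity_close[OF \<sigma> i] ts by (intro mult_left_mono D0) linarith
      also have "\<dots> \<le> D * ((1 + 1 / s0) * (1 / real n + \<bar>dev n \<sigma>\<bar>))"
      proof (intro mult_left_mono D0)
        have "(1 + 1 / s0) * (1 / real n + d) = (1 / real n + d / s0) + (d + 1 / s0 * (1 / real n))" for d
          by (simp add: algebra_simps add_divide_distrib)
        moreover have "0 \<le> \<bar>dev n \<sigma>\<bar> + 1 / s0 * (1 / real n)" using s0_pos by simp
        ultimately show "1 / real n + \<bar>dev n \<sigma>\<bar> / s0 \<le> (1 + 1 / s0) * (1 / real n + \<bar>dev n \<sigma>\<bar>)"
          by simp
      qed
      finally show ?thesis by (simp add: mult.assoc)
    qed
    then have "\<bar>(\<Sum>i = 1..n. spin_var (cavity n {i} \<sigma>) - v0) / real n\<bar> \<le> ?C * (1 / real n + \<bar>dev n \<sigma>\<bar>)"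
      by (intro mean_abs_le) (use D0 s0_pos in auto)
    then show ?thesis using n by (simp add: sum_subtractf diff_divide_distrib)
  qed
  moreover have "0 \<le> ?C" using D0 s0_pos by simp
  ultimately show ?thesis by blast
qed

lemma mean_kern_concentration:
  "\<exists>C\<ge>0. \<forall>n\<ge>1. (\<integral>\<sigma>. (mean_kern n \<sigma> - v0)\<^sup>2 \<partial>gibbs n) \<le> C / real n"
proof -
  obtain C where C: "C \<ge> 0" "\<And>n. 1 \<le> n \<Longrightarrow> (\<integral>\<sigma>. ((\<Sum>i = 1..n. kern_dev n {i} i \<sigma>) / real n)\<^sup>2 \<partial>gibbs n) \<le> C / real n"
    using mean_kern_dev_second_moment by blast
  obtain D where D: "D \<ge> 0" "\<And>n \<sigma>. 1 \<le> n \<Longrightarrow> \<sigma> \<in> space (config_measure n) \<Longrightarrow>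
    \<bar>(\<Sum>i = 1..n. spin_var (cavity n {i} \<sigma>)) / real n - v0\<bar> \<le> D * (1 / real n + \<bar>dev n \<sigma>\<bar>)"
    using spin_var_close by blast
  obtain E where E: "E \<ge> 0" "\<And>n. 1 \<le> n \<Longrightarrow> (\<integral>\<sigma>. dev n \<sigma> ^ (2 * 1) \<partial>gibbs n) \<le> E / real n ^ 1"
    using moment_bound by blast
  show ?thesis
  proof (intro exI[of _ "2 * C + 4 * D\<^sup>2 + 4 * D\<^sup>2 * E"] conjI allI impI)
    show "0 \<le> 2 * C + 4 * D\<^sup>2 + 4 * D\<^sup>2 * E" using C E by simp
    fix n :: nat assume n: "1 \<le> n"
    interpret prob_space "gibbs n" by (rule prob_space_gibbs[OF n])
    let ?X = "\<lambda>\<sigma>. (\<Sum>i = 1..n. kern_dev n {i} i \<sigma>) / real n"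
    have iX: "integrable (gibbs n) (\<lambda>\<sigma>. (?X \<sigma>)\<^sup>2)"
    proof (rule gibbs_integrable_bounded[OF n, of _ "(4 * exp (2 * \<beta>) + 1)\<^sup>2"])
      fix \<sigma> :: "nat \<Rightarrow> real ^ 'n" assume \<sigma>: "\<sigma> \<in> space (config_measure n)"
      have "\<bar>?X \<sigma>\<bar> \<le> 4 * exp (2 * \<beta>) + 1" by (intro mean_abs_le kern_dev_bound \<sigma>) (simp add: add_nonneg_nonneg)
      then have "\<bar>?X \<sigma>\<bar>\<^sup>2 \<le> (4 * exp (2 * \<beta>) + 1)\<^sup>2" by (intro power_mono) auto
      then show "\<bar>(?X \<sigma>)\<^sup>2\<bar> \<le> (4 * exp (2 * \<beta>) + 1)\<^sup>2" by (simp only: power2_abs abs_power2)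
    qed measurable
    have iV: "integrable (gibbs n) (\<lambda>\<sigma>. (dev n \<sigma>)\<^sup>2)" by (rule integrable_dev_power[OF n])
    have "(\<integral>\<sigma>. (mean_kern n \<sigma> - v0)\<^sup>2 \<partial>gibbs n)
        \<le> (\<integral>\<sigma>. 2 * (?X \<sigma>)\<^sup>2 + (4 * D\<^sup>2 / (real n)\<^sup>2 + 4 * D\<^sup>2 * (dev n \<sigma>)\<^sup>2) \<partial>gibbs n)"
    proof (rule integral_mono)
      show "integrable (gibbs n) (\<lambda>\<sigma>. (mean_kern n \<sigma> - v0)\<^sup>2)"
      proof (rule gibbs_integrable_bounded[OF n, of _ "(4 * exp (2 * \<beta>) + \<bar>v0\<bar>)\<^sup>2"])
        fix \<sigma> :: "nat \<Rightarrow> real ^ 'n" assume \<sigma>: "\<sigma> \<in> space (config_measure n)"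
        have "\<bar>mean_kern n \<sigma> - v0\<bar> \<le> 4 * exp (2 * \<beta>) + \<bar>v0\<bar>"
          using mean_kern_bound'[OF n \<sigma>] by linarith
        then have "\<bar>mean_kern n \<sigma> - v0\<bar>\<^sup>2 \<le> (4 * exp (2 * \<beta>) + \<bar>v0\<bar>)\<^sup>2" by (intro power_mono) auto
        then show "\<bar>(mean_kern n \<sigma> - v0)\<^sup>2\<bar> \<le> (4 * exp (2 * \<beta>) + \<bar>v0\<bar>)\<^sup>2" by simp
      qed measurable
      show "integrable (gibbs n) (\<lambda>\<sigma>. 2 * (?X \<sigma>)\<^sup>2 + (4 * D\<^sup>2 / (real n)\<^sup>2 + 4 * D\<^sup>2 * (dev n \<sigma>)\<^sup>2))"
        by (intro Bochner_Integration.integrable_add integrable_mult_right iX iV integrable_const)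
      fix \<sigma> assume "\<sigma> \<in> space (gibbs n)"
      then have \<sigma>: "\<sigma> \<in> space (config_measure n)" by (simp add: space_gibbs)
      let ?e = "(\<Sum>i = 1..n. spin_var (cavity n {i} \<sigma>)) / real n - v0"
      have eq: "mean_kern n \<sigma> - v0 = ?X \<sigma> + ?e"
        by (simp add: mean_kern_def kern_dev_def sum_subtractf diff_divide_distrib)
      have sq2: "(u + v)\<^sup>2 \<le> 2 * u\<^sup>2 + 2 * v\<^sup>2" for u v :: real
        using zero_le_power2[of "u - v"] by (simp add: power2_eq_square algebra_simps)
      have "?e\<^sup>2 \<le> (D * (1 / real n + \<bar>dev n \<sigma>\<bar>))\<^sup>2"
        using power_mono[OF D(2)[OF n \<sigma>], of 2] by simp
      also have "\<dots> = D\<^sup>2 * (1 / real n + \<bar>dev n \<sigma>\<bar>)\<^sup>2" by (simp add: power_mult_distrib)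
      also have "\<dots> \<le> D\<^sup>2 * (2 * (1 / real n)\<^sup>2 + 2 * \<bar>dev n \<sigma>\<bar>\<^sup>2)" by (intro mult_left_mono sq2) simp
      finally have e: "?e\<^sup>2 \<le> D\<^sup>2 * (2 * (1 / real n)\<^sup>2 + 2 * \<bar>dev n \<sigma>\<bar>\<^sup>2)" .
      show "(mean_kern n \<sigma> - v0)\<^sup>2 \<le> 2 * (?X \<sigma>)\<^sup>2 + (4 * D\<^sup>2 / (real n)\<^sup>2 + 4 * D\<^sup>2 * (dev n \<sigma>)\<^sup>2)"
        unfolding eq using sq2[of "?X \<sigma>" ?e] e by (simp add: power_divide distrib_left)
    qed
    also have "\<dots> = 2 * (\<integral>\<sigma>. (?X \<sigma>)\<^sup>2 \<partial>gibbs n) + (4 * D\<^sup>2 / (real n)\<^sup>2 + 4 * D\<^sup>2 * (\<integral>\<sigma>. (dev n \<sigma>)\<^sup>2 \<partial>gibbs n))"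
      using iX iV by (simp add: prob_space Bochner_Integration.integral_add Bochner_Integration.integrable_add)
    also have "\<dots> \<le> 2 * (C / real n) + (4 * D\<^sup>2 / real n + 4 * D\<^sup>2 * (E / real n))"
    proof (intro add_mono mult_left_mono)
      show "4 * D\<^sup>2 / (real n)\<^sup>2 \<le> 4 * D\<^sup>2 / real n"
        using n by (intro divide_left_mono) (auto simp: power2_eq_square)
    qed (use C(2)[OF n] E(2)[OF n] in auto)
    also have "\<dots> = (2 * C + 4 * D\<^sup>2 + 4 * D\<^sup>2 * E) / real n" by (simp add: add_divide_distrib)
    finally show "(\<integral>\<sigma>. (mean_kern n \<sigma> - v0)\<^sup>2 \<partial>gibbs n) \<le> (2 * C + 4 * D\<^sup>2 + 4 * D\<^sup>2 * E) / real n" .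
  qed
qed

end

section \<open>The Stein equation of the normal law\<close>

abbreviation \<Phi> :: "real \<Rightarrow> real" where
  "\<Phi> \<equiv> cdf std_normal_distribution"

abbreviation gauss :: "real \<Rightarrow> real" where
  "gauss \<equiv> std_normal_density"

interpretation std_normal: real_distribution std_normal_distribution
  by (rule real_dist_normal_dist)

lemma gauss_pos: "0 < gauss x"
  by (simp add: std_normal_density_def)

lemma gauss_le_1: "gauss x \<le> 1"
proof -
  have "1 \<le> sqrt (2 * pi)" using pi_gt3 by (simp add: real_le_rsqrt)
  then have "1 / sqrt (2 * pi) \<le> 1" by simp
  then have "1 / sqrt (2 * pi) * exp (- x\<^sup>2 / 2) \<le> 1 * 1" by (intro mult_mono) auto
  then show ?thesis by (simp add: std_normal_density_def)
qed

lemma gauss_minus [simp]: "gauss (- x) = gauss x"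
  by (simp add: std_normal_density_def)

lemma gauss_deriv: "(gauss has_real_derivative - x * gauss x) (at x)"
  unfolding std_normal_density_def by (rule derivative_eq_intros refl | simp)+

lemma continuous_gauss: "continuous_on S gauss"
  unfolding std_normal_density_def by (intro continuous_intros) auto

lemma gauss_ratio: "gauss x / gauss y = exp ((y\<^sup>2 - x\<^sup>2) / 2)"
  by (simp add: std_normal_density_def diff_divide_distrib exp_diff[symmetric])

lemma \<Phi>_diff:
  assumes "a < x"
  shows "\<Phi> x - \<Phi> a = integral {a..x} gauss"
proof -
  have "\<Phi> x - \<Phi> a = measure std_normal_distribution {a<..x}"
    by (rule std_normal.cdf_diff_eq[OF assms])
  also have "\<dots> = (\<integral>t. indicator {a<..x} t \<partial>std_normal_distribution)" by simp
  also have "\<dots> = (LINT t:{a<..x}|lborel. gauss t)"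
    unfolding set_lebesgue_integral_def by (subst integral_density) (auto simp: mult.commute)
  also have "\<dots> = integral {a<..x} gauss"
    by (intro set_borel_integral_eq_integral set_integrable_subset[OF borel_integrable_atLeastAtMost'[OF continuous_gauss[of "{a..x}"]]])
      auto
  also have "\<dots> = integral {a..x} gauss"
  proof (rule integral_spike_set)
    have "{t \<in> {a<..x} - {a..x}. gauss t \<noteq> 0} = {}" by auto
    then show "negligible {t \<in> {a<..x} - {a..x}. gauss t \<noteq> 0}" by (simp only: negligible_empty)
    show "negligible {t \<in> {a..x} - {a<..x}. gauss t \<noteq> 0}"
      by (rule negligible_subset[OF negligible_sing[of a]]) auto
  qed
  finally show ?thesis .
qed

lemma \<Phi>_deriv: "(\<Phi> has_real_derivative gauss x) (at x)"
proof -
  have "((\<lambda>y. integral {x - 1..y} gauss) has_real_derivative gauss x) (at x within {x - 1..x + 1})"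
    by (rule integral_has_real_derivative[OF continuous_gauss]) auto
  then have "((\<lambda>y. integral {x - 1..y} gauss) has_real_derivative gauss x) (at x)"
    by (simp add: at_within_Icc_at)
  then have "((\<lambda>y. \<Phi> (x - 1) + integral {x - 1..y} gauss) has_real_derivative gauss x) (at x)"
    by (auto intro!: derivative_eq_intros)
  then show ?thesis
  proof (rule has_field_derivative_transform_within_open[of _ _ _ "{x - 1<..}"])
    show "\<Phi> (x - 1) + integral {x - 1..y} gauss = \<Phi> y" if "y \<in> {x - 1<..}" for y
      using \<Phi>_diff[of "x - 1" y] that by simp
  qed auto
qed

lemma continuous_\<Phi>: "continuous_on S \<Phi>"
  using \<Phi>_deriv by (meson DERIV_isCont continuous_at_imp_continuous_on)

lemma \<Phi>_bounds: "0 \<le> \<Phi> x" "\<Phi> x \<le> 1"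
  by (simp_all add: std_normal.cdf_nonneg std_normal.cdf_bounded_prob)

lemma \<Phi>_mono: "x \<le> y \<Longrightarrow> \<Phi> x \<le> \<Phi> y"
  by (rule std_normal.cdf_nondecreasing)

lemma \<Phi>_minus: "\<Phi> (- x) = 1 - \<Phi> x"
proof -
  have "((\<lambda>x. \<Phi> x + \<Phi> (- x)) has_real_derivative 0) (at x)" for x
  proof -
    have "((\<lambda>x. \<Phi> (- x)) has_real_derivative gauss (- x) * (- 1)) (at x)"
      by (rule DERIV_chain2[OF \<Phi>_deriv]) (auto intro!: derivative_eq_intros)
    from DERIV_add[OF \<Phi>_deriv[of x] this] show ?thesis by simp
  qed
  then have const: "\<Phi> y + \<Phi> (- y) = \<Phi> x + \<Phi> (- x)" for y
    using DERIV_isconst_all[of "\<lambda>x. \<Phi> x + \<Phi> (- x)"] by blast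
  have lim: "((\<lambda>y. \<Phi> y + \<Phi> (- y)) \<longlongrightarrow> 1 + 0) at_top"
    by (intro tendsto_add std_normal.cdf_lim_at_top_prob
        filterlim_compose[OF std_normal.cdf_lim_at_bot filterlim_uminus_at_bot_at_top])
  have "(\<lambda>y. \<Phi> y + \<Phi> (- y)) = (\<lambda>y. \<Phi> x + \<Phi> (- x))" by (rule ext) (rule const)
  from lim[unfolded this] have "\<Phi> x + \<Phi> (- x) = 1 + 0"
    by (simp only: tendsto_const_iff trivial_limit_at_top_linorder not_False_eq_True)
  then show ?thesis by simp
qed

text \<open>The difference of the two sides, divided by \<open>x\<close>, is monotone and tends to 0 at infinity.\<close>

lemma gauss_tail:
  assumes "0 < x"
  shows "x * (1 - \<Phi> x) \<le> gauss x"
proof -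
  let ?u = "\<lambda>x. gauss x / x - (1 - \<Phi> x)"
  have mono: "?u y \<le> ?u x" if "x \<le> y" for y
  proof (rule DERIV_nonpos_imp_nonincreasing[OF that])
    fix t assume "x \<le> t" "t \<le> y"
    then have t: "0 < t" using assms by simp
    have D: "(?u has_real_derivative ((- t * gauss t) * t - gauss t * 1) / (t * t) - (0 - gauss t)) (at t)"
      by (intro DERIV_diff DERIV_divide gauss_deriv DERIV_ident \<Phi>_deriv DERIV_const) (use t in simp)
    have eq: "((- t * gauss t) * t - gauss t * 1) / (t * t) - (0 - gauss t) = - (gauss t / (t * t))"
      using t by (simp add: field_simps)
    have "- (gauss t / (t * t)) \<le> 0" using gauss_pos[of t] t by simp
    with D[unfolded eq] show "\<exists>d. (?u has_real_derivative d) (at t) \<and> d \<le> 0" by blast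
  qed
  have lim: "((\<lambda>y. gauss y / y) \<longlongrightarrow> 0) at_top"
  proof (rule tendsto_sandwich[of "\<lambda>_. 0" _ _ "\<lambda>y. inverse y"])
    show "\<forall>\<^sub>F y in at_top. 0 \<le> gauss y / y"
      using eventually_gt_at_top[of 0] by eventually_elim (simp add: gauss_pos less_imp_le)
    show "\<forall>\<^sub>F y in at_top. gauss y / y \<le> inverse y"
      using eventually_gt_at_top[of 0] by eventually_elim (simp add: gauss_le_1 divide_simps)
  qed (auto intro: tendsto_inverse_0_at_top filterlim_ident)
  have "(?u \<longlongrightarrow> 0 - (1 - 1)) at_top"
    by (intro tendsto_diff lim tendsto_const std_normal.cdf_lim_at_top_prob)
  then have "0 \<le> ?u x"
    using tendsto_upperbound[of ?u 0 at_top "?u x"] eventually_mono[OF eventually_ge_at_top[of x] mono] by simp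
  then show ?thesis using assms by (simp add: field_simps)
qed

definition mills_const :: real where "mills_const = 1 / gauss 1"

lemma mills_const_ge_1: "1 \<le> mills_const"
  using gauss_le_1[of 1] gauss_pos[of 1] by (simp add: mills_const_def)

lemma mills:
  assumes "0 \<le> x"
  shows "1 - \<Phi> x \<le> mills_const * gauss x"
proof (cases "x \<le> 1")
  case True
  have "x\<^sup>2 \<le> 1" using True assms by (simp add: power_le_one)
  then have "gauss 1 \<le> gauss x" by (simp add: std_normal_density_def divide_right_mono)
  then have "1 \<le> mills_const * gauss x" using gauss_pos[of 1] by (simp add: mills_const_def)
  then show ?thesis using \<Phi>_bounds[of x] by linarith
next
  case False
  have "1 * (1 - \<Phi> x) \<le> x * (1 - \<Phi> x)" using False \<Phi>_bounds[of x] by (intro mult_right_mono) auto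
  also have "\<dots> \<le> gauss x" using False by (intro gauss_tail) simp
  also have "\<dots> \<le> mills_const * gauss x" using mills_const_ge_1 gauss_pos[of x] by simp
  finally show ?thesis by simp
qed

text \<open>The bounded solution of \<open>f' w - w * f w = indicator {..z} w - \<Phi> z\<close>.\<close>

definition stein_sol :: "real \<Rightarrow> real \<Rightarrow> real" where
  "stein_sol z w = \<Phi> (min w z) * (1 - \<Phi> (max w z)) / gauss w"

definition stein_sol' :: "real \<Rightarrow> real \<Rightarrow> real" where
  "stein_sol' z w = indicator {..z} w - \<Phi> z + w * stein_sol z w"

lemma continuous_stein_sol: "continuous_on S (stein_sol z)"
  unfolding stein_sol_def using gauss_pos
  by (intro continuous_intros continuous_gauss continuous_on_compose2[OF continuous_\<Phi>[of UNIV]]) (auto simp: less_imp_neq[THEN not_sym])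

lemma stein_sol_deriv:
  assumes "w \<noteq> z"
  shows "(stein_sol z has_real_derivative stein_sol' z w) (at w)"
proof (cases "w < z")
  case True
  have "((\<lambda>w. \<Phi> w * (1 - \<Phi> z) / gauss w) has_real_derivative
      (gauss w * (1 - \<Phi> z) * gauss w - \<Phi> w * (1 - \<Phi> z) * (- w * gauss w)) / (gauss w * gauss w)) (at w)"
    by (intro DERIV_divide DERIV_cmult_right \<Phi>_deriv gauss_deriv) (use gauss_pos[of w] in simp)
  moreover have "(gauss w * (1 - \<Phi> z) * gauss w - \<Phi> w * (1 - \<Phi> z) * (- w * gauss w)) / (gauss w * gauss w)
      = stein_sol' z w"
    using True gauss_pos[of w] by (simp add: stein_sol'_def stein_sol_def field_simps)
  ultimately have "((\<lambda>w. \<Phi> w * (1 - \<Phi> z) / gauss w) has_real_derivative stein_sol' z w) (at w)" by simp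
  then show ?thesis
    by (rule has_field_derivative_transform_within_open[of _ _ _ "{..<z}"]) (use True in \<open>auto simp: stein_sol_def\<close>)
next
  case False
  then have zw: "z < w" using assms by simp
  have "((\<lambda>w. \<Phi> z * (1 - \<Phi> w) / gauss w) has_real_derivative
      (\<Phi> z * (0 - gauss w) * gauss w - \<Phi> z * (1 - \<Phi> w) * (- w * gauss w)) / (gauss w * gauss w)) (at w)"
    by (intro DERIV_divide DERIV_cmult DERIV_diff DERIV_const \<Phi>_deriv gauss_deriv) (use gauss_pos[of w] in simp)
  moreover have "(\<Phi> z * (0 - gauss w) * gauss w - \<Phi> z * (1 - \<Phi> w) * (- w * gauss w)) / (gauss w * gauss w)
      = stein_sol' z w"
    using zw gauss_pos[of w] by (simp add: stein_sol'_def stein_sol_def field_simps)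
  ultimately have "((\<lambda>w. \<Phi> z * (1 - \<Phi> w) / gauss w) has_real_derivative stein_sol' z w) (at w)" by simp
  then show ?thesis
    by (rule has_field_derivative_transform_within_open[of _ _ _ "{z<..}"]) (use zw in \<open>auto simp: stein_sol_def\<close>)
qed

lemma borel_measurable_stein_sol [measurable]: "stein_sol z \<in> borel_measurable borel"
  by (rule borel_measurable_continuous_onI[OF continuous_stein_sol])

lemma borel_measurable_stein_sol' [measurable]: "stein_sol' z \<in> borel_measurable borel"
  unfolding stein_sol'_def[abs_def] by measurable

lemma stein_sol_nonneg: "0 \<le> stein_sol z w"
  unfolding stein_sol_def using \<Phi>_bounds gauss_pos[of w] by (intro divide_nonneg_pos mult_nonneg_nonneg) auto

lemma stein_sol_le_tail: "stein_sol z w * gauss w \<le> 1 - \<Phi> \<bar>w\<bar>"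
proof -
  have eq: "stein_sol z w * gauss w = \<Phi> (min w z) * (1 - \<Phi> (max w z))"
    using gauss_pos[of w] by (simp add: stein_sol_def)
  show ?thesis
  proof (cases "0 \<le> w")
    case True
    have "\<Phi> (min w z) * (1 - \<Phi> (max w z)) \<le> 1 * (1 - \<Phi> w)"
      using \<Phi>_bounds \<Phi>_mono[of w "max w z"] by (intro mult_mono) auto
    then show ?thesis using True eq by simp
  next
    case False
    have "\<Phi> (min w z) * (1 - \<Phi> (max w z)) \<le> \<Phi> w * 1"
      using \<Phi>_bounds \<Phi>_mono[of "min w z" w] by (intro mult_mono) auto
    then show ?thesis using False eq \<Phi>_minus[of w] by simp
  qed
qed

lemma stein_sol_bound: "stein_sol z w \<le> mills_const"
proof -
  have "stein_sol z w * gauss w \<le> mills_const * gauss w"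
    using stein_sol_le_tail[of z w] mills[of "\<bar>w\<bar>"] by (cases "0 \<le> w") auto
  then show ?thesis using gauss_pos[of w] by simp
qed

lemma times_stein_sol_bound: "\<bar>w * stein_sol z w\<bar> \<le> 1"
proof (cases "w = 0")
  case False
  have "\<bar>w\<bar> * (stein_sol z w * gauss w) \<le> \<bar>w\<bar> * (1 - \<Phi> \<bar>w\<bar>)"
    by (intro mult_left_mono stein_sol_le_tail) simp
  also have "\<dots> \<le> gauss \<bar>w\<bar>" using False by (intro gauss_tail) simp
  also have "\<dots> = 1 * gauss w" by (cases "0 \<le> w") auto
  finally have "(\<bar>w\<bar> * stein_sol z w) * gauss w \<le> 1 * gauss w" by (simp add: mult.assoc)
  then have "\<bar>w\<bar> * stein_sol z w \<le> 1" using gauss_pos[of w] by (simp only: mult_le_cancel_right_pos)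
  then show ?thesis using stein_sol_nonneg[of z w] by (simp add: abs_mult)
qed simp

lemma stein_sol'_bound: "\<bar>stein_sol' z w\<bar> \<le> 2"
  using times_stein_sol_bound[of w z] \<Phi>_bounds[of z]
  by (auto simp: stein_sol'_def indicator_def abs_le_iff)

text \<open>
  For \<open>\<bar>w\<bar> < \<bar>z\<bar>\<close> the solution is at most the tail of the normal law at \<open>\<bar>z\<bar>\<close> divided by the density
  at \<open>w\<close>, hence of the order of the Gaussian factor bounded in the next lemma.
\<close>

lemma gauss_ratio_polynomial:
  fixes u v :: real
  assumes "0 \<le> u" "u \<le> v"
  shows "exp ((u\<^sup>2 - v\<^sup>2) / 2) \<le> fact k * exp 2 * ((1 + u) ^ k / (1 + v) ^ k)"
proof -
  \<comment> \<open>The exponent is at most \<open>- d\<^sup>2 / 2\<close>, and \<open>1 + v \<le> (1 + u) * (1 + d)\<close>.\<close>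
  define d where "d = v - u"
  have d: "0 \<le> d" using assms by (simp add: d_def)
  have "(1 + v) ^ k \<le> ((1 + u) * (1 + d)) ^ k"
  proof (intro power_mono)
    have "0 \<le> u * d" using assms d by simp
    then show "1 + v \<le> (1 + u) * (1 + d)" by (simp add: d_def algebra_simps)
  qed (use assms in simp)
  also have "\<dots> = (1 + u) ^ k * (1 + d) ^ k" by (rule power_mult_distrib)
  also have "(1 + d) ^ k \<le> fact k * exp (1 + d)"
  proof -
    have "(\<Sum>i\<in>{k}. (1 + d) ^ i / fact i) \<le> exp (1 + d)"
      unfolding exp_def using d summable_exp_generic[of "1 + d"]
      by (simp add: divide_inverse mult.commute scaleR_conv_of_real)
        (rule order_trans[OF _ sum_le_suminf[of _ "{k}"]], auto simp: mult.commute)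
    then show ?thesis by (simp add: field_simps)
  qed
  finally have 1: "(1 + v) ^ k \<le> (1 + u) ^ k * (fact k * exp (1 + d))"
    using assms by (simp add: mult_left_mono)
  have "(u\<^sup>2 - v\<^sup>2) / 2 + (1 + d) \<le> 2"
  proof -
    have "v\<^sup>2 - u\<^sup>2 = d\<^sup>2 + 2 * (u * d)" by (simp add: d_def power2_eq_square algebra_simps)
    then have "d\<^sup>2 \<le> v\<^sup>2 - u\<^sup>2" using assms d by simp
    moreover have "0 \<le> (d - 1)\<^sup>2" by simp
    then have "2 * d \<le> d\<^sup>2 + 1" by (simp add: power2_eq_square algebra_simps)
    ultimately show ?thesis by (simp add: diff_divide_distrib)
  qed
  then have "exp ((u\<^sup>2 - v\<^sup>2) / 2 + (1 + d)) \<le> exp 2" by simp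
  then have 2: "exp ((u\<^sup>2 - v\<^sup>2) / 2) * exp (1 + d) \<le> exp 2" by (simp only: exp_add)
  have "exp ((u\<^sup>2 - v\<^sup>2) / 2) * (1 + v) ^ k \<le> exp ((u\<^sup>2 - v\<^sup>2) / 2) * ((1 + u) ^ k * (fact k * exp (1 + d)))"
    by (intro mult_left_mono 1) simp
  also have "\<dots> = (1 + u) ^ k * fact k * (exp ((u\<^sup>2 - v\<^sup>2) / 2) * exp (1 + d))" by (simp add: mult_ac)
  also have "\<dots> \<le> (1 + u) ^ k * fact k * exp 2" using assms by (intro mult_left_mono 2) auto
  finally show ?thesis using assms by (simp add: field_simps)
qed

lemma stein_sol_nonuniform:
  "\<exists>C\<ge>0. \<forall>z w. \<bar>stein_sol z w\<bar> \<le> C * ((1 + \<bar>w\<bar>) ^ k / (1 + \<bar>z\<bar>) ^ k)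
    \<and> \<bar>stein_sol' z w\<bar> \<le> C * ((1 + \<bar>w\<bar>) ^ k / (1 + \<bar>z\<bar>) ^ k)"
proof -
  define D where "D = fact k * exp (2::real)"
  define C where "C = max (mills_const + 2) ((mills_const + 1) * D)"
  have D: "0 \<le> D" by (simp add: D_def)
  have C: "mills_const \<le> C" "2 \<le> C" "mills_const * D \<le> C" "(mills_const + 1) * D \<le> C" "0 \<le> C"
    using mills_const_ge_1 D by (auto simp: C_def distrib_right le_max_iff_disj)
  have "\<bar>stein_sol z w\<bar> \<le> C * ((1 + \<bar>w\<bar>) ^ k / (1 + \<bar>z\<bar>) ^ k)
    \<and> \<bar>stein_sol' z w\<bar> \<le> C * ((1 + \<bar>w\<bar>) ^ k / (1 + \<bar>z\<bar>) ^ k)" for z w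
  proof (cases "\<bar>z\<bar> \<le> \<bar>w\<bar>")
    case True
    then have "(1 + \<bar>z\<bar>) ^ k \<le> (1 + \<bar>w\<bar>) ^ k" by (intro power_mono) auto
    then have "1 \<le> (1 + \<bar>w\<bar>) ^ k / (1 + \<bar>z\<bar>) ^ k" by (simp add: add_pos_nonneg)
    then have "C * 1 \<le> C * ((1 + \<bar>w\<bar>) ^ k / (1 + \<bar>z\<bar>) ^ k)" using C by (intro mult_left_mono) auto
    moreover have "\<bar>stein_sol z w\<bar> \<le> C" using stein_sol_nonneg[of z w] stein_sol_bound[of z w] C by simp
    moreover have "\<bar>stein_sol' z w\<bar> \<le> C" using stein_sol'_bound[of z w] C by linarith
    ultimately show ?thesis by linarith
  next
    case False
    let ?q = "1 - \<Phi> \<bar>z\<bar>" and ?e = "exp ((\<bar>w\<bar>\<^sup>2 - \<bar>z\<bar>\<^sup>2) / 2)"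
    have q0: "0 \<le> ?q" using \<Phi>_bounds[of "\<bar>z\<bar>"] by simp
    have ratio: "gauss \<bar>z\<bar> / gauss w = ?e" by (simp add: gauss_ratio)
    have w: "z > 0 \<and> w < z \<or> z < 0 \<and> z < w" using False by linarith
    have sol: "\<bar>stein_sol z w\<bar> \<le> ?q / gauss w"
    proof -
      have "\<Phi> (min w z) * (1 - \<Phi> (max w z)) \<le> ?q"
        using w \<Phi>_bounds[of w] \<Phi>_bounds[of z] \<Phi>_minus[of z] by (auto simp: mult_left_le mult_left_le_one_le)
      then have "stein_sol z w \<le> ?q / gauss w"
        unfolding stein_sol_def by (intro divide_right_mono less_imp_le[OF gauss_pos])
      then show ?thesis using stein_sol_nonneg[of z w] by simp
    qed
    have q: "?q / gauss w \<le> mills_const * ?e"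
    proof -
      have "?q / gauss w \<le> mills_const * gauss \<bar>z\<bar> / gauss w"
        by (intro divide_right_mono mills less_imp_le[OF gauss_pos]) simp
      then show ?thesis unfolding ratio[symmetric] by simp
    qed
    have wq: "\<bar>w * stein_sol z w\<bar> \<le> ?e"
    proof -
      have "\<bar>w * stein_sol z w\<bar> \<le> \<bar>z\<bar> * (?q / gauss w)"
        unfolding abs_mult using False sol by (intro mult_mono) auto
      also have "\<dots> = (\<bar>z\<bar> * ?q) / gauss w" by simp
      also have "\<dots> \<le> gauss \<bar>z\<bar> / gauss w"
        using False by (intro divide_right_mono gauss_tail less_imp_le[OF gauss_pos]) auto
      finally show ?thesis by (simp add: ratio)
    qed
    have qe: "?q \<le> mills_const * ?e"
    proof -
      have "?q * gauss w \<le> ?q * 1" using q0 by (intro mult_left_mono gauss_le_1) auto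
      then have "?q \<le> ?q / gauss w" using gauss_pos[of w] by (simp add: field_simps)
      then show ?thesis using q by linarith
    qed
    have "\<bar>indicator {..z} w - \<Phi> z\<bar> = ?q"
      using w \<Phi>_bounds[of z] \<Phi>_minus[of z] by (auto simp: indicator_def)
    then have "\<bar>stein_sol' z w\<bar> \<le> ?q + \<bar>w * stein_sol z w\<bar>" unfolding stein_sol'_def by linarith
    also have "\<dots> \<le> (mills_const + 1) * ?e" using qe wq by (simp add: distrib_right)
    finally have sol': "\<bar>stein_sol' z w\<bar> \<le> (mills_const + 1) * ?e" .
    have e: "?e \<le> D * ((1 + \<bar>w\<bar>) ^ k / (1 + \<bar>z\<bar>) ^ k)"
      unfolding D_def using False by (intro gauss_ratio_polynomial) auto
    have up: "c * ?e \<le> C * ((1 + \<bar>w\<bar>) ^ k / (1 + \<bar>z\<bar>) ^ k)" if "0 \<le> c" "c * D \<le> C" for c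
    proof -
      have "c * ?e \<le> c * (D * ((1 + \<bar>w\<bar>) ^ k / (1 + \<bar>z\<bar>) ^ k))" by (intro mult_left_mono e that)
      also have "\<dots> = (c * D) * ((1 + \<bar>w\<bar>) ^ k / (1 + \<bar>z\<bar>) ^ k)" by (simp add: mult.assoc)
      also have "\<dots> \<le> C * ((1 + \<bar>w\<bar>) ^ k / (1 + \<bar>z\<bar>) ^ k)" by (intro mult_right_mono that) auto
      finally show ?thesis .
    qed
    show ?thesis
      using sol q sol' up[of mills_const] up[of "mills_const + 1"] C mills_const_ge_1 by auto
  qed
  then show ?thesis using C(5) by blast
qed

section \<open>The Berry--Esseen bound\<close>

context vector_model
begin

definition B :: real where "B = sqrt (B_squared CARD('n) \<beta>)"

lemma B_pos: "0 < B"
  using B_squared_pos by (simp add: B_def)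

text \<open>The variance balances the strength \<open>\<kappa>\<close> of the drift against the limit \<open>v0\<close> of the mean kernel.\<close>

lemma B_sq: "\<kappa> * (s0 ^ 4 * B\<^sup>2) = 2 * v0"
proof -
  have "B\<^sup>2 = 4 * \<beta>\<^sup>2 * mag' b / ((1 - \<beta> * mag' b) * b\<^sup>2)"
    unfolding B_def B_squared_eq[symmetric] using B_squared_pos by simp
  also have "(1 - \<beta> * mag' b) * b\<^sup>2 = (2 * \<kappa> * s0\<^sup>2) * \<beta>\<^sup>2"
    using \<beta>_pos by (simp add: \<kappa>_def s0_def power_divide)
  also have "4 * \<beta>\<^sup>2 * mag' b / ((2 * \<kappa> * s0\<^sup>2) * \<beta>\<^sup>2) = 2 * mag' b / (\<kappa> * s0\<^sup>2)"
    using \<beta>_pos by simp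
  finally have "B\<^sup>2 = 2 * mag' b / (\<kappa> * s0\<^sup>2)" .
  then have eq: "\<kappa> * s0\<^sup>2 * B\<^sup>2 = 2 * mag' b" using \<kappa>_pos s0_pos by simp
  have "\<kappa> * (s0 ^ 4 * B\<^sup>2) = s0\<^sup>2 * (\<kappa> * s0\<^sup>2 * B\<^sup>2)"
    by (simp add: power2_eq_square power4_eq_xxxx mult_ac)
  then show ?thesis unfolding eq by (simp add: v0_def)
qed

definition scale :: "nat \<Rightarrow> real" where "scale n = sqrt (real n) / (s0\<^sup>2 * B)"

lemma scale_pos: "1 \<le> n \<Longrightarrow> 0 < scale n"
  using s0_sq B_pos by (simp add: scale_def)

lemma scale_sq: "(scale n)\<^sup>2 = real n * (\<kappa> / (2 * v0))"
proof -
  have "(scale n)\<^sup>2 = real n / (s0 ^ 4 * B\<^sup>2)"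
    by (simp add: scale_def power_divide power_mult_distrib flip: power_mult)
  moreover have "\<kappa> / (2 * v0) = 1 / (s0 ^ 4 * B\<^sup>2)"
    unfolding B_sq[symmetric] using \<kappa>_pos by simp
  ultimately show ?thesis by simp
qed

lemma W_stat_eq:
  assumes "1 \<le> n"
  shows "W_stat n \<beta> \<sigma> / B = scale n * dev n \<sigma>"
proof -
  have R: "\<beta>\<^sup>2 / ((real n)\<^sup>2 * (b_root CARD('n) \<beta>)\<^sup>2) * (norm (total_spin n \<sigma>))\<^sup>2 = sq_mean_spin n \<sigma> / s0\<^sup>2"
    using assms \<beta>_pos by (simp add: b_def[symmetric] s0_def total_spin_eq sq_mean_spin_def power_mult_distrib power_divide)
  have "sq_mean_spin n \<sigma> / s0\<^sup>2 - 1 = dev n \<sigma> / s0\<^sup>2"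
    using s0_pos by (simp add: dev_def diff_divide_distrib)
  then show ?thesis unfolding W_stat_def R scale_def by simp
qed

lemma drift_linear:
  "\<exists>C\<ge>0. \<forall>n \<sigma>. 1 \<le> n \<longrightarrow> \<sigma> \<in> space (config_measure n) \<longrightarrow>
    \<bar>drift n \<sigma> - \<kappa> * dev n \<sigma>\<bar> \<le> C * ((dev n \<sigma>)\<^sup>2 + 1 / real n)"
proof -
  obtain C where C: "C \<ge> 0" "\<And>t. 0 \<le> t \<Longrightarrow> t \<le> 1 \<Longrightarrow>
    \<bar>t\<^sup>2 - t * mag (\<beta> * t) - \<kappa> * (t\<^sup>2 - s0\<^sup>2)\<bar> \<le> C * (t\<^sup>2 - s0\<^sup>2)\<^sup>2"
    using drift_linearisation by blast
  let ?C = "C + (2 + \<beta>)"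
  have "\<bar>drift n \<sigma> - \<kappa> * dev n \<sigma>\<bar> \<le> ?C * ((dev n \<sigma>)\<^sup>2 + 1 / real n)"
    if n: "1 \<le> n" and \<sigma>: "\<sigma> \<in> space (config_measure n)" for n \<sigma>
  proof -
    let ?t = "norm (cavity n {} \<sigma>)"
    let ?e = "(\<Sum>i = 1..n. spin_mean (cavity n {i} \<sigma>) - spin_mean (cavity n {} \<sigma>)) / real n"
    have "\<bar>?e\<bar> \<le> (1 + \<beta>) * (1 / real n)"
    proof (rule mean_abs_le)
      fix i assume i: "i \<in> {1..n}"
      have "\<bar>spin_mean (cavity n {i} \<sigma>) - spin_mean (cavity n {} \<sigma>)\<bar> \<le> (1 + \<beta>) * \<bar>norm (cavity n {i} \<sigma>) - ?t\<bar>"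
        by (intro spin_mean_lipschitz norm_cavity_le \<sigma>)
      also have "\<dots> \<le> (1 + \<beta>) * (1 / real n)"
        using \<beta>_pos by (intro mult_left_mono norm_cavity_close \<sigma> i) auto
      finally show "\<bar>spin_mean (cavity n {i} \<sigma>) - spin_mean (cavity n {} \<sigma>)\<bar> \<le> (1 + \<beta>) * (1 / real n)" .
    qed (use \<beta>_pos in simp)
    moreover have "drift n \<sigma> = sq_mean_spin n \<sigma> - 1 / real n - (spin_mean (cavity n {} \<sigma>) + ?e)"
      using drift_eq[OF n \<sigma>] n by (simp add: sum_subtractf diff_divide_distrib)
    moreover have "\<bar>sq_mean_spin n \<sigma> - spin_mean (cavity n {} \<sigma>) - \<kappa> * dev n \<sigma>\<bar> \<le> C * (dev n \<sigma>)\<^sup>2"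
      using C(2)[of ?t] norm_cavity_le[OF \<sigma>] by (simp add: sq_mean_spin_def spin_mean_def dev_def)
    moreover have "0 \<le> 1 / real n" by simp
    ultimately have "\<bar>drift n \<sigma> - \<kappa> * dev n \<sigma>\<bar> \<le> C * (dev n \<sigma>)\<^sup>2 + (1 / real n + (1 + \<beta>) * (1 / real n))"
      by linarith
    also have "\<dots> = C * (dev n \<sigma>)\<^sup>2 + (2 + \<beta>) * (1 / real n)"
      by (simp add: add_divide_distrib[symmetric])
    also have "\<dots> \<le> ?C * (dev n \<sigma>)\<^sup>2 + ?C * (1 / real n)"
    proof (rule add_mono)
      show "C * (dev n \<sigma>)\<^sup>2 \<le> ?C * (dev n \<sigma>)\<^sup>2" using \<beta>_pos by (intro mult_right_mono) auto
      show "(2 + \<beta>) * (1 / real n) \<le> ?C * (1 / real n)" using C(1) by (intro mult_right_mono) auto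
    qed
    finally show ?thesis by (simp add: distrib_left)
  qed
  moreover have "0 \<le> ?C" using C \<beta>_pos by simp
  ultimately show ?thesis by blast
qed

text \<open>
  The Stein identity for the solution at the normalised deviation \<open>w\<close>. The two error terms are the
  fluctuation of the mean kernel and the nonlinear part of the drift.
\<close>

lemma distribution_error_eq:
  assumes n: "1 \<le> n"
  shows "measure (gibbs n) {\<sigma> \<in> space (gibbs n). W_stat n \<beta> \<sigma> / B \<le> z} - \<Phi> z
    = (\<integral>\<sigma>. stein_sol' z (scale n * dev n \<sigma>) * (1 - mean_kern n \<sigma> / v0)
        + scale n / \<kappa> * (stein_sol z (scale n * dev n \<sigma>) * (drift n \<sigma> - \<kappa> * dev n \<sigma>)) \<partial>gibbs n)"
proof -
  interpret prob_space "gibbs n" by (rule prob_space_gibbs[OF n])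
  define \<gamma> where "\<gamma> = scale n"
  have \<gamma>: "0 < \<gamma>" using scale_pos[OF n] by (simp add: \<gamma>_def)
  let ?w = "\<lambda>\<sigma>. \<gamma> * dev n \<sigma>"
  let ?h = "\<lambda>u. stein_sol z (\<gamma> * (u - s0\<^sup>2))" and ?h' = "\<lambda>u. \<gamma> * stein_sol' z (\<gamma> * (u - s0\<^sup>2))"
  have id: "(\<integral>\<sigma>. ?h (sq_mean_spin n \<sigma>) * drift n \<sigma> \<partial>gibbs n)
      = 2 / real n * (\<integral>\<sigma>. ?h' (sq_mean_spin n \<sigma>) * mean_kern n \<sigma> \<partial>gibbs n)"
  proof (rule gibbs_stein_identity[OF n, of _ "s0\<^sup>2 + z / \<gamma>"])
    show "continuous_on UNIV ?h"
      by (intro continuous_on_compose2[OF continuous_stein_sol[of UNIV]] continuous_intros) auto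
    show "(?h has_real_derivative ?h' u) (at u)" if "u \<noteq> s0\<^sup>2 + z / \<gamma>" for u
    proof -
      have "\<gamma> * (u - s0\<^sup>2) \<noteq> z" using that \<gamma> by (auto simp: field_simps)
      from stein_sol_deriv[OF this]
      have "(?h has_real_derivative stein_sol' z (\<gamma> * (u - s0\<^sup>2)) * \<gamma>) (at u)"
        by (rule DERIV_chain2) (auto intro!: derivative_eq_intros)
      then show ?thesis by (simp add: mult.commute)
    qed
    show "?h' \<in> borel_measurable borel" by measurable
    show "\<exists>C. \<forall>u. \<bar>u\<bar> \<le> K \<longrightarrow> \<bar>?h' u\<bar> \<le> C" for K
      using \<gamma> stein_sol'_bound by (intro exI[of _ "\<gamma> * 2"]) (auto simp: abs_mult intro!: mult_left_mono)
  qed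
  define a where "a \<sigma> = stein_sol z (?w \<sigma>) * drift n \<sigma>" for \<sigma>
  define k where "k \<sigma> = stein_sol' z (?w \<sigma>) * mean_kern n \<sigma>" for \<sigma>
  define s' where "s' \<sigma> = stein_sol' z (?w \<sigma>)" for \<sigma>
  define ws where "ws \<sigma> = ?w \<sigma> * stein_sol z (?w \<sigma>)" for \<sigma>
  have ia: "integrable (gibbs n) a"
  proof (rule gibbs_integrable_bounded[OF n, of _ "mills_const * 2"])
    fix \<sigma> :: "nat \<Rightarrow> real ^ 'n" assume \<sigma>: "\<sigma> \<in> space (config_measure n)"
    show "\<bar>a \<sigma>\<bar> \<le> mills_const * 2"
      unfolding a_def abs_mult using stein_sol_nonneg stein_sol_bound mills_const_ge_1
      by (intro mult_mono drift_bound \<sigma>) auto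
  qed (unfold a_def, measurable)
  have ik: "integrable (gibbs n) k"
  proof (rule gibbs_integrable_bounded[OF n, of _ "2 * (4 * exp (2 * \<beta>))"])
    fix \<sigma> :: "nat \<Rightarrow> real ^ 'n" assume \<sigma>: "\<sigma> \<in> space (config_measure n)"
    show "\<bar>k \<sigma>\<bar> \<le> 2 * (4 * exp (2 * \<beta>))"
      unfolding k_def abs_mult by (intro mult_mono stein_sol'_bound mean_kern_bound' n \<sigma>) auto
  qed (unfold k_def, measurable)
  have is': "integrable (gibbs n) s'"
  proof (rule gibbs_integrable_bounded[OF n, of _ 2])
    show "\<bar>s' \<sigma>\<bar> \<le> 2" for \<sigma> unfolding s'_def by (rule stein_sol'_bound)
  qed (unfold s'_def, measurable)
  have iws: "integrable (gibbs n) ws"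
  proof (rule gibbs_integrable_bounded[OF n, of _ 1])
    show "\<bar>ws \<sigma>\<bar> \<le> 1" for \<sigma> unfolding ws_def by (rule times_stein_sol_bound)
  qed (unfold ws_def, measurable)
  have E_a: "(\<integral>\<sigma>. a \<sigma> \<partial>gibbs n) = 2 * \<gamma> / real n * (\<integral>\<sigma>. k \<sigma> \<partial>gibbs n)"
    using id by (simp add: a_def k_def dev_def mult.assoc)
  have E_a': "\<gamma> / \<kappa> * (\<integral>\<sigma>. a \<sigma> \<partial>gibbs n) = (\<integral>\<sigma>. k \<sigma> \<partial>gibbs n) / v0"
  proof -
    have "\<gamma> / \<kappa> * (2 * \<gamma> / real n) = 2 / (\<kappa> * real n) * \<gamma>\<^sup>2" by (simp add: power2_eq_square)
    also have "\<dots> = 1 / v0"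
      unfolding \<gamma>_def scale_sq using n \<kappa>_pos v0_pos by (simp add: field_simps)
    finally show ?thesis unfolding E_a by (simp only: mult.assoc[symmetric]) simp
  qed
  have "measure (gibbs n) {\<sigma> \<in> space (gibbs n). W_stat n \<beta> \<sigma> / B \<le> z}
      = (\<integral>\<sigma>. indicator {\<sigma> \<in> space (gibbs n). W_stat n \<beta> \<sigma> / B \<le> z} \<sigma> \<partial>gibbs n)"
  proof -
    have "{\<sigma> \<in> space (gibbs n). ?w \<sigma> \<le> z} \<in> sets (gibbs n)" by measurable
    then show ?thesis by (simp add: W_stat_eq[OF n] \<gamma>_def Int_absorb2)
  qed
  also have "\<dots> = (\<integral>\<sigma>. s' \<sigma> - ws \<sigma> + \<Phi> z \<partial>gibbs n)"
    by (intro Bochner_Integration.integral_cong refl)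
      (auto simp: W_stat_eq[OF n] \<gamma>_def[symmetric] s'_def ws_def stein_sol'_def indicator_def)
  also have "\<dots> = (\<integral>\<sigma>. s' \<sigma> \<partial>gibbs n) - (\<integral>\<sigma>. ws \<sigma> \<partial>gibbs n) + \<Phi> z"
    using is' iws by (simp add: prob_space)
  finally have lhs: "measure (gibbs n) {\<sigma> \<in> space (gibbs n). W_stat n \<beta> \<sigma> / B \<le> z} - \<Phi> z
      = (\<integral>\<sigma>. s' \<sigma> \<partial>gibbs n) - (\<integral>\<sigma>. ws \<sigma> \<partial>gibbs n)" by simp
  have "(\<integral>\<sigma>. stein_sol' z (?w \<sigma>) * (1 - mean_kern n \<sigma> / v0)
        + \<gamma> / \<kappa> * (stein_sol z (?w \<sigma>) * (drift n \<sigma> - \<kappa> * dev n \<sigma>)) \<partial>gibbs n)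
      = (\<integral>\<sigma>. (s' \<sigma> - k \<sigma> / v0) + (\<gamma> / \<kappa> * a \<sigma> - ws \<sigma>) \<partial>gibbs n)"
    using \<kappa>_pos by (intro Bochner_Integration.integral_cong refl)
      (simp add: s'_def k_def a_def ws_def right_diff_distrib mult_ac)
  also have "\<dots> = ((\<integral>\<sigma>. s' \<sigma> \<partial>gibbs n) - (\<integral>\<sigma>. k \<sigma> \<partial>gibbs n) / v0)
      + (\<gamma> / \<kappa> * (\<integral>\<sigma>. a \<sigma> \<partial>gibbs n) - (\<integral>\<sigma>. ws \<sigma> \<partial>gibbs n))"
    using is' ik ia iws
    by (subst Bochner_Integration.integral_add Bochner_Integration.integral_diff,
        auto intro!: Bochner_Integration.integrable_diff integrable_divide integrable_mult_right)+
  also have "\<dots> = (\<integral>\<sigma>. s' \<sigma> \<partial>gibbs n) - (\<integral>\<sigma>. ws \<sigma> \<partial>gibbs n)"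
    unfolding E_a' by simp
  finally show ?thesis unfolding lhs \<gamma>_def[symmetric] by simp
qed

lemma one_plus_abs_power:
  fixes x :: real
  shows "(1 + \<bar>x\<bar>) ^ (2 * k) \<le> 2 ^ (2 * k) * (1 + x ^ (2 * k))"
proof -
  have e: "\<bar>x\<bar> ^ (2 * k) = x ^ (2 * k)" by (simp add: power_mult)
  have "(1 + \<bar>x\<bar>) ^ (2 * k) \<le> (2 * max 1 \<bar>x\<bar>) ^ (2 * k)" by (intro power_mono) auto
  also have "\<dots> = 2 ^ (2 * k) * max 1 \<bar>x\<bar> ^ (2 * k)" by (rule power_mult_distrib)
  also have "max 1 \<bar>x\<bar> ^ (2 * k) \<le> 1 + x ^ (2 * k)"
    using e by (cases "1 \<le> \<bar>x\<bar>") (auto simp: max_def power_mult)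
  finally show ?thesis by simp
qed

text \<open>
  The Gaussian decay of the solution away from \<open>z\<close> turns into a power of \<open>1 + \<bar>z\<bar>\<close> at the price of
  moments of \<open>w\<close>, which are bounded. Both error terms have second moments of order \<open>1 / n\<close>.
\<close>

theorem nonuniform_berry_esseen:
  "\<exists>C\<ge>0. \<forall>n\<ge>1. \<forall>z. \<bar>measure (gibbs n) {\<sigma> \<in> space (gibbs n). W_stat n \<beta> \<sigma> / B \<le> z} - \<Phi> z\<bar>
    \<le> C / ((1 + \<bar>z\<bar>) ^ k * sqrt (real n))"
proof -
  obtain S where S: "S \<ge> 0" "\<And>z w. \<bar>stein_sol z w\<bar> \<le> S * ((1 + \<bar>w\<bar>) ^ k / (1 + \<bar>z\<bar>) ^ k)"
    "\<And>z w. \<bar>stein_sol' z w\<bar> \<le> S * ((1 + \<bar>w\<bar>) ^ k / (1 + \<bar>z\<bar>) ^ k)"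
    using stein_sol_nonuniform[of k] by blast
  obtain L where L: "L \<ge> 0" "\<And>n \<sigma>. 1 \<le> n \<Longrightarrow> \<sigma> \<in> space (config_measure n) \<Longrightarrow>
    \<bar>drift n \<sigma> - \<kappa> * dev n \<sigma>\<bar> \<le> L * ((dev n \<sigma>)\<^sup>2 + 1 / real n)"
    using drift_linear by blast
  obtain K where K: "K \<ge> 0" "\<And>n. 1 \<le> n \<Longrightarrow> (\<integral>\<sigma>. (mean_kern n \<sigma> - v0)\<^sup>2 \<partial>gibbs n) \<le> K / real n"
    using mean_kern_concentration by blast
  obtain M2 where M2: "M2 \<ge> 0" "\<And>n. 1 \<le> n \<Longrightarrow> (\<integral>\<sigma>. dev n \<sigma> ^ (2 * 2) \<partial>gibbs n) \<le> M2 / real n ^ 2"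
    using moment_bound by blast
  obtain Mk where Mk: "Mk \<ge> 0" "\<And>n. 1 \<le> n \<Longrightarrow> (\<integral>\<sigma>. dev n \<sigma> ^ (2 * k) \<partial>gibbs n) \<le> Mk / real n ^ k"
    using moment_bound by blast
  define g where "g = \<kappa> / (2 * v0)"
  have g: "0 < g" using \<kappa>_pos v0_pos by (simp add: g_def)
  define D where "D = 4 * g * L\<^sup>2 / \<kappa>\<^sup>2"
  have D: "0 \<le> D" using g by (simp add: D_def)
  define C1 where "C1 = 2 ^ (2 * k) * (1 + g ^ k * Mk)"
  define C2 where "C2 = 2 * K / v0\<^sup>2 + D * (M2 + 1)"
  have "\<bar>measure (gibbs n) {\<sigma> \<in> space (gibbs n). W_stat n \<beta> \<sigma> / B \<le> z} - \<Phi> z\<bar>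
    \<le> (S * (C1 + C2) / 2) / ((1 + \<bar>z\<bar>) ^ k * sqrt (real n))" if n: "1 \<le> n" for n z
  proof -
    interpret prob_space "gibbs n" by (rule prob_space_gibbs[OF n])
    define \<gamma> where "\<gamma> = scale n"
    have \<gamma>: "0 < \<gamma>" "\<gamma>\<^sup>2 = real n * g" using scale_pos[OF n] scale_sq[of n] by (simp_all add: \<gamma>_def g_def)
    define rn where "rn = sqrt (real n)"
    have rn: "0 < rn" "rn\<^sup>2 = real n" using n by (simp_all add: rn_def)
    let ?w = "\<lambda>\<sigma>. \<gamma> * dev n \<sigma>"
    define X where "X \<sigma> = \<bar>1 - mean_kern n \<sigma> / v0\<bar> + \<gamma> / \<kappa> * \<bar>drift n \<sigma> - \<kappa> * dev n \<sigma>\<bar>" for \<sigma>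
    define A where "A \<sigma> = 2 ^ (2 * k) * (1 + \<gamma> ^ (2 * k) * dev n \<sigma> ^ (2 * k))" for \<sigma>
    define Q where "Q \<sigma> = 2 / v0\<^sup>2 * (mean_kern n \<sigma> - v0)\<^sup>2 + real n * D * (dev n \<sigma> ^ (2 * 2) + 1 / (real n)\<^sup>2)" for \<sigma>
    let ?F = "\<lambda>\<sigma>. stein_sol' z (?w \<sigma>) * (1 - mean_kern n \<sigma> / v0)
        + \<gamma> / \<kappa> * (stein_sol z (?w \<sigma>) * (drift n \<sigma> - \<kappa> * dev n \<sigma>))"
    let ?c = "S / (1 + \<bar>z\<bar>) ^ k"
    have c: "0 \<le> ?c" using S by simp
    have F_le: "\<bar>?F \<sigma>\<bar> \<le> ?c * ((1 + \<bar>?w \<sigma>\<bar>) ^ k * X \<sigma>)" for \<sigma>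
    proof -
      let ?p = "S * ((1 + \<bar>?w \<sigma>\<bar>) ^ k / (1 + \<bar>z\<bar>) ^ k)"
      have "\<bar>?F \<sigma>\<bar> \<le> \<bar>stein_sol' z (?w \<sigma>)\<bar> * \<bar>1 - mean_kern n \<sigma> / v0\<bar>
          + \<gamma> / \<kappa> * (\<bar>stein_sol z (?w \<sigma>)\<bar> * \<bar>drift n \<sigma> - \<kappa> * dev n \<sigma>\<bar>)"
        using \<gamma> \<kappa>_pos by (intro order_trans[OF abs_triangle_ineq]) (simp add: abs_mult)
      also have "\<dots> \<le> ?p * \<bar>1 - mean_kern n \<sigma> / v0\<bar> + \<gamma> / \<kappa> * (?p * \<bar>drift n \<sigma> - \<kappa> * dev n \<sigma>\<bar>)"
        using \<gamma> \<kappa>_pos by (intro add_mono mult_right_mono mult_left_mono S) auto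
      also have "\<dots> = ?c * ((1 + \<bar>?w \<sigma>\<bar>) ^ k * X \<sigma>)"
        by (simp add: X_def algebra_simps)
      finally show ?thesis .
    qed
    \<comment> \<open>The weights \<open>1 / sqrt n\<close> and \<open>sqrt n\<close> balance \<open>u\<close> of order 1 against \<open>v\<close> of order \<open>1 / sqrt n\<close>.\<close>
    have amgm: "u * v \<le> (u\<^sup>2 / rn + rn * v\<^sup>2) / 2" for u v :: real
    proof -
      have "0 \<le> (u - rn * v)\<^sup>2" by simp
      then have "2 * (rn * (u * v)) \<le> u\<^sup>2 + rn\<^sup>2 * v\<^sup>2" by (simp add: power2_eq_square algebra_simps)
      then show ?thesis using rn(1) by (simp add: field_simps power2_eq_square)
    qed
    have X_sq: "(X \<sigma>)\<^sup>2 \<le> Q \<sigma>" if \<sigma>: "\<sigma> \<in> space (config_measure n)" for \<sigma>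
    proof -
      have sq2: "(u + v)\<^sup>2 \<le> 2 * u\<^sup>2 + 2 * v\<^sup>2" for u v :: real
        using zero_le_power2[of "u - v"] by (simp add: power2_eq_square algebra_simps)
      let ?r = "(dev n \<sigma>)\<^sup>2 + 1 / real n"
      have "(X \<sigma>)\<^sup>2 \<le> 2 * \<bar>1 - mean_kern n \<sigma> / v0\<bar>\<^sup>2 + 2 * (\<gamma> / \<kappa> * \<bar>drift n \<sigma> - \<kappa> * dev n \<sigma>\<bar>)\<^sup>2"
        unfolding X_def by (rule sq2)
      also have "\<dots> \<le> 2 * \<bar>1 - mean_kern n \<sigma> / v0\<bar>\<^sup>2 + 2 * (\<gamma> / \<kappa> * (L * ?r))\<^sup>2"
        using \<gamma> \<kappa>_pos by (intro add_mono mult_left_mono power_mono L n \<sigma>) auto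
      also have "\<bar>1 - mean_kern n \<sigma> / v0\<bar>\<^sup>2 = 1 / v0\<^sup>2 * (mean_kern n \<sigma> - v0)\<^sup>2"
      proof -
        have "1 - mean_kern n \<sigma> / v0 = - ((mean_kern n \<sigma> - v0) / v0)" using v0_pos by (simp add: field_simps)
        then show ?thesis by (simp add: power_divide)
      qed
      also have "(\<gamma> / \<kappa> * (L * ?r))\<^sup>2 = (real n * g * L\<^sup>2 / \<kappa>\<^sup>2) * ?r\<^sup>2"
        unfolding power_mult_distrib power_divide \<gamma>(2) by simp
      also have "(real n * g * L\<^sup>2 / \<kappa>\<^sup>2) * ?r\<^sup>2 \<le> (real n * g * L\<^sup>2 / \<kappa>\<^sup>2) * (2 * ((dev n \<sigma>)\<^sup>2)\<^sup>2 + 2 * (1 / real n)\<^sup>2)"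
        using g by (intro mult_left_mono sq2) auto
      also have "2 * (1 / v0\<^sup>2 * (mean_kern n \<sigma> - v0)\<^sup>2) + 2 * ((real n * g * L\<^sup>2 / \<kappa>\<^sup>2) * (2 * ((dev n \<sigma>)\<^sup>2)\<^sup>2 + 2 * (1 / real n)\<^sup>2)) = Q \<sigma>"
        by (simp add: Q_def D_def power_mult power_divide algebra_simps add_divide_distrib)
      finally show ?thesis by simp
    qed
    have w_pow: "((1 + \<bar>?w \<sigma>\<bar>) ^ k)\<^sup>2 \<le> A \<sigma>" for \<sigma>
    proof -
      have "((1 + \<bar>?w \<sigma>\<bar>) ^ k)\<^sup>2 = (1 + \<bar>?w \<sigma>\<bar>) ^ (2 * k)" by (simp add: power_mult mult.commute flip: power_mult)
      also have "\<dots> \<le> 2 ^ (2 * k) * (1 + (?w \<sigma>) ^ (2 * k))" by (rule one_plus_abs_power)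
      also have "\<dots> = A \<sigma>" unfolding A_def power_mult_distrib ..
      finally show ?thesis .
    qed
    have F_AQ: "\<bar>?F \<sigma>\<bar> \<le> ?c * ((A \<sigma> / rn + rn * Q \<sigma>) / 2)" if \<sigma>: "\<sigma> \<in> space (config_measure n)" for \<sigma>
    proof -
      have "(1 + \<bar>?w \<sigma>\<bar>) ^ k * X \<sigma> \<le> (((1 + \<bar>?w \<sigma>\<bar>) ^ k)\<^sup>2 / rn + rn * (X \<sigma>)\<^sup>2) / 2" by (rule amgm)
      also have "\<dots> \<le> (A \<sigma> / rn + rn * Q \<sigma>) / 2"
        using rn(1) by (intro divide_right_mono add_mono mult_left_mono w_pow X_sq \<sigma>) auto
      finally show ?thesis using F_le[of \<sigma>] mult_left_mono[OF _ c] by (meson order_trans)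
    qed
    have iK: "integrable (gibbs n) (\<lambda>\<sigma>. (mean_kern n \<sigma> - v0)\<^sup>2)"
    proof (rule gibbs_integrable_bounded[OF n, of _ "(4 * exp (2 * \<beta>) + \<bar>v0\<bar>)\<^sup>2"])
      fix \<sigma> :: "nat \<Rightarrow> real ^ 'n" assume \<sigma>: "\<sigma> \<in> space (config_measure n)"
      have "\<bar>mean_kern n \<sigma> - v0\<bar> \<le> 4 * exp (2 * \<beta>) + \<bar>v0\<bar>"
        using mean_kern_bound'[OF n \<sigma>] by linarith
      then have "\<bar>mean_kern n \<sigma> - v0\<bar>\<^sup>2 \<le> (4 * exp (2 * \<beta>) + \<bar>v0\<bar>)\<^sup>2" by (intro power_mono) auto
      then show "\<bar>(mean_kern n \<sigma> - v0)\<^sup>2\<bar> \<le> (4 * exp (2 * \<beta>) + \<bar>v0\<bar>)\<^sup>2" by (simp only: power2_abs abs_power2)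
    qed measurable
    note idev = integrable_dev_power[OF n]
    have iA: "integrable (gibbs n) A" unfolding A_def
      by (intro integrable_mult_right Bochner_Integration.integrable_add integrable_const idev)
    have iQ: "integrable (gibbs n) Q" unfolding Q_def
      by (intro integrable_mult_right Bochner_Integration.integrable_add integrable_const idev iK)
    have EA: "(\<integral>\<sigma>. A \<sigma> \<partial>gibbs n) \<le> C1"
    proof -
      have "(\<integral>\<sigma>. A \<sigma> \<partial>gibbs n) = 2 ^ (2 * k) * (1 + \<gamma> ^ (2 * k) * (\<integral>\<sigma>. dev n \<sigma> ^ (2 * k) \<partial>gibbs n))"
        unfolding A_def using idev[of "2 * k"] by (simp add: prob_space)
      also have "\<dots> \<le> 2 ^ (2 * k) * (1 + \<gamma> ^ (2 * k) * (Mk / real n ^ k))"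
        using \<gamma> by (intro mult_left_mono add_left_mono Mk n) auto
      also have "\<gamma> ^ (2 * k) * (Mk / real n ^ k) = g ^ k * Mk"
        unfolding power_mult \<gamma>(2) using n by (simp add: power_mult_distrib)
      finally show ?thesis by (simp add: C1_def)
    qed
    have EQ: "(\<integral>\<sigma>. Q \<sigma> \<partial>gibbs n) \<le> C2 / real n"
    proof -
      have "(\<integral>\<sigma>. Q \<sigma> \<partial>gibbs n) = 2 / v0\<^sup>2 * (\<integral>\<sigma>. (mean_kern n \<sigma> - v0)\<^sup>2 \<partial>gibbs n)
          + real n * D * ((\<integral>\<sigma>. dev n \<sigma> ^ (2 * 2) \<partial>gibbs n) + 1 / (real n)\<^sup>2)"
        unfolding Q_def using idev[of "2 * 2"] iK by (simp add: prob_space del: One_nat_def)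
      also have "\<dots> \<le> 2 / v0\<^sup>2 * (K / real n) + real n * D * (M2 / real n ^ 2 + 1 / (real n)\<^sup>2)"
        using D by (intro mult_left_mono add_mono add_right_mono K M2 n) auto
      also have "\<dots> = C2 / real n"
        using n by (simp add: C2_def add_divide_distrib distrib_left power2_eq_square)
      finally show ?thesis .
    qed
    have "\<bar>(\<integral>\<sigma>. ?F \<sigma> \<partial>gibbs n)\<bar> \<le> (\<integral>\<sigma>. \<bar>?F \<sigma>\<bar> \<partial>gibbs n)" by (rule Bochner_Integration.integral_abs_bound)
    also have "\<dots> \<le> (\<integral>\<sigma>. ?c * ((A \<sigma> / rn + rn * Q \<sigma>) / 2) \<partial>gibbs n)"
    proof (rule integral_mono')
      show "integrable (gibbs n) (\<lambda>\<sigma>. ?c * ((A \<sigma> / rn + rn * Q \<sigma>) / 2))"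
        by (intro integrable_mult_right integrable_divide Bochner_Integration.integrable_add iA iQ)
      show "\<bar>?F \<sigma>\<bar> \<le> ?c * ((A \<sigma> / rn + rn * Q \<sigma>) / 2)" if "\<sigma> \<in> space (gibbs n)" for \<sigma>
        using F_AQ that by (simp add: space_gibbs)
      show "0 \<le> ?c * ((A \<sigma> / rn + rn * Q \<sigma>) / 2)" if "\<sigma> \<in> space (gibbs n)" for \<sigma>
        by (rule order_trans[OF abs_ge_zero F_AQ]) (use that in \<open>simp add: space_gibbs\<close>)
    qed
    also have "\<dots> = ?c * (((\<integral>\<sigma>. A \<sigma> \<partial>gibbs n) / rn + rn * (\<integral>\<sigma>. Q \<sigma> \<partial>gibbs n)) / 2)"
      using iA iQ by simp
    also have "\<dots> \<le> ?c * ((C1 / rn + rn * (C2 / real n)) / 2)"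
      using rn(1) by (intro mult_left_mono[OF _ c] divide_right_mono add_mono mult_left_mono EA EQ) auto
    also have "rn * (C2 / real n) = C2 / rn"
      using rn(1) unfolding rn(2)[symmetric] by (simp add: power2_eq_square)
    also have "?c * ((C1 / rn + C2 / rn) / 2) = (S * (C1 + C2) / 2) / ((1 + \<bar>z\<bar>) ^ k * rn)"
      by (simp add: add_divide_distrib[symmetric])
    finally show ?thesis
      unfolding distribution_error_eq[OF n] \<gamma>_def[symmetric] rn_def .
  qed
  moreover have "0 \<le> S * (C1 + C2) / 2"
    using S D K M2 Mk g by (simp add: C1_def C2_def)
  ultimately show ?thesis by blast
qed

end

theorem theorem3p1:
  fixes \<beta> p :: real
  assumes "CARD('n::finite) \<ge> 2"
    and "\<beta> > real CARD('n)"
    and "p \<ge> 1"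
  shows "\<exists>C::real. \<forall>n::nat. n \<ge> 1 \<longrightarrow> (\<forall>z::real.
    \<bar>measure (gibbs_measure n \<beta>)
        {\<sigma> \<in> space (gibbs_measure n \<beta> :: (nat \<Rightarrow> real ^ 'n) measure).
           W_stat n \<beta> \<sigma> / sqrt (B_squared CARD('n) \<beta>) \<le> z}
      - cdf std_normal_distribution z\<bar>
    \<le> C / ((1 + \<bar>z\<bar>) powr p * sqrt (real n)))"
proof -
  interpret vector_model \<beta> "TYPE('n)"
    by standard (use assms in auto)
  define k where "k = nat \<lceil>p\<rceil>"
  obtain C where C: "C \<ge> 0" "\<And>n z. 1 \<le> n \<Longrightarrow>
      \<bar>measure (gibbs n) {\<sigma> \<in> space (gibbs n). W_stat n \<beta> \<sigma> / B \<le> z} - \<Phi> z\<bar> \<le> C / ((1 + \<bar>z\<bar>) ^ k * sqrt (real n))"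
    using nonuniform_berry_esseen[of k] by blast
  have "C / ((1 + \<bar>z\<bar>) ^ k * sqrt (real n)) \<le> C / ((1 + \<bar>z\<bar>) powr p * sqrt (real n))" if n: "1 \<le> n" for n z
  proof -
    have "(1 + \<bar>z\<bar>) powr p \<le> (1 + \<bar>z\<bar>) powr real k"
      by (intro powr_mono) (auto simp: k_def real_nat_ceiling_ge)
    also have "\<dots> = (1 + \<bar>z\<bar>) ^ k" by (intro powr_realpow) auto
    finally have "(1 + \<bar>z\<bar>) powr p * sqrt (real n) \<le> (1 + \<bar>z\<bar>) ^ k * sqrt (real n)"
      by (intro mult_right_mono) auto
    then show ?thesis using n C(1) by (intro divide_left_mono mult_pos_pos) auto
  qed
  then show ?thesis
    using C(2) unfolding B_def by (meson order_trans)
qed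

end
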